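(* Let $r,r'\in\mathbb{Z}_2$, $s\geq 1$ an integer and $\eta\in\mathbb{P}^1(k)$. The following isomorphisms of $D_4$-modules hold. (1) If $s$ is odd, then $P(r')\otimes\Omega^sV(r)\cong P(r')\otimes\Omega^{-s}V(r)\cong sP(r+r')\oplus(s+1)P(r+r'+1)$. (2) If $s$ is even, then $P(r')\otimes\Omega^sV(r)\cong P(r')\otimes\Omega^{-s}V(r)\cong sP(r+r'+1)\oplus(s+1)P(r+r')$. (3) $P(r')\otimes M_s(r,\eta)\cong sP(0)\oplus sP(1)$.
   Context: Let $k$ be an algebraically closed field with $\mathrm{char}(k)\neq 2$. All modules are finite-dimensional left modules; $\otimes=\otimes_k$; $\mathbb{Z}_2=\mathbb{Z}/2\mathbb{Z}$; $nM$ denotes the direct sum of $n$ copies of $M$; $\mathbb{P}^1(k)$ is identified with $k\cup\{\infty\}$; $l(M)$ is the length of $M$. $D_4$ is the $k$-algebra generated by $a,b,c,d$ subject to $ba=-ab$, $db=-bd$, $ca=-ac$, $dc=-cd$, $bc=cb$, $a^2=0$, $b^2=1$, $c^2=1$, $d^2=0$, $da+ad=1-bc$. It is a $16$-dimensional Hopf algebra (isomorphic to the Drinfeld double of Sweedler's 4-dimensional Hopf algebra) with comultiplication $\Delta(a)=a\otimes b+1\otimes a$, $\Delta(b)=b\otimes b$, $\Delta(c)=c\otimes c$, $\Delta(d)=d\otimes c+1\otimes d$, counit $\varepsilon(a)=\varepsilon(d)=0$, $\varepsilon(b)=\varepsilon(c)=1$, antipode $S(a)=-ab$, $S(b)=b$,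 $S(c)=c$, $S(d)=-dc$. Tensor products of $D_4$-modules are $D_4$-modules via $\Delta$. For $r\in\mathbb{Z}_2$, $V(r)$ is the one-dimensional simple module on which $a,d$ act as $0$ and $b,c$ act as $(-1)^r$, and $P(r)$ is the projective cover of $V(r)$ (it is 4-dimensional and is also the injective envelope of $V(r)$). For a module $M$, $\Omega M$ is the kernel of a projective cover $P(M)\to M$ and $\Omega^{-1}M$ is the cokernel of an injective envelope $M\to I(M)$; for $s\geq1$, $\Omega^{s}$ and $\Omega^{-s}$ are the $s$-fold iterates of $\Omega$ and $\Omega^{-1}$. For $r\in\mathbb{Z}_2$, $\eta\in\mathbb{P}^1(k)$, $M_1(r,\eta)$ is the module with basis $v_1,v_2$ where $b,c$ act on $v_1$ as $(-1)^{r+1}$ and on $v_2$ as $(-1)^r$, $av_2=dv_2=0$, and $av_1=v_2$, $dv_1=-\eta v_2$ if $\eta\in k$, while $av_1=0$, $dv_1=v_2$ if $\eta=\infty$. An indecomposable module $M$ of Loewy length $2$ is of $(s,t)$-type if $l(M/\mathrm{soc}(M))=s$ and $l(\mathrm{soc}(M))=t$. For $s\geq1$, $M_s(r,\eta)$ denotes the (known to be unique up to isomorphism) indecomposable module of $(s,s)$-type containing a submodule isomorphic to $M_1(r,\eta)$. *)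

theory Defs
  imports
    "HOL-Library.Z2"
    "HOL-Computational_Algebra.Polynomial"
    "Jordan_Normal_Form.Matrix"
    "Jordan_Normal_Form.Matrix_Kernel"
begin

section \<open>Finite-dimensional modules\<close>

text \<open>
  By the presentation of \<open>D\<^sub>4\<close>, a left \<open>D\<^sub>4\<close>-module structure on a vector space is the same
  thing as four linear operators satisfying the defining relations. A finite-dimensional module is
  represented on the space of column vectors \<open>k\<^sup>n\<close>; up to isomorphism this covers all
  of them, and quantification over all finite-dimensional modules stays within one type.
\<close>

record 'k rep =
  rdim :: nat
  opa :: "'k mat"
  opb :: "'k mat"
  opc :: "'k mat"
  opd :: "'k mat"

definition D4_module :: "'k::field rep \<Rightarrow> bool" where
  "D4_module M \<longleftrightarrow>
     (let n = rdim M; a = opa M; b = opb M; c = opc M; d = opd M in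
        a \<in> carrier_mat n n \<and> b \<in> carrier_mat n n \<and> c \<in> carrier_mat n n \<and> d \<in> carrier_mat n n \<and>
        b * a = - (a * b) \<and> d * b = - (b * d) \<and> c * a = - (a * c) \<and> d * c = - (c * d) \<and>
        b * c = c * b \<and>
        a * a = 0\<^sub>m n n \<and> b * b = 1\<^sub>m n \<and> c * c = 1\<^sub>m n \<and> d * d = 0\<^sub>m n n \<and>
        d * a + a * d = 1\<^sub>m n - b * c)"

abbreviation space :: "'k::field rep \<Rightarrow> 'k vec set" where
  "space M \<equiv> carrier_vec (rdim M)"

abbreviation zero_space :: "'k::field rep \<Rightarrow> 'k vec set" where
  "zero_space M \<equiv> {0\<^sub>v (rdim M)}"

definition hom_D4 :: "'k::field rep \<Rightarrow> 'k rep \<Rightarrow> 'k mat set" where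
  "hom_D4 M N = {f \<in> carrier_mat (rdim N) (rdim M).
     f * opa M = opa N * f \<and> f * opb M = opb N * f \<and>
     f * opc M = opc N * f \<and> f * opd M = opd N * f}"

definition mono_D4 :: "'k::field rep \<Rightarrow> 'k rep \<Rightarrow> 'k mat set" where
  "mono_D4 M N = {f \<in> hom_D4 M N. inj_on ((*\<^sub>v) f) (space M)}"

definition epi_D4 :: "'k::field rep \<Rightarrow> 'k rep \<Rightarrow> 'k mat set" where
  "epi_D4 M N = {f \<in> hom_D4 M N. (*\<^sub>v) f ` space M = space N}"

definition iso_D4 :: "'k::field rep \<Rightarrow> 'k rep \<Rightarrow> bool"  (infix \<open>\<cong>\<^sub>D\<close> 50) where
  "M \<cong>\<^sub>D N \<longleftrightarrow> (\<exists>f \<in> hom_D4 M N. bij_betw ((*\<^sub>v) f) (space M) (space N))"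

section \<open>Direct sums and tensor products\<close>

definition dsum :: "'k::field rep list \<Rightarrow> 'k rep" where
  "dsum Ms = \<lparr>rdim = sum_list (map rdim Ms),
     opa = diag_block_mat (map opa Ms), opb = diag_block_mat (map opb Ms),
     opc = diag_block_mat (map opc Ms), opd = diag_block_mat (map opd Ms)\<rparr>"

definition copies :: "nat \<Rightarrow> 'k::field rep \<Rightarrow> 'k rep" where
  "copies n M = dsum (replicate n M)"

text \<open>Kronecker product: the basis vector \<open>e\<^sub>i \<otimes> e\<^sub>j\<close> of \<open>k\<^sup>m \<otimes> k\<^sup>n\<close> has index \<open>i * n + j\<close>.\<close>

definition kron :: "'k::field mat \<Rightarrow> 'k mat \<Rightarrow> 'k mat" where
  "kron A B = mat (dim_row A * dim_row B) (dim_col A * dim_col B)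
     (\<lambda>(i, j). A $$ (i div dim_row B, j div dim_col B) * B $$ (i mod dim_row B, j mod dim_col B))"

text \<open>The generators act through \<open>\<Delta>(a) = a \<otimes> b + 1 \<otimes> a\<close>, \<open>\<Delta>(b) = b \<otimes> b\<close>, \<open>\<Delta>(c) = c \<otimes> c\<close>,
  \<open>\<Delta>(d) = d \<otimes> c + 1 \<otimes> d\<close>.\<close>

definition tensor :: "'k::field rep \<Rightarrow> 'k rep \<Rightarrow> 'k rep"  (infixr \<open>\<otimes>\<^sub>D\<close> 70) where
  "M \<otimes>\<^sub>D N = \<lparr>rdim = rdim M * rdim N,
     opa = kron (opa M) (opb N) + kron (1\<^sub>m (rdim M)) (opa N),
     opb = kron (opb M) (opb N),
     opc = kron (opc M) (opc N),
     opd = kron (opd M) (opc N) + kron (1\<^sub>m (rdim M)) (opd N)\<rparr>"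

section \<open>Submodules, socle, Loewy length, length\<close>

definition submodule_D4 :: "'k::field rep \<Rightarrow> 'k vec set \<Rightarrow> bool" where
  "submodule_D4 M U \<longleftrightarrow>
     U \<subseteq> space M \<and> 0\<^sub>v (rdim M) \<in> U \<and>
     (\<forall>u\<in>U. \<forall>v\<in>U. u + v \<in> U) \<and> (\<forall>x. \<forall>u\<in>U. x \<cdot>\<^sub>v u \<in> U) \<and>
     (\<forall>u\<in>U. opa M *\<^sub>v u \<in> U \<and> opb M *\<^sub>v u \<in> U \<and> opc M *\<^sub>v u \<in> U \<and> opd M *\<^sub>v u \<in> U)"

definition maximal_in :: "'k::field rep \<Rightarrow> 'k vec set \<Rightarrow> 'k vec set \<Rightarrow> bool" where
  "maximal_in M W U \<longleftrightarrow>
     submodule_D4 M W \<and> submodule_D4 M U \<and> W \<subset> U \<and>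
     \<not> (\<exists>X. submodule_D4 M X \<and> W \<subset> X \<and> X \<subset> U)"

definition simple_submodule :: "'k::field rep \<Rightarrow> 'k vec set \<Rightarrow> bool" where
  "simple_submodule M U \<longleftrightarrow>
     submodule_D4 M U \<and> U \<noteq> zero_space M \<and>
     (\<forall>X. submodule_D4 M X \<and> X \<subseteq> U \<longrightarrow> X = zero_space M \<or> X = U)"

text \<open>The sum of all simple submodules, i.e. the least submodule containing them.\<close>

definition soc :: "'k::field rep \<Rightarrow> 'k vec set" where
  "soc M = \<Inter> {X. submodule_D4 M X \<and> (\<forall>U. simple_submodule M U \<longrightarrow> U \<subseteq> X)}"

text \<open>The radical of the submodule \<open>U\<close> of \<open>M\<close>.\<close>

definition rad :: "'k::field rep \<Rightarrow> 'k vec set \<Rightarrow> 'k vec set" where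
  "rad M U = U \<inter> \<Inter> {W. maximal_in M W U}"

definition loewy_length :: "'k::field rep \<Rightarrow> nat" where
  "loewy_length M = (LEAST n. (rad M ^^ n) (space M) = zero_space M)"

definition has_length :: "'k::field rep \<Rightarrow> nat \<Rightarrow> bool" where
  "has_length M n \<longleftrightarrow>
     (\<exists>F. F 0 = zero_space M \<and> F n = space M \<and> (\<forall>i<n. maximal_in M (F i) (F (Suc i))))"

definition indecomposable :: "'k::field rep \<Rightarrow> bool" where
  "indecomposable M \<longleftrightarrow> D4_module M \<and> rdim M \<noteq> 0 \<and>
     (\<forall>X Y. D4_module X \<and> D4_module Y \<and> M \<cong>\<^sub>D dsum [X, Y] \<longrightarrow> rdim X = 0 \<or> rdim Y = 0)"

text \<open>\<open>S\<close> is \<open>soc M\<close> regarded as a module in its own right, \<open>Q\<close> is \<open>M / soc M\<close>.\<close>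

definition is_type :: "'k::field rep \<Rightarrow> nat \<Rightarrow> nat \<Rightarrow> bool" where
  "is_type M s t \<longleftrightarrow> indecomposable M \<and> loewy_length M = 2 \<and>
     (\<exists>S i. D4_module S \<and> i \<in> mono_D4 S M \<and> (*\<^sub>v) i ` space S = soc M \<and> has_length S t) \<and>
     (\<exists>Q p. D4_module Q \<and> p \<in> epi_D4 M Q \<and> mat_kernel p = soc M \<and> has_length Q s)"

section \<open>Projective covers, injective envelopes, syzygies\<close>

definition projective :: "'k::field rep \<Rightarrow> bool" where
  "projective P \<longleftrightarrow> D4_module P \<and>
     (\<forall>X Y. \<forall>g \<in> epi_D4 X Y. \<forall>f \<in> hom_D4 P Y. D4_module X \<and> D4_module Y \<longrightarrow>
        (\<exists>h \<in> hom_D4 P X. g * h = f))"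

definition injective :: "'k::field rep \<Rightarrow> bool" where
  "injective I \<longleftrightarrow> D4_module I \<and>
     (\<forall>X Y. \<forall>g \<in> mono_D4 X Y. \<forall>f \<in> hom_D4 X I. D4_module X \<and> D4_module Y \<longrightarrow>
        (\<exists>h \<in> hom_D4 Y I. h * g = f))"

text \<open>The kernel of \<open>p\<close> is superfluous in \<open>P\<close>.\<close>

definition projective_cover :: "'k::field rep \<Rightarrow> 'k mat \<Rightarrow> 'k rep \<Rightarrow> bool" where
  "projective_cover P p M \<longleftrightarrow> projective P \<and> D4_module M \<and> p \<in> epi_D4 P M \<and>
     (\<forall>U. submodule_D4 P U \<and> {u + w | u w. u \<in> U \<and> w \<in> mat_kernel p} = space P \<longrightarrow> U = space P)"

text \<open>The image of \<open>i\<close> is essential in \<open>I\<close>.\<close>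

definition injective_envelope :: "'k::field rep \<Rightarrow> 'k mat \<Rightarrow> 'k rep \<Rightarrow> bool" where
  "injective_envelope I i M \<longleftrightarrow> injective I \<and> D4_module M \<and> i \<in> mono_D4 M I \<and>
     (\<forall>U. submodule_D4 I U \<and> U \<inter> (*\<^sub>v) i ` space M = zero_space I \<longrightarrow> U = zero_space I)"

text \<open>
  \<open>\<Omega>M\<close> and \<open>\<Omega>\<^sup>-\<^sup>1M\<close> are determined only up to isomorphism, so they are given as relations:
  \<open>is_Omega M K\<close> says that \<open>K\<close> is (isomorphic to) \<open>\<Omega>M\<close>, and the iterates
  \<open>\<Omega>\<^sup>sM\<close> are given by the relational power \<open>is_Omega ^^ s\<close>.
\<close>

definition is_Omega :: "'k::field rep \<Rightarrow> 'k rep \<Rightarrow> bool" where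
  "is_Omega M K \<longleftrightarrow> D4_module K \<and>
     (\<exists>P p i. projective_cover P p M \<and> i \<in> mono_D4 K P \<and> (*\<^sub>v) i ` space K = mat_kernel p)"

definition is_Omega_inv :: "'k::field rep \<Rightarrow> 'k rep \<Rightarrow> bool" where
  "is_Omega_inv M C \<longleftrightarrow> D4_module C \<and>
     (\<exists>I i p. injective_envelope I i M \<and> p \<in> epi_D4 I C \<and> mat_kernel p = (*\<^sub>v) i ` space M)"

section \<open>The modules \<open>V(r)\<close>, \<open>P(r)\<close>, \<open>M\<^sub>1(r, \<eta>)\<close> and \<open>M\<^sub>s(r, \<eta>)\<close>\<close>

text \<open>\<open>\<int>\<^sub>2\<close> is the type \<open>bit\<close>; \<open>pow_neg1 r\<close> is \<open>(-1)\<^sup>r\<close>.\<close>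

definition pow_neg1 :: "bit \<Rightarrow> 'k::field" where
  "pow_neg1 r = (if r = 0 then 1 else - 1)"

definition simple_V :: "bit \<Rightarrow> 'k::field rep" where
  "simple_V r = \<lparr>rdim = 1, opa = 0\<^sub>m 1 1, opb = pow_neg1 r \<cdot>\<^sub>m 1\<^sub>m 1, opc = pow_neg1 r \<cdot>\<^sub>m 1\<^sub>m 1, opd = 0\<^sub>m 1 1\<rparr>"

definition is_P :: "bit \<Rightarrow> 'k::field rep \<Rightarrow> bool" where
  "is_P r P \<longleftrightarrow> (\<exists>p. projective_cover P p (simple_V r))"

datatype 'k proj_line = Fin 'k | Infty

text \<open>Matrices act on columns, with \<open>v\<^sub>1 = (1, 0)\<close> and \<open>v\<^sub>2 = (0, 1)\<close>. \<open>M\<^sub>s(r, \<eta>)\<close> is again determined up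
  to isomorphism: \<open>is_M s r \<eta> M\<close> says that \<open>M\<close> is one of its representatives.\<close>

fun M_one :: "bit \<Rightarrow> 'k::field proj_line \<Rightarrow> 'k rep" where
  "M_one r (Fin \<eta>) = \<lparr>rdim = 2,
     opa = mat_of_rows_list 2 [[0, 0], [1, 0]],
     opb = mat_of_rows_list 2 [[pow_neg1 (r + 1), 0], [0, pow_neg1 r]],
     opc = mat_of_rows_list 2 [[pow_neg1 (r + 1), 0], [0, pow_neg1 r]],
     opd = mat_of_rows_list 2 [[0, 0], [- \<eta>, 0]]\<rparr>"
| "M_one r Infty = \<lparr>rdim = 2,
     opa = 0\<^sub>m 2 2,
     opb = mat_of_rows_list 2 [[pow_neg1 (r + 1), 0], [0, pow_neg1 r]],
     opc = mat_of_rows_list 2 [[pow_neg1 (r + 1), 0], [0, pow_neg1 r]],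
     opd = mat_of_rows_list 2 [[0, 0], [1, 0]]\<rparr>"

definition is_M :: "nat \<Rightarrow> bit \<Rightarrow> 'k::field proj_line \<Rightarrow> 'k rep \<Rightarrow> bool" where
  "is_M s r \<eta> M \<longleftrightarrow> is_type M s s \<and> (\<exists>i. i \<in> mono_D4 (M_one r \<eta>) M)"

end

theory Submission
  imports Defs "Jordan_Normal_Form.Determinant"
begin

text \<open>
  Let \<open>v\<close> generate \<open>P(r')\<close>. A submodule of \<open>P(r') \<otimes> N\<close> containing \<open>v \<otimes> N\<close> is everything, and
  \<open>b\<close> and \<open>c\<close> coincide on the modules \<open>N\<close> considered here, so the vectors \<open>v \<otimes> u\<close>, with \<open>u\<close> running over
  a basis of eigenvectors of \<open>b\<close> in \<open>N\<close>, generate \<open>P(r') \<otimes> N\<close>. Each of them is the image of a generator of some \<open>P(q)\<close>, where \<open>q\<close> depends on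
  the eigenvalue only; this gives a surjection from a direct sum of \<open>dim N\<close> modules \<open>P(q)\<close> onto
  \<open>P(r') \<otimes> N\<close>, bijective because both dimensions are \<open>4 dim N\<close>. So only the dimensions of the two
  eigenspaces of \<open>b\<close> on \<open>N\<close> matter. For \<open>\<Omega>\<^sup>s V(r)\<close> they are read off explicit syzygies, for \<open>\<Omega>\<^sup>-\<^sup>s V(r)\<close>
  off their duals. On \<open>M\<^sub>s(r, \<eta>)\<close> indecomposability forces \<open>b\<close> to act by a sign on the socle and by the
  opposite sign on the quotient, so both dimensions are \<open>s\<close>.
\<close>

text \<open>Once \<open>c = b\<close>, the relation \<open>da + ad = 1 - bc\<close> reads
  \<open>da + ad = 0\<close>, because \<open>b^2 = 1\<close>. Such modules are modules over the
  exterior algebra on \<open>a\<close> and \<open>d\<close>, graded by the sign of \<open>b\<close>,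
  with \<open>a\<close> and \<open>d\<close> odd. Hence the dimension 4 of \<open>P(q)\<close>, with
  basis \<open>v, a v, d v, a d v\<close>, and the linear minimal resolution of a simple module,
  with free terms of rank 1, 2, 3, ... and kernels that have an explicit basis. Since \<Omega> and
  its inverse are only relations, a computation with one explicit cover reaches every representative
  through the uniqueness of projective covers, proved for isomorphic rather than equal targets so
  that it survives iteration. Division by 2 makes linear lifts, sections and retractions compatible
  with \<open>b\<close> and \<open>c\<close>, by averaging over a group of order two. Dimensions
  occur as matrix formats: a subspace is presented as the image of a matrix with a left inverse, and
  dimensions are compared through the formats of one-sided inverses.\<close>

lemma mat_mult_assoc:
  fixes A B C :: "'a::semiring_0 mat"
  assumes "dim_col A = dim_row B" "dim_col B = dim_row C"
  shows "A * B * C = A * (B * C)"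
  by (rule assoc_mult_mat[of _ "dim_row A" "dim_row B" _ "dim_row C" _ "dim_col C"]) (simp_all only: carrier_mat_def
    carrier_dim_vec mem_Collect_eq assms simp_thms)

lemma mat_mult_vec_assoc:
  fixes A B :: "'a::semiring_0 mat"
  assumes "dim_col A = dim_row B" "dim_col B = dim_vec v"
  shows "A * B *\<^sub>v v = A *\<^sub>v (B *\<^sub>v v)"
  by (rule assoc_mult_mat_vec[of _ "dim_row A" "dim_row B" _ "dim_vec v"]) (simp_all only: carrier_mat_def
    carrier_dim_vec mem_Collect_eq assms simp_thms)

lemma mat_mult_add:
  fixes A B C :: "'a::semiring_0 mat"
  assumes "dim_col A = dim_row B" "dim_row B = dim_row C" "dim_col B = dim_col C"
  shows "A * (B + C) = A * B + A * C"
  by (rule mult_add_distrib_mat[of _ "dim_row A" "dim_row B" _ "dim_col C"]) (simp_all only: carrier_mat_def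
    carrier_dim_vec mem_Collect_eq assms simp_thms)

lemma mat_add_mult:
  fixes A B C :: "'a::semiring_0 mat"
  assumes "dim_col A = dim_row C" "dim_row A = dim_row B" "dim_col B = dim_row C"
  shows "(A + B) * C = A * C + B * C"
  by (rule add_mult_distrib_mat[of _ "dim_row A" "dim_row C" _ _ "dim_col C"]) (simp_all only: carrier_mat_def
    carrier_dim_vec mem_Collect_eq assms simp_thms)

lemma mat_mult_minus:
  fixes A B C :: "'a::ring mat"
  assumes "dim_col A = dim_row B" "dim_row B = dim_row C" "dim_col B = dim_col C"
  shows "A * (B - C) = A * B - A * C"
  by (rule mult_minus_distrib_mat[of _ "dim_row A" "dim_row B" _ "dim_col C"]) (simp_all only: carrier_mat_def
    carrier_dim_vec mem_Collect_eq assms simp_thms)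

lemma mat_minus_mult:
  fixes A B C :: "'a::ring mat"
  assumes "dim_col A = dim_row C" "dim_row A = dim_row B" "dim_col B = dim_row C"
  shows "(A - B) * C = A * C - B * C"
  by (rule minus_mult_distrib_mat[of _ "dim_row A" "dim_row C" _ _ "dim_col C"]) (simp_all only: carrier_mat_def
    carrier_dim_vec mem_Collect_eq assms simp_thms)

lemma mat_mult_smult:
  fixes A B :: "'a::comm_semiring_0 mat"
  assumes "dim_col A = dim_row B"
  shows "A * (x \<cdot>\<^sub>m B) = x \<cdot>\<^sub>m (A * B)"
  by (rule mult_smult_distrib[of _ "dim_row A" "dim_row B" _ "dim_col B"]) (simp_all only: carrier_mat_def
    carrier_dim_vec mem_Collect_eq assms simp_thms)

lemma mat_smult_mult:
  fixes A B :: "'a::comm_semiring_0 mat"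
  assumes "dim_col A = dim_row B"
  shows "(x \<cdot>\<^sub>m A) * B = x \<cdot>\<^sub>m (A * B)"
  by (rule mult_smult_assoc_mat[of _ "dim_row A" "dim_row B" _ "dim_col B"]) (simp_all only: carrier_mat_def
    carrier_dim_vec mem_Collect_eq assms simp_thms)

lemma mat_uminus_mult:
  fixes A B :: "'a::ring mat"
  assumes "dim_col A = dim_row B"
  shows "(- A) * B = - (A * B)" and "A * (- B) = - (A * B)"
  using assms by auto

lemma mat_mult_one:
  fixes A :: "'a::semiring_1 mat"
  shows "dim_col A = n \<Longrightarrow> A * 1\<^sub>m n = A" and "dim_row A = n \<Longrightarrow> 1\<^sub>m n * A = A"
  by auto

lemma mat_mult_zero:
  fixes A :: "'a::semiring_0 mat"
  shows "dim_col A = n \<Longrightarrow> A * 0\<^sub>m n m = 0\<^sub>m (dim_row A) m"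
    and "dim_row A = n \<Longrightarrow> 0\<^sub>m m n * A = 0\<^sub>m m (dim_col A)"
  by (auto intro!: right_mult_zero_mat left_mult_zero_mat)

text \<open>The side conditions are equations between dimensions rather than carrier memberships, so
  rewriting can evaluate them without guessing the formats of the factors.\<close>

lemmas mat_ring = mat_mult_assoc mat_mult_add mat_add_mult mat_mult_minus mat_minus_mult
  mat_mult_smult mat_smult_mult mat_uminus_mult mat_mult_one mat_mult_zero

lemma mat_vec_add:
  fixes A :: "'a::semiring_0 mat"
  assumes "dim_col A = dim_vec v" "dim_vec v = dim_vec w"
  shows "A *\<^sub>v (v + w) = A *\<^sub>v v + A *\<^sub>v w"
  by (rule mult_add_distrib_mat_vec[of _ "dim_row A" "dim_vec v"]) (simp_all only: carrier_mat_def carrier_dim_vec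
    mem_Collect_eq assms simp_thms)

lemma mat_vec_minus:
  fixes A :: "'a::ring mat"
  assumes "dim_col A = dim_vec v" "dim_vec v = dim_vec w"
  shows "A *\<^sub>v (v - w) = A *\<^sub>v v - A *\<^sub>v w"
  by (rule mult_minus_distrib_mat_vec[of _ "dim_row A" "dim_vec v"]) (simp_all only: carrier_mat_def carrier_dim_vec
    mem_Collect_eq assms simp_thms)

lemma mat_vec_smult:
  fixes A :: "'a::field mat"
  assumes "dim_col A = dim_vec v"
  shows "A *\<^sub>v (x \<cdot>\<^sub>v v) = x \<cdot>\<^sub>v (A *\<^sub>v v)"
  by (rule mult_mat_vec[of _ "dim_row A" "dim_col A"]) (simp_all only: carrier_mat_def carrier_dim_vec
    mem_Collect_eq assms simp_thms)

lemma mat_add_vec: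
  fixes A B :: "'a::semiring_0 mat"
  assumes "dim_col A = dim_vec v" "dim_row A = dim_row B" "dim_col B = dim_vec v"
  shows "(A + B) *\<^sub>v v = A *\<^sub>v v + B *\<^sub>v v"
  by (rule add_mult_distrib_mat_vec[of _ "dim_row A" "dim_vec v"]) (simp_all only: carrier_mat_def carrier_dim_vec
    mem_Collect_eq assms simp_thms)

lemma mat_minus_vec:
  fixes A B :: "'a::ring mat"
  assumes "dim_col A = dim_vec v" "dim_row A = dim_row B" "dim_col B = dim_vec v"
  shows "(A - B) *\<^sub>v v = A *\<^sub>v v - B *\<^sub>v v"
  by (rule minus_mult_distrib_mat_vec[of _ "dim_row A" "dim_vec v"]) (simp_all only: carrier_mat_def carrier_dim_vec
    mem_Collect_eq assms simp_thms)

lemma mat_smult_vec: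
  fixes A :: "'a::comm_semiring_0 mat"
  assumes "dim_col A = dim_vec v"
  shows "(x \<cdot>\<^sub>m A) *\<^sub>v v = x \<cdot>\<^sub>v (A *\<^sub>v v)"
  using assms by (intro eq_vecI) (auto simp: scalar_prod_def sum_distrib_left mult.assoc)

lemma mat_uminus_vec:
  fixes A :: "'a::ring mat"
  assumes "dim_col A = dim_vec v"
  shows "(- A) *\<^sub>v v = - (A *\<^sub>v v)"
  using assms by auto

lemma mat_vec_zero:
  fixes A :: "'a::semiring_0 mat"
  shows "dim_col A = n \<Longrightarrow> A *\<^sub>v 0\<^sub>v n = 0\<^sub>v (dim_row A)"
    and "dim_vec v = n \<Longrightarrow> 0\<^sub>m m n *\<^sub>v v = 0\<^sub>v m"
  by (auto intro!: eq_vecI simp: scalar_prod_def)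

lemma mat_one_vec: "dim_vec v = n \<Longrightarrow> 1\<^sub>m n *\<^sub>v v = (v :: 'a::semiring_1 vec)"
  by (auto intro: one_mult_mat_vec)

lemmas mat_vec = mat_mult_vec_assoc mat_vec_add mat_vec_minus mat_vec_smult mat_add_vec
  mat_minus_vec mat_smult_vec mat_uminus_vec mat_vec_zero mat_one_vec

section \<open>Linear algebra: subspaces, split injections and one-sided inverses\<close>

lemma mat_mult_unit_vec:
  fixes A :: "'a::semiring_1 mat"
  assumes "A \<in> carrier_mat m n" "j < n"
  shows "A *\<^sub>v unit_vec n j = col A j"
proof (rule eq_vecI)
  fix i assume "i < dim_vec (col A j)"
  then show "(A *\<^sub>v unit_vec n j) $ i = col A j $ i"
    using assms by (simp add: scalar_prod_right_unit)
qed (insert assms(1,2), simp_all)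

lemma eq_mat_by_vec:
  fixes A B :: "'a::semiring_1 mat"
  assumes "A \<in> carrier_mat m n" "B \<in> carrier_mat m n"
    and "\<And>v. v \<in> carrier_vec n \<Longrightarrow> A *\<^sub>v v = B *\<^sub>v v"
  shows "A = B"
proof (rule mat_col_eqI)
  fix j assume j: "j < dim_col B"
  have "A *\<^sub>v unit_vec n j = B *\<^sub>v unit_vec n j" by (rule assms(3)) simp
  then show "col A j = col B j"
    using mat_mult_unit_vec[OF assms(1)] mat_mult_unit_vec[OF assms(2)] assms(2) j by simp
qed (insert assms(1,2), simp_all)

text \<open>Were \<open>n < d\<close>, zero rows below \<open>A\<close> and zero columns to the
  right of \<open>B\<close> would give square matrices with the same product \<open>1\<close>. The
  reversed product would then be \<open>1\<close> as well, although its row \<open>n\<close>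
  vanishes.\<close>

lemma left_inverse_le:
  fixes A B :: "'k::field mat"
  assumes A: "A \<in> carrier_mat n d" and B: "B \<in> carrier_mat d n" and BA: "B * A = 1\<^sub>m d"
  shows "d \<le> n"
proof (rule ccontr)
  assume "\<not> d \<le> n"
  then have nd: "n < d" by simp
  define A' where "A' = four_block_mat A (0\<^sub>m n 0) (0\<^sub>m (d - n) d) (0\<^sub>m (d - n) 0)"
  define B' where "B' = four_block_mat B (0\<^sub>m d (d - n)) (0\<^sub>m 0 n) (0\<^sub>m 0 (d - n))"
  have A': "A' \<in> carrier_mat d d" and B': "B' \<in> carrier_mat d d"
    using A B nd by (auto simp: A'_def B'_def)
  have "B' * A' = four_block_mat (B * A + 0\<^sub>m d (d - n) * 0\<^sub>m (d - n) d) (B * 0\<^sub>m n 0 + 0\<^sub>m d (d - n) * 0\<^sub>m (d - n) 0)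
     (0\<^sub>m 0 n * A + 0\<^sub>m 0 (d - n) * 0\<^sub>m (d - n) d) (0\<^sub>m 0 n * 0\<^sub>m n 0 + 0\<^sub>m 0 (d - n) * 0\<^sub>m (d - n) 0)"
    unfolding A'_def B'_def using A B by (intro mult_four_block_mat) auto
  also have "\<dots> = 1\<^sub>m d"
    using A B BA by (intro eq_matI) auto
  finally have "A' * B' = 1\<^sub>m d" using mat_mult_left_right_inverse[OF B' A'] by simp
  moreover have "(A' * B') $$ (n, n) = 0"
    using A B nd by (auto simp: A'_def B'_def scalar_prod_def)
  ultimately show False using nd by simp
qed

lemma two_sided_inverse_dim:
  fixes A B :: "'k::field mat"
  assumes "A \<in> carrier_mat n d" "B \<in> carrier_mat d n" "B * A = 1\<^sub>m d" "A * B = 1\<^sub>m n"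
  shows "d = n"
  using left_inverse_le[OF assms(1-3)] left_inverse_le[OF assms(2,1,4)] by simp

definition lin_subspace :: "nat \<Rightarrow> 'k::field vec set \<Rightarrow> bool" where
  "lin_subspace n U \<longleftrightarrow> U \<subseteq> carrier_vec n \<and> 0\<^sub>v n \<in> U \<and>
     (\<forall>u\<in>U. \<forall>v\<in>U. u + v \<in> U) \<and> (\<forall>x. \<forall>u\<in>U. x \<cdot>\<^sub>v u \<in> U)"

lemma lin_subspaceD:
  assumes "lin_subspace n U"
  shows "u \<in> U \<Longrightarrow> u \<in> carrier_vec n" "0\<^sub>v n \<in> U"
    "u \<in> U \<Longrightarrow> v \<in> U \<Longrightarrow> u + v \<in> U" "u \<in> U \<Longrightarrow> x \<cdot>\<^sub>v u \<in> U"
    "u \<in> U \<Longrightarrow> v \<in> U \<Longrightarrow> u - v \<in> U"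
proof -
  show *: "u \<in> U \<Longrightarrow> u \<in> carrier_vec n" "0\<^sub>v n \<in> U"
    "u \<in> U \<Longrightarrow> v \<in> U \<Longrightarrow> u + v \<in> U" "u \<in> U \<Longrightarrow> x \<cdot>\<^sub>v u \<in> U" for u v x
    using assms by (auto simp: lin_subspace_def)
  assume u: "u \<in> U" and v: "v \<in> U"
  have "u + (- 1) \<cdot>\<^sub>v v \<in> U" using * u v by blast
  also have "u + (- 1) \<cdot>\<^sub>v v = u - v" using *(1)[OF u] *(1)[OF v] by (intro eq_vecI) auto
  finally show "u - v \<in> U" .
qed

lemma lin_subspace_image:
  assumes A: "A \<in> carrier_mat n d"
  shows "lin_subspace n ((*\<^sub>v) A ` carrier_vec d)"
  unfolding lin_subspace_def
proof (intro conjI ballI allI)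
  show "(*\<^sub>v) A ` carrier_vec d \<subseteq> carrier_vec n" using A by auto
  show "0\<^sub>v n \<in> (*\<^sub>v) A ` carrier_vec d"
    by (rule image_eqI[of _ _ "0\<^sub>v d"]) (use A in \<open>auto simp: mat_vec_zero\<close>)
  fix u v assume "u \<in> (*\<^sub>v) A ` carrier_vec d" "v \<in> (*\<^sub>v) A ` carrier_vec d"
  then obtain x y where "x \<in> carrier_vec d" "y \<in> carrier_vec d" "u = A *\<^sub>v x" "v = A *\<^sub>v y" by auto
  then show "u + v \<in> (*\<^sub>v) A ` carrier_vec d"
    by (intro image_eqI[of _ _ "x + y"]) (use A in \<open>auto simp: mat_vec_add\<close>)
next
  fix c u assume "u \<in> (*\<^sub>v) A ` carrier_vec d"
  then obtain x where "x \<in> carrier_vec d" "u = A *\<^sub>v x" by auto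
  then show "c \<cdot>\<^sub>v u \<in> (*\<^sub>v) A ` carrier_vec d"
    by (intro image_eqI[of _ _ "c \<cdot>\<^sub>v x"]) (use A in \<open>auto simp: mat_vec_smult\<close>)
qed

text \<open>The space is the direct sum of the image of \<open>A\<close> and the kernel of
  \<open>B\<close>. The kernel component \<open>w\<close> of \<open>u\<close> is nonzero because
  \<open>u\<close> lies outside the image; it becomes the new column of \<open>A\<close>. Carrying a
  left inverse along turns linear independence of the columns into an equation.\<close>

lemma split_extend:
  fixes A B :: "'k::field mat"
  assumes A: "A \<in> carrier_mat n d" and B: "B \<in> carrier_mat d n" and BA: "B * A = 1\<^sub>m d"
    and u: "u \<in> carrier_vec n" "u \<notin> (*\<^sub>v) A ` carrier_vec d"
  obtains A' B' where "A' \<in> carrier_mat n (d + 1)" "B' \<in> carrier_mat (d + 1) n" "B' * A' = 1\<^sub>m (d + 1)"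
    "(*\<^sub>v) A' ` carrier_vec (d + 1) = {y + k \<cdot>\<^sub>v u | y k. y \<in> (*\<^sub>v) A ` carrier_vec d}"
proof -
  define w where "w = u - A *\<^sub>v (B *\<^sub>v u)"
  have ABu: "A *\<^sub>v (B *\<^sub>v u) \<in> carrier_vec n" using A B u by auto
  have wc: "w \<in> carrier_vec n" unfolding w_def using u(1) ABu by simp
  have uw: "u = w + A *\<^sub>v (B *\<^sub>v u)" unfolding w_def using u(1) ABu A
    by (intro eq_vecI) (auto simp del: index_mult_mat_vec)
  have "w \<noteq> 0\<^sub>v n"
  proof
    assume "w = 0\<^sub>v n"
    then have "u = 0\<^sub>v n + A *\<^sub>v (B *\<^sub>v u)" using uw by metis
    also have "\<dots> = A *\<^sub>v (B *\<^sub>v u)" using ABu by simp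
    finally have "u = A *\<^sub>v (B *\<^sub>v u)" .
    moreover have "A *\<^sub>v (B *\<^sub>v u) \<in> (*\<^sub>v) A ` carrier_vec d" using B u(1) by auto
    ultimately show False using u(2) by simp
  qed
  then obtain k where k: "k < n" "w $ k \<noteq> 0" using wc by (metis carrier_vecD eq_vecI index_zero_vec)
  have Bw: "B *\<^sub>v w = 0\<^sub>v d"
  proof -
    have "B *\<^sub>v w = B *\<^sub>v u - (B * A) *\<^sub>v (B *\<^sub>v u)" unfolding w_def using A B u(1)
      by (simp add: mat_vec)
    then show ?thesis using B u(1) unfolding BA by (auto simp: mat_vec)
  qed
  \<comment> \<open>The new row of the left inverse: a row of the projection \<open>1 - A B\<close>,
    at a position where \<open>w\<close> is nonzero, rescaled to take the value 1 on
    \<open>w\<close>. It kills the old columns because \<open>(1 - A B) A = 0\<close>.\<close>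
  define \<rho> where "\<rho> = (1 / w $ k) \<cdot>\<^sub>m (mat_of_row (row (1\<^sub>m n - A * B) k))"
  define C where "C = mat_of_cols n [w]"
  have \<rho>c: "\<rho> \<in> carrier_mat 1 n" unfolding \<rho>_def using A B by auto
  have Cc: "C \<in> carrier_mat n 1" unfolding C_def by auto
  have e: "(1\<^sub>m n - A * B) * A = 0\<^sub>m n d" using A B BA by (simp add: mat_ring)
  have e2: "(1\<^sub>m n - A * B) *\<^sub>v w = w" using A B BA wc by (simp add: mat_vec Bw)
  have "\<rho> * A = 0\<^sub>m 1 d"
  proof (rule eq_matI)
    fix i j assume ij: "i < dim_row (0\<^sub>m 1 d :: 'k mat)" "j < dim_col (0\<^sub>m 1 d :: 'k mat)"
    have "((1\<^sub>m n - A * B) * A) $$ (k, j) = 0" unfolding e using k ij by simp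
    then have "row (1\<^sub>m n - A * B) k \<bullet> col A j = 0" using k ij A B by simp
    then show "(\<rho> * A) $$ (i, j) = 0\<^sub>m 1 d $$ (i, j)" using ij A B k unfolding \<rho>_def
      by (simp add: mat_smult_mult)
  qed (use \<rho>c A in auto)
  moreover have "\<rho> * C = 1\<^sub>m 1"
  proof (rule eq_matI)
    fix i j assume ij: "i < dim_row (1\<^sub>m 1 :: 'k mat)" "j < dim_col (1\<^sub>m 1 :: 'k mat)"
    have "((1\<^sub>m n - A * B) *\<^sub>v w) $ k = w $ k" unfolding e2 by simp
    then have "row (1\<^sub>m n - A * B) k \<bullet> w = w $ k" using k A B by simp
    moreover have "col C 0 = w" unfolding C_def using wc by simp
    ultimately show "(\<rho> * C) $$ (i, j) = 1\<^sub>m 1 $$ (i, j)" using ij A B k Cc unfolding \<rho>_def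
      by (simp add: mat_smult_mult)
  qed (use \<rho>c Cc in auto)
  moreover have "B * C = 0\<^sub>m d 1"
  proof (rule eq_matI)
    fix i j assume ij: "i < dim_row (0\<^sub>m d 1 :: 'k mat)" "j < dim_col (0\<^sub>m d 1 :: 'k mat)"
    have "(B *\<^sub>v w) $ i = 0" unfolding Bw using ij by simp
    moreover have "col C 0 = w" unfolding C_def using wc by simp
    ultimately show "(B * C) $$ (i, j) = 0\<^sub>m d 1 $$ (i, j)" using ij B Cc by simp
  qed (use B Cc in auto)
  ultimately have prod: "four_block_mat B (0\<^sub>m d 0) \<rho> (0\<^sub>m 1 0) * four_block_mat A C (0\<^sub>m 0 d) (0\<^sub>m 0 1) = 1\<^sub>m (d + 1)"
    using A B Cc \<rho>c BA by (subst mult_four_block_mat[of _ d n _ 0 _ 1 _ _ d _ 1]) auto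
  let ?A' = "four_block_mat A C (0\<^sub>m 0 d) (0\<^sub>m 0 1)"
  have A'x: "?A' *\<^sub>v (x1 @\<^sub>v x2) = A *\<^sub>v x1 + (x2 $ 0) \<cdot>\<^sub>v w" if x: "x1 \<in> carrier_vec d" "x2 \<in> carrier_vec 1" for x1 x2
  proof -
    have "?A' *\<^sub>v (x1 @\<^sub>v x2) = (A *\<^sub>v x1 + C *\<^sub>v x2) @\<^sub>v (0\<^sub>m 0 d *\<^sub>v x1 + 0\<^sub>m 0 1 *\<^sub>v x2)"
      by (rule four_block_mat_mult_vec[OF A Cc _ _ x]) auto
    also have "\<dots> = A *\<^sub>v x1 + (x2 $ 0) \<cdot>\<^sub>v w"
      using A Cc x wc by (intro eq_vecI) (auto simp: append_vec_def scalar_prod_def C_def mat_of_cols_def)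
    finally show ?thesis .
  qed
  have img: "(*\<^sub>v) ?A' ` carrier_vec (d + 1) = {y + k \<cdot>\<^sub>v u | y k. y \<in> (*\<^sub>v) A ` carrier_vec d}"
  proof
    show "(*\<^sub>v) ?A' ` carrier_vec (d + 1) \<subseteq> {y + k \<cdot>\<^sub>v u | y k. y \<in> (*\<^sub>v) A ` carrier_vec d}"
    proof
      fix z assume "z \<in> (*\<^sub>v) ?A' ` carrier_vec (d + 1)"
      then obtain x where x: "x \<in> carrier_vec (d + 1)" and z: "z = ?A' *\<^sub>v x" by auto
      define x1 where "x1 = vec_first x d"
      define x2 where "x2 = vec_last x 1"
      have x12: "x = x1 @\<^sub>v x2" "x1 \<in> carrier_vec d" "x2 \<in> carrier_vec 1"
        unfolding x1_def x2_def using vec_first_last_append[OF x] by auto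
      define k where "k = x2 $ 0"
      have y: "x1 - k \<cdot>\<^sub>v (B *\<^sub>v u) \<in> carrier_vec d" using x12(2) B u(1) by auto
      have "z = A *\<^sub>v x1 + k \<cdot>\<^sub>v w" unfolding z x12(1) k_def by (rule A'x[OF x12(2,3)])
      also have "\<dots> = A *\<^sub>v (x1 - k \<cdot>\<^sub>v (B *\<^sub>v u)) + k \<cdot>\<^sub>v u"
        unfolding w_def using A B x12(2) u(1)
        by (simp add: mat_vec_minus mat_vec_smult) (intro eq_vecI; simp add: algebra_simps del: index_mult_mat_vec)
      finally show "z \<in> {y + k \<cdot>\<^sub>v u | y k. y \<in> (*\<^sub>v) A ` carrier_vec d}" using y by blast
    qed
    show "{y + k \<cdot>\<^sub>v u | y k. y \<in> (*\<^sub>v) A ` carrier_vec d} \<subseteq> (*\<^sub>v) ?A' ` carrier_vec (d + 1)"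
    proof
      fix z assume "z \<in> {y + k \<cdot>\<^sub>v u | y k. y \<in> (*\<^sub>v) A ` carrier_vec d}"
      then obtain x k where x: "x \<in> carrier_vec d" and z: "z = A *\<^sub>v x + k \<cdot>\<^sub>v u" by auto
      define x1 where "x1 = x + k \<cdot>\<^sub>v (B *\<^sub>v u)"
      define x2 where "x2 = vec 1 (\<lambda>_. k)"
      have x12: "x1 \<in> carrier_vec d" "x2 \<in> carrier_vec 1" unfolding x1_def x2_def using x B u(1) by auto
      have "?A' *\<^sub>v (x1 @\<^sub>v x2) = A *\<^sub>v x1 + k \<cdot>\<^sub>v w" using A'x[OF x12] by (simp add: x2_def)
      also have "\<dots> = z" unfolding z x1_def w_def using A B x u(1)
        by (simp add: mat_vec_add mat_vec_smult) (intro eq_vecI; simp add: algebra_simps del: index_mult_mat_vec)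
      finally have eq: "?A' *\<^sub>v (x1 @\<^sub>v x2) = z" .
      show "z \<in> (*\<^sub>v) ?A' ` carrier_vec (d + 1)" unfolding eq[symmetric] by (rule imageI[OF append_carrier_vec[OF x12]])
    qed
  qed
  have cA: "?A' \<in> carrier_mat n (d + 1)" and cB: "four_block_mat B (0\<^sub>m d 0) \<rho> (0\<^sub>m 1 0) \<in> carrier_mat (d + 1) n"
    using A B Cc \<rho>c by auto
  show thesis by (rule that[OF cA cB prod img])
qed

text \<open>Take \<open>A\<close> with the largest possible number \<open>d\<close> of columns; a vector of \<open>U\<close> outside its
  image would allow one more.\<close>

lemma lin_subspace_split:
  fixes U :: "'k::field vec set"
  assumes U: "lin_subspace n U"
  obtains d A B where "A \<in> carrier_mat n d" "B \<in> carrier_mat d n" "B * A = 1\<^sub>m d"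
    "(*\<^sub>v) A ` carrier_vec d = U"
proof -
  define Q where "Q d \<longleftrightarrow> (\<exists>A B. A \<in> carrier_mat n d \<and> B \<in> carrier_mat d n \<and> B * A = 1\<^sub>m d \<and>
    (*\<^sub>v) A ` carrier_vec d \<subseteq> U)" for d
  have "Q 0" unfolding Q_def
    by (rule exI[of _ "0\<^sub>m n 0"], rule exI[of _ "0\<^sub>m 0 n"])
      (use lin_subspaceD(2)[OF U] in \<open>auto intro!: eq_matI simp: mat_vec_zero\<close>)
  moreover have "\<forall>d. Q d \<longrightarrow> d \<le> n" unfolding Q_def by (blast intro: left_inverse_le)
  ultimately obtain d where Qd: "Q d" and max: "\<And>d'. Q d' \<Longrightarrow> d' \<le> d"
    using Nat.ex_has_greatest_nat[of Q 0 n] by blast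
  then obtain A B where A: "A \<in> carrier_mat n d" and B: "B \<in> carrier_mat d n" and BA: "B * A = 1\<^sub>m d"
    and im: "(*\<^sub>v) A ` carrier_vec d \<subseteq> U" unfolding Q_def by auto
  have "U \<subseteq> (*\<^sub>v) A ` carrier_vec d"
  proof
    fix u assume u: "u \<in> U"
    show "u \<in> (*\<^sub>v) A ` carrier_vec d"
    proof (rule ccontr)
      assume nu: "u \<notin> (*\<^sub>v) A ` carrier_vec d"
      obtain A' B' where A': "A' \<in> carrier_mat n (d + 1)" "B' \<in> carrier_mat (d + 1) n" "B' * A' = 1\<^sub>m (d + 1)"
        "(*\<^sub>v) A' ` carrier_vec (d + 1) = {y + k \<cdot>\<^sub>v u | y k. y \<in> (*\<^sub>v) A ` carrier_vec d}"
        by (rule split_extend[OF A B BA lin_subspaceD(1)[OF U u] nu])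
      have "(*\<^sub>v) A' ` carrier_vec (d + 1) \<subseteq> U"
        unfolding A'(4) using im lin_subspaceD(3,4)[OF U] u by fast
      then have "Q (d + 1)" unfolding Q_def using A'(1-3) by (intro exI conjI)
      from max[OF this] show False by simp
    qed
  qed
  with im have "(*\<^sub>v) A ` carrier_vec d = U" by (rule subset_antisym)
  then show thesis by (rule that[OF A B BA])
qed

lemma surj_right_inverse:
  fixes g :: "'k::field mat"
  assumes g: "g \<in> carrier_mat m n" and s: "(*\<^sub>v) g ` carrier_vec n = carrier_vec m"
  obtains R where "R \<in> carrier_mat n m" "g * R = 1\<^sub>m m"
proof -
  have "\<forall>j. \<exists>x. j < m \<longrightarrow> x \<in> carrier_vec n \<and> g *\<^sub>v x = unit_vec m j"
    using s by (metis imageE unit_vec_carrier)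
  then obtain x where x: "\<And>j. j < m \<Longrightarrow> x j \<in> carrier_vec n" "\<And>j. j < m \<Longrightarrow> g *\<^sub>v x j = unit_vec m j"
    by metis
  define R where "R = mat_of_cols n (map x [0..<m])"
  have R: "R \<in> carrier_mat n m" unfolding R_def by auto
  have "g * R = 1\<^sub>m m"
  proof (rule mat_col_eqI)
    fix j assume "j < dim_col (1\<^sub>m m :: 'k mat)"
    then have j: "j < m" by simp
    have "col (g * R) j = g *\<^sub>v col R j" by (rule col_mult2[OF g R j])
    also have "col R j = x j" unfolding R_def using j x by simp
    finally show "col (g * R) j = col (1\<^sub>m m) j" using x j by simp
  qed (use g R in auto)
  with R that show thesis by blast
qed

text \<open>A split injection \<open>A\<close> with the same image as \<open>g\<close> reduces the
  claim to \<open>B g\<close>, which is surjective and so has a right inverse \<open>R\<close>. Then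
  \<open>g R = A\<close>, and injectivity of \<open>g\<close> makes \<open>R\<close> a left inverse
  of \<open>B g\<close> too, so \<open>R B\<close> is a left inverse of \<open>g\<close>.\<close>

lemma inj_left_inverse:
  fixes g :: "'k::field mat"
  assumes g: "g \<in> carrier_mat n m" and i: "inj_on ((*\<^sub>v) g) (carrier_vec m)"
  obtains L where "L \<in> carrier_mat m n" "L * g = 1\<^sub>m m"
proof -
  obtain d A B where A: "A \<in> carrier_mat n d" and B: "B \<in> carrier_mat d n" and BA: "B * A = 1\<^sub>m d"
    and im: "(*\<^sub>v) A ` carrier_vec d = (*\<^sub>v) g ` carrier_vec m"
    using lin_subspace_split[OF lin_subspace_image[OF g]] by metis
  have "(*\<^sub>v) (B * g) ` carrier_vec m = (*\<^sub>v) B ` ((*\<^sub>v) g ` carrier_vec m)"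
    unfolding image_image using g B by (intro image_cong) (auto simp: mat_vec)
  also have "\<dots> = (*\<^sub>v) (B * A) ` carrier_vec d"
    unfolding im[symmetric] image_image using A B by (intro image_cong) (auto simp: mat_vec)
  also have "\<dots> = carrier_vec d" unfolding BA by (auto simp: mat_one_vec image_iff)
  finally obtain R where R: "R \<in> carrier_mat m d" "(B * g) * R = 1\<^sub>m d"
    using surj_right_inverse[of "B * g" d m] B g by auto
  have AB: "A *\<^sub>v (B *\<^sub>v (g *\<^sub>v x)) = g *\<^sub>v x" if x: "x \<in> carrier_vec m" for x
  proof -
    obtain y where y: "y \<in> carrier_vec d" "g *\<^sub>v x = A *\<^sub>v y" using im x by blast
    have "A *\<^sub>v (B *\<^sub>v (A *\<^sub>v y)) = A *\<^sub>v ((B * A) *\<^sub>v y)" using A B y by (simp add: mat_vec)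
    then show ?thesis using y BA by simp
  qed
  have gR: "g * R = A"
  proof (rule eq_mat_by_vec[of _ n d])
    fix y :: "'k vec" assume y: "y \<in> carrier_vec d"
    have "A *\<^sub>v y = A *\<^sub>v ((B * g * R) *\<^sub>v y)" using R y by simp
    also have "\<dots> = A *\<^sub>v (B *\<^sub>v (g *\<^sub>v (R *\<^sub>v y)))" using g B R(1) y by (simp add: mat_vec)
    also have "\<dots> = (g * R) *\<^sub>v y" using AB[of "R *\<^sub>v y"] g R y by (simp add: mat_vec)
    finally show "(g * R) *\<^sub>v y = A *\<^sub>v y" by simp
  qed (use g R A in auto)
  have "(R * (B * g)) = 1\<^sub>m m"
  proof (rule eq_mat_by_vec[of _ m m])
    fix x :: "'k vec" assume x: "x \<in> carrier_vec m"
    have "g *\<^sub>v ((R * (B * g)) *\<^sub>v x) = (g * R) *\<^sub>v (B *\<^sub>v (g *\<^sub>v x))" using g R(1) B x by (simp add: mat_vec)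
    also have "\<dots> = g *\<^sub>v x" unfolding gR using AB x by simp
    finally have *: "g *\<^sub>v ((R * (B * g)) *\<^sub>v x) = g *\<^sub>v x" .
    have "(R * (B * g)) *\<^sub>v x = x" by (rule inj_onD[OF i *]) (use x R(1) g B in \<open>auto intro!:
      mult_mat_vec_carrier[of _ m m]\<close>)
    then show "(R * (B * g)) *\<^sub>v x = 1\<^sub>m m *\<^sub>v x"
      using x by simp
  qed (use R B g in auto)
  then have "(R * B) * g = 1\<^sub>m m" using R B g by (simp add: mat_ring)
  then show thesis using that[of "R * B"] R B by auto
qed

lemma bij_inverse:
  fixes f :: "'k::field mat"
  assumes f: "f \<in> carrier_mat n m" and b: "bij_betw ((*\<^sub>v) f) (carrier_vec m) (carrier_vec n)"
  obtains g where "g \<in> carrier_mat m n" "g * f = 1\<^sub>m m" "f * g = 1\<^sub>m n" "m = n"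
proof -
  obtain L where L: "L \<in> carrier_mat m n" "L * f = 1\<^sub>m m"
    using inj_left_inverse[OF f] b by (auto simp: bij_betw_def)
  obtain R where R: "R \<in> carrier_mat m n" "f * R = 1\<^sub>m n"
    using surj_right_inverse[OF f] b by (auto simp: bij_betw_def)
  have "L = L * (f * R)" using L R by simp
  also have "\<dots> = (L * f) * R" using L(1) R(1) f by (simp add: mat_mult_assoc)
  finally have "L = R" using L R by simp
  then show thesis using that[of L] L R two_sided_inverse_dim[OF f L(1)] by auto
qed

lemma inverse_bij:
  fixes f g :: "'k::field mat"
  assumes f: "f \<in> carrier_mat n m" and g: "g \<in> carrier_mat m n" "g * f = 1\<^sub>m m" "f * g = 1\<^sub>m n"
  shows "bij_betw ((*\<^sub>v) f) (carrier_vec m) (carrier_vec n)"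
proof (rule bij_betwI[of _ _ _ "(*\<^sub>v) g"])
  fix x :: "'k vec" assume "x \<in> carrier_vec m"
  then have "g *\<^sub>v (f *\<^sub>v x) = (g * f) *\<^sub>v x" using f g
    by (simp add: mat_mult_vec_assoc[symmetric] del: assoc_mult_mat_vec)
  then show "g *\<^sub>v (f *\<^sub>v x) = x" using g \<open>x \<in> carrier_vec m\<close> by simp
next
  fix y :: "'k vec" assume "y \<in> carrier_vec n"
  then have "f *\<^sub>v (g *\<^sub>v y) = (f * g) *\<^sub>v y" using f g
    by (simp add: mat_mult_vec_assoc[symmetric] del: assoc_mult_mat_vec)
  then show "f *\<^sub>v (g *\<^sub>v y) = y" using g \<open>y \<in> carrier_vec n\<close> by simp
qed (use f g in auto)

lemma left_inverse_inj:
  fixes f g :: "'k::field mat"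
  assumes f: "f \<in> carrier_mat n m" and g: "g \<in> carrier_mat m n" "g * f = 1\<^sub>m m"
  shows "inj_on ((*\<^sub>v) f) (carrier_vec m)"
proof (rule inj_on_inverseI[of _ "(*\<^sub>v) g"])
  fix x :: "'k vec" assume "x \<in> carrier_vec m"
  then have "g *\<^sub>v (f *\<^sub>v x) = (g * f) *\<^sub>v x" using f g
    by (simp add: mat_mult_vec_assoc[symmetric] del: assoc_mult_mat_vec)
  then show "g *\<^sub>v (f *\<^sub>v x) = x" using g \<open>x \<in> carrier_vec m\<close> by simp
qed

lemma right_inverse_surj:
  fixes f g :: "'k::field mat"
  assumes f: "f \<in> carrier_mat n m" and g: "g \<in> carrier_mat m n" "f * g = 1\<^sub>m n"
  shows "(*\<^sub>v) f ` carrier_vec m = carrier_vec n"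
proof
  show "carrier_vec n \<subseteq> (*\<^sub>v) f ` carrier_vec m"
  proof
    fix y :: "'k vec" assume y: "y \<in> carrier_vec n"
    then have "f *\<^sub>v (g *\<^sub>v y) = (f * g) *\<^sub>v y" using f g
      by (simp add: mat_mult_vec_assoc[symmetric] del: assoc_mult_mat_vec)
    then show "y \<in> (*\<^sub>v) f ` carrier_vec m" using g y by (intro image_eqI[of _ _ "g *\<^sub>v y"]) auto
  qed
qed (use f in auto)

section \<open>Modules and homomorphisms\<close>

text \<open>The generators are treated as record selectors, so that a fact about all four operators
  is stated and proved once, for a variable \<open>t\<close>.\<close>

definition gens :: "('k::field rep \<Rightarrow> 'k mat) set" where
  "gens = {opa, opb, opc, opd}"

text \<open>The formats without the relations, which is what composing homomorphisms and forming
  direct sums work with.\<close>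

definition rep_carrier :: "'k::field rep \<Rightarrow> bool" where
  "rep_carrier M \<longleftrightarrow> (\<forall>t\<in>gens. t M \<in> carrier_mat (rdim M) (rdim M))"

lemma D4_moduleD:
  assumes "D4_module M"
  shows "rep_carrier M"
    "opa M \<in> carrier_mat (rdim M) (rdim M)" "opb M \<in> carrier_mat (rdim M) (rdim M)"
    "opc M \<in> carrier_mat (rdim M) (rdim M)" "opd M \<in> carrier_mat (rdim M) (rdim M)"
    "opb M * opa M = - (opa M * opb M)" "opd M * opb M = - (opb M * opd M)"
    "opc M * opa M = - (opa M * opc M)" "opd M * opc M = - (opc M * opd M)"
    "opb M * opc M = opc M * opb M"
    "opa M * opa M = 0\<^sub>m (rdim M) (rdim M)" "opb M * opb M = 1\<^sub>m (rdim M)"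
    "opc M * opc M = 1\<^sub>m (rdim M)" "opd M * opd M = 0\<^sub>m (rdim M) (rdim M)"
    "opd M * opa M + opa M * opd M = 1\<^sub>m (rdim M) - opb M * opc M"
  using assms by (simp_all add: D4_module_def Let_def rep_carrier_def gens_def)

lemma rep_carrierD: "rep_carrier M \<Longrightarrow> t \<in> gens \<Longrightarrow> t M \<in> carrier_mat (rdim M) (rdim M)"
  by (simp add: rep_carrier_def)

lemma hom_D4_iff:
  "f \<in> hom_D4 M N \<longleftrightarrow> f \<in> carrier_mat (rdim N) (rdim M) \<and> (\<forall>t\<in>gens. f * t M = t N * f)"
  by (simp add: hom_D4_def gens_def)

lemma hom_D4D:
  assumes "f \<in> hom_D4 M N"
  shows "f \<in> carrier_mat (rdim N) (rdim M)" "t \<in> gens \<Longrightarrow> f * t M = t N * f"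
  using assms by (simp_all add: hom_D4_iff)

lemma hom_D4_vec:
  assumes "f \<in> hom_D4 M N" "rep_carrier M" "rep_carrier N" "t \<in> gens" "x \<in> space M"
  shows "f *\<^sub>v (t M *\<^sub>v x) = t N *\<^sub>v (f *\<^sub>v x)"
proof -
  note c = hom_D4D(1)[OF assms(1)] rep_carrierD[OF assms(2,4)] rep_carrierD[OF assms(3,4)]
  have "f *\<^sub>v (t M *\<^sub>v x) = (f * t M) *\<^sub>v x"
    using c assms(5) by (simp add: mat_mult_vec_assoc del: assoc_mult_mat_vec)
  also have "\<dots> = (t N * f) *\<^sub>v x" using assms by (simp add: hom_D4_iff)
  also have "\<dots> = t N *\<^sub>v (f *\<^sub>v x)"
    using c assms(5) by (simp add: mat_mult_vec_assoc del: assoc_mult_mat_vec)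
  finally show ?thesis .
qed

lemma hom_D4_comp:
  assumes f: "f \<in> hom_D4 M N" and g: "g \<in> hom_D4 N K"
    and c: "rep_carrier M" "rep_carrier N" "rep_carrier K"
  shows "g * f \<in> hom_D4 M K"
  unfolding hom_D4_iff
proof (intro conjI ballI)
  show "g * f \<in> carrier_mat (rdim K) (rdim M)" using hom_D4D(1)[OF f] hom_D4D(1)[OF g] by auto
  fix t :: "'a rep \<Rightarrow> 'a mat" assume t: "t \<in> gens"
  note d = hom_D4D(1)[OF f] hom_D4D(1)[OF g] rep_carrierD[OF c(1) t] rep_carrierD[OF c(2) t] rep_carrierD[OF c(3) t]
  have "g * f * t M = g * (f * t M)" using d by (simp add: mat_mult_assoc)
  also have "\<dots> = (g * t N) * f" unfolding hom_D4D(2)[OF f t] using d by (simp add: mat_mult_assoc)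
  also have "\<dots> = t K * (g * f)" unfolding hom_D4D(2)[OF g t] using d by (simp add: mat_mult_assoc)
  finally show "g * f * t M = t K * (g * f)" .
qed

lemma one_hom_D4: "rep_carrier M \<Longrightarrow> 1\<^sub>m (rdim M) \<in> hom_D4 M M"
  unfolding hom_D4_iff by (auto dest: rep_carrierD)

lemma hom_D4_inverse:
  assumes f: "f \<in> hom_D4 M N" and g: "g \<in> carrier_mat (rdim M) (rdim N)"
    and inv: "g * f = 1\<^sub>m (rdim M)" "f * g = 1\<^sub>m (rdim N)"
    and c: "rep_carrier M" "rep_carrier N"
  shows "g \<in> hom_D4 N M"
  unfolding hom_D4_iff
proof (intro conjI ballI)
  show "g \<in> carrier_mat (rdim M) (rdim N)" by (rule g)
  fix t :: "'a rep \<Rightarrow> 'a mat" assume t: "t \<in> gens"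
  note d = hom_D4D(1)[OF f] g rep_carrierD[OF c(1) t] rep_carrierD[OF c(2) t]
  have "g * t N = g * t N * (f * g)" unfolding inv using d by simp
  also have "\<dots> = g * (t N * f) * g" using d by (simp add: mat_mult_assoc)
  also have "\<dots> = (g * f) * (t M * g)" unfolding hom_D4D(2)[OF f t, symmetric] using d by (simp add: mat_mult_assoc)
  also have "\<dots> = t M * g" unfolding inv using d by simp
  finally show "g * t N = t M * g" .
qed

lemma iso_D4I:
  assumes "f \<in> hom_D4 M N" "g \<in> carrier_mat (rdim M) (rdim N)"
    "g * f = 1\<^sub>m (rdim M)" "f * g = 1\<^sub>m (rdim N)"
  shows "M \<cong>\<^sub>D N"
  unfolding iso_D4_def using inverse_bij[OF hom_D4D(1)[OF assms(1)] assms(2-4)] assms(1) by blast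

lemma iso_D4E:
  assumes "M \<cong>\<^sub>D N" "rep_carrier M" "rep_carrier N"
  obtains f g where "f \<in> hom_D4 M N" "g \<in> hom_D4 N M" "g * f = 1\<^sub>m (rdim M)" "f * g = 1\<^sub>m (rdim N)"
    "rdim M = rdim N"
proof -
  obtain f where f: "f \<in> hom_D4 M N" "bij_betw ((*\<^sub>v) f) (space M) (space N)"
    using assms(1) unfolding iso_D4_def by blast
  obtain g where g: "g \<in> carrier_mat (rdim M) (rdim N)" "g * f = 1\<^sub>m (rdim M)" "f * g = 1\<^sub>m (rdim N)"
    and n: "rdim M = rdim N"
    using bij_inverse[OF hom_D4D(1)[OF f(1)] f(2)] by metis
  from that[OF f(1) hom_D4_inverse[OF f(1) g assms(2,3)] g(2,3) n] show thesis .
qed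

lemma iso_D4_refl: "rep_carrier M \<Longrightarrow> M \<cong>\<^sub>D M"
  by (rule iso_D4I[OF one_hom_D4, of _ "1\<^sub>m (rdim M)"]) auto

lemma iso_D4_sym:
  assumes "M \<cong>\<^sub>D N" "rep_carrier M" "rep_carrier N"
  shows "N \<cong>\<^sub>D M"
  using iso_D4E[OF assms] iso_D4I hom_D4D(1) by metis

lemma iso_D4_trans:
  assumes "L \<cong>\<^sub>D M" "M \<cong>\<^sub>D N" "rep_carrier L" "rep_carrier M" "rep_carrier N"
  shows "L \<cong>\<^sub>D N"
proof -
  obtain f where f: "f \<in> hom_D4 L M" "bij_betw ((*\<^sub>v) f) (space L) (space M)"
    using assms(1) unfolding iso_D4_def by blast
  obtain g where g: "g \<in> hom_D4 M N" "bij_betw ((*\<^sub>v) g) (space M) (space N)"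
    using assms(2) unfolding iso_D4_def by blast
  have "bij_betw ((*\<^sub>v) g \<circ> (*\<^sub>v) f) (space L) (space N)" using f(2) g(2) by (rule bij_betw_trans)
  then have "bij_betw ((*\<^sub>v) (g * f)) (space L) (space N)"
    by (rule bij_betw_cong[THEN iffD1, rotated])
      (use hom_D4D(1)[OF f(1)] hom_D4D(1)[OF g(1)] in \<open>simp add: mat_mult_vec_assoc\<close>)
  then show ?thesis unfolding iso_D4_def using hom_D4_comp[OF f(1) g(1) assms(3-5)] by blast
qed

lemma submodule_D4_iff:
  "submodule_D4 M U \<longleftrightarrow> lin_subspace (rdim M) U \<and> (\<forall>t\<in>gens. \<forall>u\<in>U. t M *\<^sub>v u \<in> U)"
  unfolding submodule_D4_def lin_subspace_def gens_def by auto

lemma submodule_D4D: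
  assumes "submodule_D4 M U"
  shows "lin_subspace (rdim M) U" "t \<in> gens \<Longrightarrow> u \<in> U \<Longrightarrow> t M *\<^sub>v u \<in> U"
  using assms by (auto simp: submodule_D4_iff)

lemma submodule_D4_image:
  assumes f: "f \<in> hom_D4 M N" and c: "rep_carrier M" "rep_carrier N"
  shows "submodule_D4 N ((*\<^sub>v) f ` space M)"
  unfolding submodule_D4_iff
proof (intro conjI ballI)
  show "lin_subspace (rdim N) ((*\<^sub>v) f ` space M)" by (rule lin_subspace_image[OF hom_D4D(1)[OF f]])
  fix t :: "'a rep \<Rightarrow> 'a mat" and u assume t: "t \<in> gens" and "u \<in> (*\<^sub>v) f ` space M"
  then obtain x where x: "x \<in> space M" "u = f *\<^sub>v x" by auto
  then have "t N *\<^sub>v u = f *\<^sub>v (t M *\<^sub>v x)" using hom_D4_vec[OF f c t x(1)] by simp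
  then show "t N *\<^sub>v u \<in> (*\<^sub>v) f ` space M" using x rep_carrierD[OF c(1) t] by auto
qed

lemma mono_D4_left_inverse:
  assumes "i \<in> mono_D4 M N"
  obtains L where "L \<in> carrier_mat (rdim M) (rdim N)" "L * i = 1\<^sub>m (rdim M)"
  using assms inj_left_inverse[of i "rdim N" "rdim M"] unfolding mono_D4_def hom_D4_def by blast

lemma epi_D4_right_inverse:
  assumes "p \<in> epi_D4 M N"
  obtains R where "R \<in> carrier_mat (rdim M) (rdim N)" "p * R = 1\<^sub>m (rdim N)"
  using assms surj_right_inverse[of p "rdim N" "rdim M"] unfolding epi_D4_def hom_D4_def by blast

text \<open>The universal property of the kernel. The left inverse \<open>L\<close> of
  \<open>i\<close> is merely linear, but \<open>X\<close> takes its values in the image of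
  \<open>i\<close>, so \<open>i (L X) = X\<close>; this identity carries the commutation with the
  generators from \<open>X\<close> over to \<open>L X\<close>.\<close>

lemma mono_D4_factor:
  assumes i: "i \<in> mono_D4 K P" and im: "(*\<^sub>v) i ` space K = mat_kernel p" and p: "p \<in> hom_D4 P M"
    and X: "X \<in> hom_D4 N P" "p * X = 0\<^sub>m (rdim M) (rdim N)"
    and c: "rep_carrier K" "rep_carrier P" "rep_carrier N"
  obtains k where "k \<in> hom_D4 N K" "i * k = X"
proof -
  have ih: "i \<in> hom_D4 K P" using i by (simp add: mono_D4_def)
  obtain L where L: "L \<in> carrier_mat (rdim K) (rdim P)" "L * i = 1\<^sub>m (rdim K)"
    using mono_D4_left_inverse[OF i] by blast
  note d = hom_D4D(1)[OF ih] hom_D4D(1)[OF p] hom_D4D(1)[OF X(1)] L(1)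
  have iLX: "i * (L * X) = X"
  proof (rule eq_mat_by_vec)
    fix v :: "'a vec" assume v: "v \<in> carrier_vec (rdim N)"
    have "p *\<^sub>v (X *\<^sub>v v) = (p * X) *\<^sub>v v" using d v by (simp add: mat_mult_vec_assoc)
    then have "X *\<^sub>v v \<in> mat_kernel p" using d v X(2) by (intro mat_kernelI[OF d(2)]) (auto simp: mat_vec_zero)
    then obtain w where w: "w \<in> space K" "X *\<^sub>v v = i *\<^sub>v w" using im by auto
    have "(i * (L * X)) *\<^sub>v v = i *\<^sub>v ((L * i) *\<^sub>v w)" using d v w by (simp add: mat_mult_vec_assoc)
    then show "(i * (L * X)) *\<^sub>v v = X *\<^sub>v v" using w L by simp
  qed (use d in auto)
  have "L * X \<in> hom_D4 N K" unfolding hom_D4_iff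
  proof (intro conjI ballI)
    show "L * X \<in> carrier_mat (rdim K) (rdim N)" using d by auto
    fix t :: "'a rep \<Rightarrow> 'a mat" assume t: "t \<in> gens"
    note e = d rep_carrierD[OF c(1) t] rep_carrierD[OF c(2) t] rep_carrierD[OF c(3) t]
    have "L * X * t N = L * (X * t N)" using e by (simp add: mat_mult_assoc)
    also have "\<dots> = L * (t P * (i * (L * X)))" unfolding hom_D4D(2)[OF X(1) t] iLX ..
    also have "\<dots> = L * ((t P * i) * (L * X))" using e by (simp add: mat_mult_assoc)
    also have "\<dots> = (L * i) * (t K * (L * X))" unfolding hom_D4D(2)[OF ih t, symmetric] using e
      by (simp add: mat_mult_assoc)
    also have "\<dots> = t K * (L * X)" unfolding L(2) using e by simp
    finally show "L * X * t N = t K * (L * X)" .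
  qed
  from that[OF this iLX] show thesis .
qed

lemma mono_D4_cancel:
  assumes i: "i \<in> mono_D4 K P" and "i * x = i * y" "x \<in> carrier_mat (rdim K) m" "y \<in> carrier_mat (rdim K) m"
  shows "x = y"
proof -
  obtain L where L: "L \<in> carrier_mat (rdim K) (rdim P)" "L * i = 1\<^sub>m (rdim K)"
    using mono_D4_left_inverse[OF i] by blast
  have ic: "i \<in> carrier_mat (rdim P) (rdim K)" using i by (simp add: mono_D4_def hom_D4_def)
  have "x = (L * i) * x" unfolding L using assms by simp
  also have "\<dots> = (L * i) * y" using assms(2-4) ic L(1) by (simp add: mat_mult_assoc)
  also have "\<dots> = y" unfolding L using assms by simp
  finally show ?thesis .
qed

section \<open>Uniqueness of syzygies\<close>

lemma projective_cover_unique: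
  assumes pc: "projective_cover P p M" and pc': "projective_cover P' p' M'"
    and f: "f \<in> hom_D4 M M'" and g: "g \<in> hom_D4 M' M"
    and gf: "g * f = 1\<^sub>m (rdim M)" and fg: "f * g = 1\<^sub>m (rdim M')"
  obtains h k where "h \<in> hom_D4 P P'" "k \<in> hom_D4 P' P" "k * h = 1\<^sub>m (rdim P)" "h * k = 1\<^sub>m (rdim P')"
    "p' * h = f * p" "p * k = g * p'"
proof -
  have mods: "D4_module P" "D4_module P'" "D4_module M" "D4_module M'"
    and proj: "projective P" "projective P'"
    and p: "p \<in> hom_D4 P M" and p': "p' \<in> hom_D4 P' M'"
    and pe: "p \<in> epi_D4 P M" and pe': "p' \<in> epi_D4 P' M'"
    using pc pc' by (auto simp: projective_cover_def projective_def epi_D4_def)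
  have small: "U = space P" if "submodule_D4 P U" "{u + w |u w. u \<in> U \<and> w \<in> mat_kernel p} = space P" for U
    using pc that by (auto simp: projective_cover_def)
  have small': "U = space P'" if "submodule_D4 P' U" "{u + w |u w. u \<in> U \<and> w \<in> mat_kernel p'} = space P'" for U
    using pc' that by (auto simp: projective_cover_def)
  note rc = D4_moduleD(1)[OF mods(1)] D4_moduleD(1)[OF mods(2)] D4_moduleD(1)[OF mods(3)] D4_moduleD(1)[OF mods(4)]
  have "f * p \<in> hom_D4 P M'" by (rule hom_D4_comp[OF p f rc(1,3,4)])
  then obtain h where h: "h \<in> hom_D4 P P'" and p'h: "p' * h = f * p"
    using proj(1) pe' mods unfolding projective_def by metis
  note d0 = hom_D4D(1)[OF p] hom_D4D(1)[OF p'] hom_D4D(1)[OF f] hom_D4D(1)[OF g] hom_D4D(1)[OF h]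
  \<comment> \<open>A submodule that meets every fibre of \<open>q\<close> becomes everything after
    adding the kernel of \<open>q\<close>; both superfluity arguments use it in this form.\<close>
  have sum_kernel: "{u + w |u w. u \<in> U \<and> w \<in> mat_kernel q} = space Q"
    if U: "submodule_D4 Q U" and q: "q \<in> hom_D4 Q N" and rest: "\<And>y. y \<in> space Q \<Longrightarrow> \<exists>u\<in>U. q *\<^sub>v u = q *\<^sub>v y"
    for U q Q N
  proof
    have Uc: "U \<subseteq> space Q" using lin_subspaceD(1)[OF submodule_D4D(1)[OF U]] by auto
    note qc = hom_D4D(1)[OF q]
    show "{u + w |u w. u \<in> U \<and> w \<in> mat_kernel q} \<subseteq> space Q"
      using Uc qc by (auto simp: mat_kernel_def)
    show "space Q \<subseteq> {u + w |u w. u \<in> U \<and> w \<in> mat_kernel q}"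
    proof
      fix y assume y: "y \<in> space Q"
      then obtain u where u: "u \<in> U" "q *\<^sub>v u = q *\<^sub>v y" using rest by auto
      then have uc: "u \<in> space Q" using Uc by auto
      have "y - u \<in> mat_kernel q"
        using qc y uc u(2) by (intro mat_kernelI[OF qc]) (auto simp: mat_vec_minus)
      moreover have "y = u + (y - u)" using y uc by (intro eq_vecI) auto
      ultimately show "y \<in> {u + w |u w. u \<in> U \<and> w \<in> mat_kernel q}" using u(1) by blast
    qed
  qed
  have h_surj: "(*\<^sub>v) h ` space P = space P'"
  proof (rule small'[OF submodule_D4_image[OF h rc(1,2)] sum_kernel[OF submodule_D4_image[OF h rc(1,2)] p']])
    fix y assume y: "y \<in> space P'"
    have "g *\<^sub>v (p' *\<^sub>v y) \<in> space M" using d0 y by auto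
    then have "g *\<^sub>v (p' *\<^sub>v y) \<in> (*\<^sub>v) p ` space P" using pe by (simp add: epi_D4_def)
    then obtain x where x: "x \<in> space P" "p *\<^sub>v x = g *\<^sub>v (p' *\<^sub>v y)" by auto
    have "p' *\<^sub>v (h *\<^sub>v x) = (p' * h) *\<^sub>v x" using d0 x by (simp add: mat_mult_vec_assoc)
    also have "\<dots> = f *\<^sub>v (g *\<^sub>v (p' *\<^sub>v y))" unfolding p'h x(2)[symmetric] using d0 x(1)
      by (simp add: mat_mult_vec_assoc)
    also have "\<dots> = (f * g) *\<^sub>v (p' *\<^sub>v y)" using d0 y by (simp add: mat_mult_vec_assoc)
    also have "\<dots> = p' *\<^sub>v y" unfolding fg using d0 y by simp
    finally show "\<exists>u\<in>(*\<^sub>v) h ` space P. p' *\<^sub>v u = p' *\<^sub>v y" using x by auto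
  qed
  then have "h \<in> epi_D4 P P'" using h by (simp add: epi_D4_def)
  then obtain k where k: "k \<in> hom_D4 P' P" and hk: "h * k = 1\<^sub>m (rdim P')"
    using proj(2) one_hom_D4[OF rc(2)] mods unfolding projective_def by metis
  note d = d0 hom_D4D(1)[OF k]
  have pk: "p * k = g * p'"
  proof -
    have "p * k = (g * f) * p * k" unfolding gf using d by simp
    also have "\<dots> = g * ((f * p) * k)" using d by (simp add: mat_mult_assoc)
    also have "\<dots> = g * (p' * (h * k))" unfolding p'h[symmetric] using d by (simp add: mat_mult_assoc)
    finally show ?thesis unfolding hk using d by simp
  qed
  have k_surj: "(*\<^sub>v) k ` space P' = space P"
  proof (rule small[OF submodule_D4_image[OF k rc(2,1)] sum_kernel[OF submodule_D4_image[OF k rc(2,1)] p]])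
    fix y assume y: "y \<in> space P"
    have "p *\<^sub>v (k *\<^sub>v (h *\<^sub>v y)) = (p * k) *\<^sub>v (h *\<^sub>v y)" using d y by (simp add: mat_mult_vec_assoc)
    also have "\<dots> = g *\<^sub>v ((p' * h) *\<^sub>v y)" unfolding pk using d y by (simp add: mat_mult_vec_assoc)
    also have "\<dots> = (g * f) *\<^sub>v (p *\<^sub>v y)" unfolding p'h using d y by (simp add: mat_mult_vec_assoc)
    also have "\<dots> = p *\<^sub>v y" unfolding gf using d y by simp
    finally show "\<exists>u\<in>(*\<^sub>v) k ` space P'. p *\<^sub>v u = p *\<^sub>v y" using d y by auto
  qed
  have "k * h = 1\<^sub>m (rdim P)"
  proof (rule eq_mat_by_vec)
    fix x :: "'a vec" assume "x \<in> carrier_vec (rdim P)"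
    then obtain y where y: "y \<in> space P'" "x = k *\<^sub>v y" using k_surj by (metis imageE)
    have "(k * h) *\<^sub>v x = k *\<^sub>v ((h * k) *\<^sub>v y)" unfolding y(2) using d y by (simp add: mat_mult_vec_assoc)
    then show "(k * h) *\<^sub>v x = 1\<^sub>m (rdim P) *\<^sub>v x" unfolding hk using y d by simp
  qed (use d in auto)
  from that[OF h k this hk p'h pk] show thesis .
qed

text \<open>The mutually inverse maps between the covers send one kernel into the other. The induced
  maps \<open>u\<close> and \<open>v\<close> are mutually inverse because this holds after composing
  with the injections \<open>i\<close> and \<open>i'\<close>.\<close>

lemma is_Omega_cong:
  assumes "M \<cong>\<^sub>D M'" and KM: "is_Omega M K" and KM': "is_Omega M' K'"
  shows "K \<cong>\<^sub>D K'"
proof -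
  obtain P p i where K: "D4_module K" and pc: "projective_cover P p M" and i: "i \<in> mono_D4 K P"
    and im: "(*\<^sub>v) i ` space K = mat_kernel p" using KM unfolding is_Omega_def by blast
  obtain P' p' i' where K': "D4_module K'" and pc': "projective_cover P' p' M'" and i': "i' \<in> mono_D4 K' P'"
    and im': "(*\<^sub>v) i' ` space K' = mat_kernel p'" using KM' unfolding is_Omega_def by blast
  have mods: "D4_module P" "D4_module P'" "D4_module M" "D4_module M'"
    and p: "p \<in> hom_D4 P M" and p': "p' \<in> hom_D4 P' M'"
    using pc pc' by (auto simp: projective_cover_def projective_def epi_D4_def)
  note rc = D4_moduleD(1)[OF mods(1)] D4_moduleD(1)[OF mods(2)] D4_moduleD(1)[OF mods(3)] D4_moduleD(1)[OF mods(4)]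
    D4_moduleD(1)[OF K] D4_moduleD(1)[OF K']
  obtain f g where f: "f \<in> hom_D4 M M'" and g: "g \<in> hom_D4 M' M"
    and gf: "g * f = 1\<^sub>m (rdim M)" and fg: "f * g = 1\<^sub>m (rdim M')"
    using iso_D4E[OF assms(1) rc(3,4)] by metis
  obtain h k where h: "h \<in> hom_D4 P P'" and k: "k \<in> hom_D4 P' P" and kh: "k * h = 1\<^sub>m (rdim P)"
    and hk: "h * k = 1\<^sub>m (rdim P')" and p'h: "p' * h = f * p" and pk: "p * k = g * p'"
    using projective_cover_unique[OF pc pc' f g gf fg] by metis
  have ih: "i \<in> hom_D4 K P" and ih': "i' \<in> hom_D4 K' P'" using i i' by (auto simp: mono_D4_def)
  note d = hom_D4D(1)[OF p] hom_D4D(1)[OF p'] hom_D4D(1)[OF f] hom_D4D(1)[OF g] hom_D4D(1)[OF h] hom_D4D(1)[OF k]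
    hom_D4D(1)[OF ih] hom_D4D(1)[OF ih']
  have zero: "q * j = 0\<^sub>m (rdim N) (rdim L)"
    if "(*\<^sub>v) j ` space L = mat_kernel q" "q \<in> carrier_mat (rdim N) (rdim Q)" "j \<in> carrier_mat (rdim Q) (rdim L)"
    for q j :: "'a mat" and L N Q :: "'a rep"
  proof (rule eq_mat_by_vec)
    fix v :: "'a vec" assume v: "v \<in> space L"
    then have "j *\<^sub>v v \<in> mat_kernel q" using that by auto
    then show "(q * j) *\<^sub>v v = 0\<^sub>m (rdim N) (rdim L) *\<^sub>v v"
      using that(2,3) v by (auto simp: mat_kernel_def mat_mult_vec_assoc mat_vec_zero)
  qed (use that in auto)
  have "p' * (h * i) = (p' * h) * i" using d by (simp add: mat_mult_assoc)
  also have "\<dots> = f * (p * i)" unfolding p'h using d by (simp add: mat_mult_assoc)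
  also have "\<dots> = 0\<^sub>m (rdim M') (rdim K)" unfolding zero[OF im d(1) d(7)] using d by simp
  finally obtain u where u: "u \<in> hom_D4 K K'" "i' * u = h * i"
    using mono_D4_factor[OF i' im' p' hom_D4_comp[OF ih h rc(5,1,2)] _ rc(6,2,5)] by metis
  have "p * (k * i') = (p * k) * i'" using d by (simp add: mat_mult_assoc)
  also have "\<dots> = g * (p' * i')" unfolding pk using d by (simp add: mat_mult_assoc)
  also have "\<dots> = 0\<^sub>m (rdim M) (rdim K')" unfolding zero[OF im' d(2) d(8)] using d by simp
  finally obtain v where v: "v \<in> hom_D4 K' K" "i * v = k * i'"
    using mono_D4_factor[OF i im p hom_D4_comp[OF ih' k rc(6,2,1)] _ rc(5,1,6)] by metis
  note e = d hom_D4D(1)[OF u(1)] hom_D4D(1)[OF v(1)]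
  have "i * (v * u) = (i * v) * u" using e by (simp add: mat_mult_assoc)
  also have "\<dots> = k * (i' * u)" unfolding v(2) using e by (simp add: mat_mult_assoc)
  also have "\<dots> = (k * h) * i" unfolding u(2) using e by (simp add: mat_mult_assoc)
  also have "\<dots> = i * 1\<^sub>m (rdim K)" unfolding kh using e by simp
  finally have vu: "v * u = 1\<^sub>m (rdim K)" by (rule mono_D4_cancel[OF i]) (use e in auto)
  have "i' * (u * v) = (i' * u) * v" using e by (simp add: mat_mult_assoc)
  also have "\<dots> = h * (i * v)" unfolding u(2) using e by (simp add: mat_mult_assoc)
  also have "\<dots> = (h * k) * i'" unfolding v(2) using e by (simp add: mat_mult_assoc)
  also have "\<dots> = i' * 1\<^sub>m (rdim K')" unfolding hk using e by simp
  finally have uv: "u * v = 1\<^sub>m (rdim K')" by (rule mono_D4_cancel[OF i']) (use e in auto)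
  show ?thesis by (rule iso_D4I[OF u(1) hom_D4D(1)[OF v(1)] vu uv])
qed

section \<open>Matrices with at most one entry per row\<close>

text \<open>Row \<open>i\<close> has the entry \<open>c i\<close> in column
  \<open>\<sigma> i\<close> and is zero if that column lies outside the matrix. Multiplication
  composes the index maps, so the relations of the explicit modules reduce to arithmetic with
  indices.\<close>

definition sparse :: "nat \<Rightarrow> nat \<Rightarrow> (nat \<Rightarrow> 'k::field) \<Rightarrow> (nat \<Rightarrow> nat) \<Rightarrow> 'k mat" where
  "sparse n m c \<sigma> = mat n m (\<lambda>(i, j). if j = \<sigma> i then c i else 0)"

lemma sparse_dim [simp]: "dim_row (sparse n m c \<sigma>) = n" "dim_col (sparse n m c \<sigma>) = m"
  by (simp_all add: sparse_def)

lemma sparse_carrier [simp]: "sparse n m c \<sigma> \<in> carrier_mat n m"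
  by (simp add: sparse_def)

lemma sparse_index: "i < n \<Longrightarrow> j < m \<Longrightarrow> sparse n m c \<sigma> $$ (i, j) = (if j = \<sigma> i then c i else 0)"
  by (simp add: sparse_def)

lemma sparse_vec:
  assumes "dim_vec x = m" "i < n"
  shows "(sparse n m c \<sigma> *\<^sub>v x) $ i = (if \<sigma> i < m then c i * x $ \<sigma> i else 0)"
proof -
  have "(sparse n m c \<sigma> *\<^sub>v x) $ i = (\<Sum>j = 0..<m. sparse n m c \<sigma> $$ (i, j) * x $ j)"
    using assms by (simp add: scalar_prod_def)
  also have "\<dots> = (\<Sum>j = 0..<m. if j = \<sigma> i then c i * x $ j else 0)"
    using assms by (intro sum.cong) (auto simp: sparse_index)
  finally show ?thesis by (simp add: sum.delta)
qed

text \<open>The premise excludes rows whose entry falls outside the middle format: such a row of the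
  product is zero, whereas \<open>\<sigma>' (\<sigma> i)\<close> could point back inside.\<close>

lemma sparse_mult:
  assumes "\<And>i. i < n \<Longrightarrow> c i \<noteq> 0 \<Longrightarrow> \<sigma> i < m"
  shows "sparse n m c \<sigma> * sparse m k c' \<sigma>' = sparse n k (\<lambda>i. c i * c' (\<sigma> i)) (\<lambda>i. \<sigma>' (\<sigma> i))"
proof (rule eq_matI)
  fix i j assume ij: "i < dim_row (sparse n k (\<lambda>i. c i * c' (\<sigma> i)) (\<lambda>i. \<sigma>' (\<sigma> i)))"
    "j < dim_col (sparse n k (\<lambda>i. c i * c' (\<sigma> i)) (\<lambda>i. \<sigma>' (\<sigma> i)))"
  then have ij: "i < n" "j < k" by simp_all
  have "(sparse n m c \<sigma> * sparse m k c' \<sigma>') $$ (i, j) = (sparse n m c \<sigma> *\<^sub>v col (sparse m k c' \<sigma>') j) $ i"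
    using ij by simp
  also have "\<dots> = (if \<sigma> i < m then c i * col (sparse m k c' \<sigma>') j $ \<sigma> i else 0)"
    by (rule sparse_vec) (use ij in simp_all)
  also have "\<dots> = sparse n k (\<lambda>i. c i * c' (\<sigma> i)) (\<lambda>i. \<sigma>' (\<sigma> i)) $$ (i, j)"
    using assms[of i] ij by (auto simp: sparse_index)
  finally show "(sparse n m c \<sigma> * sparse m k c' \<sigma>') $$ (i, j) =
    sparse n k (\<lambda>i. c i * c' (\<sigma> i)) (\<lambda>i. \<sigma>' (\<sigma> i)) $$ (i, j)" .
qed simp_all

text \<open>The simplifier discharges the side condition more readily in this contrapositive form when \<open>c\<close> is
  given by a conditional.\<close>

lemma sparse_mult_alt:
  assumes "\<And>i. i < n \<Longrightarrow> \<not> \<sigma> i < m \<Longrightarrow> c i = 0"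
  shows "sparse n m c \<sigma> * sparse m k c' \<sigma>' = sparse n k (\<lambda>i. c i * c' (\<sigma> i)) (\<lambda>i. \<sigma>' (\<sigma> i))"
  by (rule sparse_mult) (use assms in metis)

lemma sparse_eqI:
  assumes "\<And>i. i < n \<Longrightarrow> c i = c' i" "\<And>i. i < n \<Longrightarrow> c' i \<noteq> 0 \<Longrightarrow> \<sigma> i = \<sigma>' i"
  shows "sparse n m c \<sigma> = sparse n m c' \<sigma>'"
proof (rule eq_matI)
  fix i j assume "i < dim_row (sparse n m c' \<sigma>')" "j < dim_col (sparse n m c' \<sigma>')"
  then show "sparse n m c \<sigma> $$ (i, j) = sparse n m c' \<sigma>' $$ (i, j)"
    using assms[of i] by (cases "c' i = 0") (auto simp: sparse_index)
qed simp_all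

lemma sparse_uminus: "- sparse n m c \<sigma> = sparse n m (\<lambda>i. - c i) \<sigma>"
  by (intro eq_matI) (auto simp: sparse_index)

lemma sparse_smult: "x \<cdot>\<^sub>m sparse n m c \<sigma> = sparse n m (\<lambda>i. x * c i) \<sigma>"
  by (intro eq_matI) (auto simp: sparse_index)

lemma sparse_zero: "0\<^sub>m n m = sparse n m (\<lambda>_. 0) \<sigma>"
  by (intro eq_matI) (auto simp: sparse_index)

lemma sparse_one: "1\<^sub>m n = sparse n n (\<lambda>_. 1) (\<lambda>i. i)"
  by (intro eq_matI) (auto simp: sparse_index)

lemmas sparse_simps = sparse_mult sparse_mult_alt sparse_uminus sparse_smult

lemma mat_add_zero:
  fixes A :: "'a::monoid_add mat"
  assumes "dim_row A = n" "dim_col A = m"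
  shows "A + 0\<^sub>m n m = A" "0\<^sub>m n m + A = A"
  using assms by (auto intro!: eq_matI)

section \<open>The block of the trivial module\<close>

definition block1 :: "'k::field rep \<Rightarrow> bool" where
  "block1 M \<longleftrightarrow> D4_module M \<and> opc M = opb M"

text \<open>The columns of \<open>W\<close> are common eigenvectors of \<open>b\<close> and
  \<open>c\<close>. Several columns are handled at once because they are the possible images of the
  generators of a free module of higher rank.\<close>

definition eigen :: "'k::field rep \<Rightarrow> 'k \<Rightarrow> 'k mat \<Rightarrow> bool" where
  "eigen X e W \<longleftrightarrow> dim_row W = rdim X \<and> opb X * W = e \<cdot>\<^sub>m W \<and> opc X * W = e \<cdot>\<^sub>m W"

text \<open>On a common eigenvector \<open>bc\<close> acts as \<open>e * e = 1\<close>, so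
  \<open>da + ad\<close> kills it even when \<open>X\<close> is outside the block. This is what
  allows projectivity to be tested against arbitrary modules.\<close>

lemma eigenD:
  assumes "D4_module X" "eigen X e W" and e: "e * e = 1"
  shows "eigen X (- e) (opa X * W)" "eigen X (- e) (opd X * W)"
    "opa X * (opa X * W) = 0\<^sub>m (rdim X) (dim_col W)" "opd X * (opd X * W) = 0\<^sub>m (rdim X) (dim_col W)"
    "opd X * (opa X * W) = - (opa X * (opd X * W))"
proof -
  note D = D4_moduleD[OF assms(1)]
  have d: "dim_row W = rdim X" and bW: "opb X * W = e \<cdot>\<^sub>m W" and cW: "opc X * W = e \<cdot>\<^sub>m W"
    using assms(2) by (auto simp: eigen_def)
  note c = D(2-5) d
  have assoc: "s * (t * W) = (s * t) * W" if "s \<in> {opa X, opb X, opc X, opd X}" "t \<in> {opa X, opb X, opc X, opd X}"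
    for s t
    using that c by (auto simp: mat_mult_assoc)
  have "opd X * opb X = - (opb X * opd X) \<Longrightarrow> opb X * opd X = - (opd X * opb X)"
    "opd X * opc X = - (opc X * opd X) \<Longrightarrow> opc X * opd X = - (opd X * opc X)" by simp_all
  then have bd: "opb X * opd X = - (opd X * opb X)" and cd: "opc X * opd X = - (opd X * opc X)" using D by blast+
  have neg: "- (x \<cdot>\<^sub>m A) = (- x) \<cdot>\<^sub>m A" for x and A :: "'a mat" by (intro eq_matI) auto
  show "eigen X (- e) (opa X * W)" unfolding eigen_def
    using c by (simp add: assoc D(6,8)) (simp add: mat_ring bW cW neg)
  show "eigen X (- e) (opd X * W)" unfolding eigen_def
    using c by (simp add: assoc bd cd) (simp add: mat_ring bW cW neg)
  show "opa X * (opa X * W) = 0\<^sub>m (rdim X) (dim_col W)" "opd X * (opd X * W) = 0\<^sub>m (rdim X) (dim_col W)"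
    using c by (simp_all add: assoc D(11,14) mat_mult_zero)
  have "opd X * (opa X * W) + opa X * (opd X * W) = (opd X * opa X + opa X * opd X) * W"
    using c by (simp add: mat_ring)
  also have "\<dots> = W - opb X * (opc X * W)" unfolding D(15) using c by (simp add: mat_ring)
  also have "\<dots> = 0\<^sub>m (rdim X) (dim_col W)"
    using c e by (simp add: cW bW mat_mult_smult) (auto intro!: eq_matI simp: e mult.assoc[symmetric])
  finally have sum: "opd X * (opa X * W) + opa X * (opd X * W) = 0\<^sub>m (rdim X) (dim_col W)" .
  show "opd X * (opa X * W) = - (opa X * (opd X * W))"
  proof (rule eq_matI)
    fix i j assume "i < dim_row (- (opa X * (opd X * W)))" "j < dim_col (- (opa X * (opd X * W)))"
    then have ij: "i < rdim X" "j < dim_col W" using c by auto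
    have "(opd X * (opa X * W) + opa X * (opd X * W)) $$ (i, j) = 0" unfolding sum using ij by simp
    then have "(opd X * (opa X * W)) $$ (i, j) + (opa X * (opd X * W)) $$ (i, j) = 0"
      using ij c by (simp del: index_mult_mat(1))
    then show "(opd X * (opa X * W)) $$ (i, j) = (- (opa X * (opd X * W))) $$ (i, j)"
      using ij c by (simp add: eq_neg_iff_add_eq_0 del: index_mult_mat(1))
  qed (use c in auto)
qed

section \<open>Free modules over the exterior algebra\<close>

text \<open>With free generators \<open>g\<close> of eigenvalue \<open>e\<close>, the basis consists
  of four blocks of length \<open>m\<close>: the vectors \<open>g\<close>, then \<open>a g\<close>,
  \<open>d g\<close> and \<open>a d g\<close>. The sign in \<open>opd\<close> is
  \<open>d (a g) = - a d g\<close>; the eigenvalue is \<open>e\<close> on the two even blocks and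
  \<open>- e\<close> on the two odd ones.\<close>

definition free :: "nat \<Rightarrow> 'k \<Rightarrow> 'k::field rep" where
  "free m e = \<lparr>rdim = 4 * m,
     opa = sparse (4 * m) (4 * m) (\<lambda>i. if m \<le> i \<and> i < 2 * m \<or> 3 * m \<le> i then 1 else 0) (\<lambda>i. i - m),
     opb = sparse (4 * m) (4 * m) (\<lambda>i. if i < m \<or> 3 * m \<le> i then e else - e) (\<lambda>i. i),
     opc = sparse (4 * m) (4 * m) (\<lambda>i. if i < m \<or> 3 * m \<le> i then e else - e) (\<lambda>i. i),
     opd = sparse (4 * m) (4 * m) (\<lambda>i. if 2 * m \<le> i \<and> i < 3 * m then 1 else
       if 3 * m \<le> i then - 1 else 0) (\<lambda>i. i - 2 * m)\<rparr>"

lemma free_rdim [simp]: "rdim (free m e) = 4 * m"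
  by (simp add: free_def)

lemma block1_free:
  assumes e: "e * e = 1"
  shows "block1 (free m e :: 'k::field rep)"
proof -
  have "opd (free m e) * opa (free m e) + opa (free m e) * opd (free m e) = (0\<^sub>m (4*m) (4*m) :: 'k mat)"
    by (intro eq_matI) (auto simp: free_def sparse_simps sparse_index)
  moreover have "opb (free m e) * opc (free m e) = (1\<^sub>m (4*m) :: 'k mat)"
    unfolding sparse_one by (auto simp: e free_def sparse_simps intro!: sparse_eqI)
  moreover have "opb (free m e) * opb (free m e) = (1\<^sub>m (4*m) :: 'k mat)"
    unfolding sparse_one by (auto simp: e free_def sparse_simps intro!: sparse_eqI)
  moreover have "opa (free m e) * opa (free m e) = (0\<^sub>m (4*m) (4*m) :: 'k mat)"
    unfolding sparse_zero[of _ _ "\<lambda>i. i - m - m"] by (auto simp: free_def sparse_simps intro!: sparse_eqI)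
  moreover have "opd (free m e) * opd (free m e) = (0\<^sub>m (4*m) (4*m) :: 'k mat)"
    unfolding sparse_zero[of _ _ "\<lambda>i. i - 2*m - 2*m"] by (auto simp: free_def sparse_simps intro!: sparse_eqI)
  moreover have "opb (free m e) * opa (free m e) = - (opa (free m e) * opb (free m e) :: 'k mat)"
    by (auto simp: free_def sparse_simps intro!: sparse_eqI)
  moreover have "opd (free m e) * opb (free m e) = - (opb (free m e) * opd (free m e) :: 'k mat)"
    by (auto simp: free_def sparse_simps intro!: sparse_eqI)
  moreover have "opc (free m e) = (opb (free m e) :: 'k mat)" by (simp add: free_def)
  moreover have "opa (free m e) \<in> carrier_mat (4*m) (4*m)" "opb (free m e) \<in> carrier_mat (4*m) (4*m)"
    "opd (free m e) \<in> carrier_mat (4*m) (4*m)" by (simp_all add: free_def)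
  ultimately show ?thesis unfolding block1_def D4_module_def Let_def
    by (simp add: minus_r_inv_mat[of _ "4*m" "4*m"])
qed

lemma free_dim [simp]:
  "dim_row (opa (free m e)) = 4 * m" "dim_col (opa (free m e)) = 4 * m" "dim_row (opb (free m e)) = 4 * m" "dim_col
    (opb (free m e)) = 4 * m"
  "dim_row (opc (free m e)) = 4 * m" "dim_col (opc (free m e)) = 4 * m" "dim_row (opd (free m e)) = 4 * m" "dim_col
    (opd (free m e)) = 4 * m"
  by (simp_all add: free_def)

lemma free_vec:
  assumes "dim_vec x = 4 * m" "i < 4 * m"
  shows "(opa (free m e) *\<^sub>v x) $ i = (if m \<le> i \<and> i < 2 * m \<or> 3 * m \<le> i then x $ (i - m) else 0)"
    "(opd (free m e) *\<^sub>v x) $ i = (if 2 * m \<le> i \<and> i < 3 * m then x $ (i - 2 * m) else if 3 * m \<le> i then - x $ (i - 2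
      * m) else 0)"
  using assms less_imp_diff_less[OF assms(2), of m] less_imp_diff_less[OF assms(2), of "2 * m"]
  by (simp_all add: free_def sparse_vec del: index_mult_mat_vec)

text \<open>The coefficients at \<open>g\<close>, \<open>a g\<close>, \<open>d g\<close> and
  \<open>a d g\<close> for \<open>j = 0, 1, 2, 3\<close>.\<close>

definition gcoord :: "nat \<Rightarrow> nat \<Rightarrow> 'k::field mat" where
  "gcoord m j = sparse m (4 * m) (\<lambda>_. 1) (\<lambda>i. i + j * m)"

definition gincl :: "nat \<Rightarrow> 'k::field mat" where
  "gincl m = sparse (4 * m) m (\<lambda>i. if i < m then 1 else 0) (\<lambda>i. i)"

lemma gcoord_carrier [simp]: "gcoord m j \<in> carrier_mat m (4 * m)" "dim_row (gcoord m j) = m" "dim_col (gcoord m j) =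
  4 * m"
  by (simp_all add: gcoord_def)

lemma gincl_carrier [simp]: "gincl m \<in> carrier_mat (4 * m) m" "dim_row (gincl m) = 4 * m" "dim_col (gincl m) = m"
  by (simp_all add: gincl_def)

lemma gcoord_free:
  "gcoord m 0 * opa (free m e) = 0\<^sub>m m (4*m)" "gcoord m (Suc 0) * opa (free m e) = gcoord m 0"
  "gcoord m 2 * opa (free m e) = 0\<^sub>m m (4*m)" "gcoord m 3 * opa (free m e) = gcoord m 2"
  "gcoord m 0 * opd (free m e) = 0\<^sub>m m (4*m)" "gcoord m (Suc 0) * opd (free m e) = 0\<^sub>m m (4*m)"
  "gcoord m 2 * opd (free m e) = gcoord m 0" "gcoord m 3 * opd (free m e) = - gcoord m (Suc 0)"
  by (auto simp: gcoord_def free_def sparse_simps sparse_zero[of _ _ "\<lambda>i. i"] intro!: sparse_eqI)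

lemma gcoord_free_b:
  "gcoord m 0 * opb (free m e) = e \<cdot>\<^sub>m gcoord m 0" "gcoord m (Suc 0) * opb (free m e) = - (e \<cdot>\<^sub>m gcoord m (Suc 0))"
  "gcoord m 2 * opb (free m e) = - (e \<cdot>\<^sub>m gcoord m 2)" "gcoord m 3 * opb (free m e) = e \<cdot>\<^sub>m gcoord m 3"
  by (auto simp: gcoord_def free_def sparse_simps intro!: sparse_eqI)

lemma free_c: "opc (free m e) = opb (free m e)"
  by (simp add: free_def)

lemma gcoord_gincl:
  "gcoord m 0 * gincl m = 1\<^sub>m m" "gcoord m (Suc 0) * gincl m = 0\<^sub>m m m" "gcoord m 2 * gincl m = 0\<^sub>m m m" "gcoord m 3
    * gincl m = 0\<^sub>m m m"
  by (auto simp: gcoord_def gincl_def sparse_simps sparse_zero[of _ _ "\<lambda>i. i"] sparse_one intro!: sparse_eqI)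

lemma eigen_gincl: "eigen (free m e) e (gincl m)"
  by (auto simp: eigen_def gincl_def free_def sparse_simps intro!: sparse_eqI)

text \<open>Each element is a combination of \<open>g\<close>, \<open>a g\<close>,
  \<open>d g\<close> and \<open>a d g\<close>. As a matrix identity it serves twice: it shows that a
  homomorphism is determined on the generators, and it puts vectors without generator component into
  \<open>a F + d F\<close>.\<close>

lemma free_decomposition:
  "1\<^sub>m (4*m) = gincl m * gcoord m 0 + opa (free m e) * (gincl m * gcoord m (Suc 0)) + opd (free m e) * (gincl m *
    gcoord m 2)
     + opa (free m e) * (opd (free m e) * (gincl m * gcoord m 3))"
proof (rule eq_mat_by_vec)
  show "1\<^sub>m (4*m) \<in> carrier_mat (4*m) (4*m)" by simp
  show "gincl m * gcoord m 0 + opa (free m e) * (gincl m * gcoord m (Suc 0)) + opd (free m e) * (gincl m * gcoord m 2)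
     + opa (free m e) * (opd (free m e) * (gincl m * gcoord m 3)) \<in> carrier_mat (4*m) (4*m)"
    by (rule carrier_matI) (simp_all add: free_def)
  fix x :: "'a vec" assume "x \<in> carrier_vec (4*m)"
  then have x: "dim_vec x = 4*m" by simp
  define y where "y j = gincl m *\<^sub>v (gcoord m j *\<^sub>v x)" for j
  have yd: "dim_vec (y j) = 4 * m" for j by (simp add: y_def)
  have y: "y j $ i = (if i < m then x $ (i + j * m) else 0)" if "i < 4*m" "j < 4" for i j
  proof -
    have "i + j * m < 4 * m" if "i < m"
    proof -
      have "Suc j * m \<le> 4 * m" using \<open>j < 4\<close> by (intro mult_le_mono1) simp
      then show ?thesis using that by (simp only: mult_Suc)
    qed
    then show ?thesis using that x by (simp add: y_def gincl_def gcoord_def sparse_vec del: index_mult_mat_vec)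
  qed
  have "(gincl m * gcoord m 0 + opa (free m e) * (gincl m * gcoord m (Suc 0)) + opd (free m e) * (gincl m * gcoord m 2)
     + opa (free m e) * (opd (free m e) * (gincl m * gcoord m 3))) *\<^sub>v x
     = y 0 + opa (free m e) *\<^sub>v y 1 + opd (free m e) *\<^sub>v y 2 + opa (free m e) *\<^sub>v (opd (free m e) *\<^sub>v y 3)"
    using x by (simp add: mat_vec y_def)
  also have "\<dots> = x"
  proof (rule eq_vecI)
    fix i assume "i < dim_vec x"
    then have i: "i < 4 * m" using x by simp
    consider "i < m" | "m \<le> i" "i < 2*m" | "2*m \<le> i" "i < 3*m" | "3*m \<le> i" by linarith
    then show "(y 0 + opa (free m e) *\<^sub>v y 1 + opd (free m e) *\<^sub>v y 2 + opa (free m e) *\<^sub>v (opd (free m e) *\<^sub>v y 3))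
      $ i = x $ i"
      by cases (use i in \<open>auto simp: free_vec yd y simp del: index_mult_mat_vec\<close>)
  qed (simp add: x free_dim)
  finally show "1\<^sub>m (4*m) *\<^sub>v x = (gincl m * gcoord m 0 + opa (free m e) * (gincl m * gcoord m (Suc 0)) + opd (free
    m e) * (gincl m * gcoord m 2)
     + opa (free m e) * (opd (free m e) * (gincl m * gcoord m 3))) *\<^sub>v x" using x by (simp add: mat_one_vec)
qed

text \<open>The only candidate for a homomorphism taking the generators to the columns of
  \<open>W\<close>: its value on the decomposition of the identity.\<close>

definition free_hom :: "nat \<Rightarrow> 'k::field rep \<Rightarrow> 'k mat \<Rightarrow> 'k mat" where
  "free_hom m X W = W * gcoord m 0 + opa X * (W * gcoord m (Suc 0)) + opd X * (W * gcoord m 2)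
     + opa X * (opd X * (W * gcoord m 3))"

text \<open>Both sides are compared coefficient by coefficient. The exterior relations are available
  on \<open>W\<close> and also on \<open>a W\<close> and \<open>d W\<close>, whose columns are
  eigenvectors again, with eigenvalue \<open>- e\<close>.\<close>

lemma free_hom:
  assumes X: "D4_module X" and W: "W \<in> carrier_mat (rdim X) m" "eigen X e W" and e: "e * e = 1"
  shows "free_hom m X W \<in> hom_D4 (free m e) X" and "free_hom m X W * gincl m = W"
proof -
  note D = D4_moduleD[OF X]
  note e0 = eigenD[OF X W(2) e]
  have "- e * - e = 1" using e by simp
  note e1 = eigenD[OF X e0(2) this]
  have c: "dim_row W = rdim X" "dim_col W = m" "dim_row (opa X) = rdim X" "dim_col (opa X) = rdim X"
    "dim_row (opb X) = rdim X" "dim_col (opb X) = rdim X" "dim_row (opc X) = rdim X" "dim_col (opc X) = rdim X"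
    "dim_row (opd X) = rdim X" "dim_col (opd X) = rdim X"
    using D(2-5) W(1) by auto
  have fc: "dim_row (opa (free m e)) = 4*m" "dim_row (opb (free m e)) = 4*m" "dim_row (opc (free m e)) = 4*m"
    "dim_row (opd (free m e)) = 4*m"
    "dim_col (opa (free m e)) = 4*m" "dim_col (opb (free m e)) = 4*m" "dim_col (opc (free m e)) = 4*m" "dim_col (opd
      (free m e)) = 4*m"
    by (simp_all add: free_def)
  have grp: "opa X * (W * Z) = (opa X * W) * Z" "opd X * (W * Z) = (opd X * W) * Z" if "dim_row Z = m" for Z
    using c that by (simp_all add: mat_mult_assoc)
  show "free_hom m X W * gincl m = W"
    unfolding free_hom_def using c by (simp add: mat_ring gcoord_gincl mat_add_zero)
  show "free_hom m X W \<in> hom_D4 (free m e) X"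
    unfolding hom_D4_def free_hom_def
  proof (intro CollectI conjI)
    show "W * gcoord m 0 + opa X * (W * gcoord m (Suc 0)) + opd X * (W * gcoord m 2) + opa X * (opd X * (W * gcoord
      m 3))
       \<in> carrier_mat (rdim X) (rdim (free m e))"
      by (rule carrier_matI) (simp_all add: c)
    \<comment> \<open>The relations are known for \<open>W\<close>; here they are carried over to
      \<open>W Z\<close>, the shape in which they meet the coordinate maps.\<close>
    have Z: "opa X * (opa X * (W * Z)) = 0\<^sub>m (rdim X) (dim_col Z)" "opd X * (opd X * (W * Z)) = 0\<^sub>m (rdim X)
      (dim_col Z)"
      "opd X * (opa X * (W * Z)) = - (opa X * (opd X * (W * Z)))"
      "opd X * (opa X * (opd X * (W * Z))) = 0\<^sub>m (rdim X) (dim_col Z)"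
      "opa X * (opa X * (opd X * (W * Z))) = 0\<^sub>m (rdim X) (dim_col Z)"
      if Zd: "dim_row Z = m" for Z
    proof -
      have r: "s * (t * (W * Z)) = (s * (t * W)) * Z" if "s \<in> {opa X, opd X}" "t \<in> {opa X, opd X}" for s t
        using that c Zd by (auto simp: mat_mult_assoc)
      have r3: "s * (t * (u * (W * Z))) = (s * (t * (u * W))) * Z"
        if "s \<in> {opa X, opd X}" "t \<in> {opa X, opd X}" "u \<in> {opa X, opd X}" for s t u
        using that c Zd by (auto simp: mat_mult_assoc)
      show "opa X * (opa X * (W * Z)) = 0\<^sub>m (rdim X) (dim_col Z)" "opd X * (opd X * (W * Z)) = 0\<^sub>m (rdim X) (dim_col Z)"
        "opd X * (opa X * (W * Z)) = - (opa X * (opd X * (W * Z)))"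
        using c Zd by (simp_all add: r e0(3-5) mat_mult_zero mat_uminus_mult)
      show "opa X * (opa X * (opd X * (W * Z))) = 0\<^sub>m (rdim X) (dim_col Z)"
        using c Zd by (simp add: r3 e1(3) mat_mult_zero)
      show "opd X * (opa X * (opd X * (W * Z))) = 0\<^sub>m (rdim X) (dim_col Z)"
        using c Zd by (simp add: r3 e1(5) e0(4) mat_mult_zero) (auto intro!: eq_matI)
    qed
    show "(W * gcoord m 0 + opa X * (W * gcoord m (Suc 0)) + opd X * (W * gcoord m 2) + opa X * (opd X * (W * gcoord
      m 3))) * opa (free m e)
      = opa X * (W * gcoord m 0 + opa X * (W * gcoord m (Suc 0)) + opd X * (W * gcoord m 2) + opa X * (opd X * (W *
        gcoord m 3)))"
      by (simp add: mat_ring c fc gcoord_free Z mat_add_zero)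
    show "(W * gcoord m 0 + opa X * (W * gcoord m (Suc 0)) + opd X * (W * gcoord m 2) + opa X * (opd X * (W * gcoord
      m 3))) * opd (free m e)
      = opd X * (W * gcoord m 0 + opa X * (W * gcoord m (Suc 0)) + opd X * (W * gcoord m 2) + opa X * (opd X * (W *
        gcoord m 3)))"
      by (simp add: mat_ring c fc gcoord_free Z mat_add_zero)
    have T: "t * (W * Z) = e \<cdot>\<^sub>m (W * Z)" "t * (opa X * (W * Z)) = - (e \<cdot>\<^sub>m (opa X * (W * Z)))"
      "t * (opd X * (W * Z)) = - (e \<cdot>\<^sub>m (opd X * (W * Z)))"
      "t * (opa X * (opd X * (W * Z))) = e \<cdot>\<^sub>m (opa X * (opd X * (W * Z)))"
      if Zd: "dim_row Z = m" and t: "t \<in> {opb X, opc X}" for Z t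
    proof -
      have r0: "t * (W * Z) = (t * W) * Z"
        using t c Zd by (auto simp: mat_mult_assoc)
      have r: "t * (u * (W * Z)) = (t * (u * W)) * Z" if "u \<in> {opa X, opd X}" for u
        using t that c Zd by (auto simp: mat_mult_assoc)
      have r3: "t * (s * (u * (W * Z))) = (t * (s * (u * W))) * Z" if "s \<in> {opa X, opd X}" "u \<in> {opa X, opd X}" for s u
        using t that c Zd by (auto simp: mat_mult_assoc)
      have neg: "(- x) \<cdot>\<^sub>m A = - (x \<cdot>\<^sub>m A)" for x and A :: "'a mat" by (intro eq_matI) auto
      show "t * (W * Z) = e \<cdot>\<^sub>m (W * Z)" "t * (opa X * (W * Z)) = - (e \<cdot>\<^sub>m (opa X * (W * Z)))"
        "t * (opd X * (W * Z)) = - (e \<cdot>\<^sub>m (opd X * (W * Z)))"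
        "t * (opa X * (opd X * (W * Z))) = e \<cdot>\<^sub>m (opa X * (opd X * (W * Z)))"
        using t c Zd W(2) e0(1,2) e1(1) unfolding r0 r r3 eigen_def
        by (auto simp: r r3 mat_ring neg)
    qed
    show "(W * gcoord m 0 + opa X * (W * gcoord m (Suc 0)) + opd X * (W * gcoord m 2) + opa X * (opd X * (W * gcoord
      m 3))) * opb (free m e)
      = opb X * (W * gcoord m 0 + opa X * (W * gcoord m (Suc 0)) + opd X * (W * gcoord m 2) + opa X * (opd X * (W *
        gcoord m 3)))"
      by (simp add: mat_ring c fc gcoord_free_b T)
    show "(W * gcoord m 0 + opa X * (W * gcoord m (Suc 0)) + opd X * (W * gcoord m 2) + opa X * (opd X * (W * gcoord
      m 3))) * opc (free m e)
      = opc X * (W * gcoord m 0 + opa X * (W * gcoord m (Suc 0)) + opd X * (W * gcoord m 2) + opa X * (opd X * (W *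
        gcoord m 3)))"
      unfolding free_c by (simp add: mat_ring c fc gcoord_free_b T)
  qed
qed

lemma free_hom_unique:
  assumes X: "D4_module X" and e: "e * e = 1" and f: "f \<in> hom_D4 (free m e) X"
  shows "f = free_hom m X (f * gincl m)"
proof -
  note D = D4_moduleD[OF X]
  have fr: "D4_module (free m e)" using block1_free[OF e] by (simp add: block1_def)
  note c = D(2,5) hom_D4D(1)[OF f] D4_moduleD(2,5)[OF fr]
  have fa: "f * opa (free m e) = opa X * f" "f * opd (free m e) = opd X * f" using f by (auto simp: hom_D4_def)
  have fa': "f * (opa (free m e) * Z) = opa X * (f * Z)" "f * (opd (free m e) * Z) = opd X * (f * Z)"
    if "dim_row Z = 4 * m" for Z
  proof -
    have "f * (opa (free m e) * Z) = (f * opa (free m e)) * Z" "f * (opd (free m e) * Z) = (f * opd (free m e)) * Z"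
      using c that by (simp_all add: mat_mult_assoc)
    then show "f * (opa (free m e) * Z) = opa X * (f * Z)" "f * (opd (free m e) * Z) = opd X * (f * Z)"
      unfolding fa using c that by (simp_all add: mat_mult_assoc)
  qed
  have "f = f * 1\<^sub>m (4 * m)" using c by simp
  also have "\<dots> = free_hom m X (f * gincl m)"
    unfolding free_decomposition[of m e] free_hom_def using c by (simp add: mat_mult_add mat_mult_assoc fa')
  finally show ?thesis .
qed

text \<open>A homomorphism out of the free module is a choice of common eigenvectors, so
  eigenvectors of \<open>Y\<close> have to be lifted along \<open>g\<close>. A linear lift is made
  an eigenvector by averaging, once for \<open>b\<close> and once for \<open>c\<close>.\<close>

lemma free_projective:
  assumes two: "(2::'k::field) \<noteq> 0" and e: "e * e = (1::'k)"
  shows "projective (free m e)"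
  unfolding projective_def
proof (intro conjI allI ballI impI)
  show fr: "D4_module (free m e)" using block1_free[OF e] by (simp add: block1_def)
  fix X Y :: "'k rep" and g f assume g: "g \<in> epi_D4 X Y" and f: "f \<in> hom_D4 (free m e) Y"
    and XY: "D4_module X \<and> D4_module Y"
  then have X: "D4_module X" and Y: "D4_module Y" by auto
  note DX = D4_moduleD[OF X] and DY = D4_moduleD[OF Y]
  have gh: "g \<in> hom_D4 X Y" using g by (simp add: epi_D4_def)
  obtain R where R: "R \<in> carrier_mat (rdim X) (rdim Y)" "g * R = 1\<^sub>m (rdim Y)"
    using epi_D4_right_inverse[OF g] by blast
  note c = DX(2-5) DY(2-5) hom_D4D(1)[OF gh] hom_D4D(1)[OF f] R(1)
  have gc: "dim_row (gincl m) = 4*m" "dim_col (gincl m) = m" by simp_all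
  define V where "V = f * gincl m"
  have Vc: "V \<in> carrier_mat (rdim Y) m" unfolding V_def by (rule carrier_matI) (use c in auto)
  have V: "opb Y * V = e \<cdot>\<^sub>m V" "opc Y * V = e \<cdot>\<^sub>m V"
  proof -
    have "opb Y * V = (opb Y * f) * gincl m" "opc Y * V = (opc Y * f) * gincl m" unfolding V_def using c
      by (simp_all add: mat_mult_assoc)
    moreover have "opb Y * f = f * opb (free m e)" "opc Y * f = f * opc (free m e)" using f by (auto simp: hom_D4_def)
    moreover have "opb (free m e) * gincl m = e \<cdot>\<^sub>m gincl m" "opc (free m e) * gincl m = e \<cdot>\<^sub>m gincl m"
      using eigen_gincl[of m e] by (auto simp: eigen_def)
    ultimately show "opb Y * V = e \<cdot>\<^sub>m V" "opc Y * V = e \<cdot>\<^sub>m V"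
      unfolding V_def using c D4_moduleD(3,4)[OF fr] by (simp_all add: mat_mult_assoc mat_mult_smult)
  qed
  \<comment> \<open>\<open>U\<close> is the \<open>e\<close>-part of the linear lift
    \<open>R V\<close> with respect to \<open>b\<close>, and \<open>W\<close> the
    \<open>e\<close>-part of \<open>U\<close> with respect to \<open>c\<close>. The second averaging
    preserves the first property because \<open>b\<close> and \<open>c\<close> commute;
    \<open>g\<close> maps both to \<open>V\<close> because \<open>V\<close> already consists of
    eigenvectors.\<close>
  define U where "U = (1/2) \<cdot>\<^sub>m (R * V + e \<cdot>\<^sub>m (opb X * (R * V)))"
  define W where "W = (1/2) \<cdot>\<^sub>m (U + e \<cdot>\<^sub>m (opc X * U))"
  have Uc: "U \<in> carrier_mat (rdim X) m" unfolding U_def by (rule carrier_matI) (use c Vc in auto)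
  have Wc: "W \<in> carrier_mat (rdim X) m" unfolding W_def by (rule carrier_matI) (use c Uc in auto)
  have ee: "e * (e * x) = x" for x using e by (simp add: mult.assoc[symmetric])
  have sym: "(x \<cdot>\<^sub>m (e \<cdot>\<^sub>m A + B)) = e \<cdot>\<^sub>m (x \<cdot>\<^sub>m (A + e \<cdot>\<^sub>m B))"
    if "dim_row A = dim_row B" "dim_col A = dim_col B" for x and A B :: "'k mat"
    using that by (intro eq_matI) (simp_all add: algebra_simps ee)
  have bU: "opb X * U = e \<cdot>\<^sub>m U"
  proof -
    have "opb X * (opb X * (R * V)) = (opb X * opb X) * (R * V)" using c Vc by (simp add: mat_mult_assoc)
    then have "opb X * (opb X * (R * V)) = R * V" unfolding DX(12) using c Vc by simp
    then have "opb X * U = (1/2) \<cdot>\<^sub>m (opb X * (R * V) + e \<cdot>\<^sub>m (R * V))" unfolding U_def using c Vc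
      by (simp add: mat_ring)
    also have "\<dots> = (1/2) \<cdot>\<^sub>m (e \<cdot>\<^sub>m (R * V) + opb X * (R * V))"
      by (rule arg_cong[of _ _ "\<lambda>A. (1/2) \<cdot>\<^sub>m A"], rule comm_add_mat[of _ "rdim X" m]) (use c Vc in auto)
    also have "\<dots> = e \<cdot>\<^sub>m U" unfolding U_def by (rule sym) (use c Vc in auto)
    finally show ?thesis .
  qed
  have cW: "opc X * W = e \<cdot>\<^sub>m W"
  proof -
    have "opc X * (opc X * U) = (opc X * opc X) * U" using c Uc by (simp add: mat_mult_assoc)
    then have "opc X * (opc X * U) = U" unfolding DX(13) using c Uc by simp
    then have "opc X * W = (1/2) \<cdot>\<^sub>m (opc X * U + e \<cdot>\<^sub>m U)" unfolding W_def using c Uc by (simp add: mat_ring)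
    also have "\<dots> = (1/2) \<cdot>\<^sub>m (e \<cdot>\<^sub>m U + opc X * U)"
      by (rule arg_cong[of _ _ "\<lambda>A. (1/2) \<cdot>\<^sub>m A"], rule comm_add_mat[of _ "rdim X" m]) (use c Uc in auto)
    also have "\<dots> = e \<cdot>\<^sub>m W" unfolding W_def by (rule sym) (use c Uc in auto)
    finally show ?thesis .
  qed
  have bW: "opb X * W = e \<cdot>\<^sub>m W"
  proof -
    have "opb X * (opc X * U) = (opb X * opc X) * U" using c Uc by (simp add: mat_mult_assoc)
    also have "\<dots> = opc X * (opb X * U)" unfolding DX(10) using c Uc by (simp add: mat_mult_assoc)
    finally have "opb X * (opc X * U) = e \<cdot>\<^sub>m (opc X * U)" unfolding bU using c Uc by (simp add: mat_mult_smult)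
    then have "opb X * W = (1/2) \<cdot>\<^sub>m (e \<cdot>\<^sub>m U + e \<cdot>\<^sub>m (e \<cdot>\<^sub>m (opc X * U)))"
      unfolding W_def using c Uc by (simp add: mat_ring bU)
    also have "\<dots> = e \<cdot>\<^sub>m W" unfolding W_def using c Uc
      by (intro eq_matI) (simp_all add: algebra_simps del: index_mult_mat(1))
    finally show ?thesis .
  qed
  have gbc: "g * opb X = opb Y * g" "g * opc X = opc Y * g" using gh by (auto simp: hom_D4_def)
  have gU: "g * U = V"
  proof -
    have gRV: "g * (R * V) = V" using c Vc R(2) by (simp add: mat_mult_assoc[symmetric])
    have "g * (opb X * (R * V)) = (g * opb X) * (R * V)" using c Vc by (simp add: mat_mult_assoc)
    also have "\<dots> = opb Y * (g * (R * V))" unfolding gbc using c Vc by (simp add: mat_mult_assoc)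
    finally have "g * U = (1/2) \<cdot>\<^sub>m (V + e \<cdot>\<^sub>m (e \<cdot>\<^sub>m V))" unfolding U_def using c Vc by (simp add: mat_ring gRV V)
    also have "\<dots> = V" by (intro eq_matI) (simp_all add: ee two)
    finally show ?thesis .
  qed
  have gW: "g * W = V"
  proof -
    have "g * (opc X * U) = (g * opc X) * U" using c Uc by (simp add: mat_mult_assoc)
    also have "\<dots> = opc Y * (g * U)" unfolding gbc using c Uc by (simp add: mat_mult_assoc)
    finally have "g * W = (1/2) \<cdot>\<^sub>m (V + e \<cdot>\<^sub>m (e \<cdot>\<^sub>m V))" unfolding W_def using c Uc by (simp add: mat_ring gU V)
    also have "\<dots> = V" by (intro eq_matI) (simp_all add: ee two)
    finally show ?thesis .
  qed
  have eW: "eigen X e W" using bW cW Wc by (simp add: eigen_def)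
  have h: "free_hom m X W \<in> hom_D4 (free m e) X" "free_hom m X W * gincl m = W"
    using free_hom[OF X Wc eW e] by auto
  have gf: "g * free_hom m X W \<in> hom_D4 (free m e) Y"
    by (rule hom_D4_comp[OF h(1) gh D4_moduleD(1)[OF fr] DX(1) DY(1)])
  have "g * free_hom m X W * gincl m = V" using c h(2) hom_D4D(1)[OF h(1)] gW by (simp add: mat_mult_assoc)
  \<comment> \<open>Both are homomorphisms out of the free module with the value \<open>V\<close> on
    the generators.\<close>
  then have "g * free_hom m X W = f"
    using free_hom_unique[OF Y e gf] free_hom_unique[OF Y e f] unfolding V_def by simp
  then show "\<exists>h\<in>hom_D4 (free m e) X. g * h = f" using h(1) by blast
qed

section \<open>The relations of the block on vectors, and Nakayama's lemma\<close>

lemma block1_vec: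
  assumes "block1 M" "x \<in> space M"
  shows "opa M *\<^sub>v (opa M *\<^sub>v x) = 0\<^sub>v (rdim M)" "opd M *\<^sub>v (opd M *\<^sub>v x) = 0\<^sub>v (rdim M)"
    "opd M *\<^sub>v (opa M *\<^sub>v x) = - (opa M *\<^sub>v (opd M *\<^sub>v x))"
    "opb M *\<^sub>v (opb M *\<^sub>v x) = x" "opb M *\<^sub>v (opa M *\<^sub>v x) = - (opa M *\<^sub>v (opb M *\<^sub>v x))"
    "opb M *\<^sub>v (opd M *\<^sub>v x) = - (opd M *\<^sub>v (opb M *\<^sub>v x))"
proof -
  have M: "D4_module M" and cb: "opc M = opb M" using assms by (auto simp: block1_def)
  note D = D4_moduleD[OF M]
  have d: "dim_row (opa M) = rdim M" "dim_col (opa M) = rdim M" "dim_row (opb M) = rdim M" "dim_col (opb M) = rdim M"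
    "dim_row (opd M) = rdim M" "dim_col (opd M) = rdim M" "dim_vec x = rdim M" using D(2-5) assms(2) by auto
  have assoc: "s *\<^sub>v (t *\<^sub>v x) = (s * t) *\<^sub>v x" if "s \<in> {opa M, opb M, opd M}" "t \<in> {opa M, opb M, opd M}" for s t
    using that d by (auto simp: mat_mult_vec_assoc)
  show "opa M *\<^sub>v (opa M *\<^sub>v x) = 0\<^sub>v (rdim M)" "opd M *\<^sub>v (opd M *\<^sub>v x) = 0\<^sub>v (rdim M)" "opb M *\<^sub>v (opb M *\<^sub>v x) = x"
    using d assms(2) by (simp_all add: assoc D(11,12,14) mat_vec)
  show "opb M *\<^sub>v (opa M *\<^sub>v x) = - (opa M *\<^sub>v (opb M *\<^sub>v x))"
    using d by (simp add: assoc D(6) mat_uminus_vec)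
  have "opb M * opd M = - (opd M * opb M)" unfolding D(7) by simp
  then show "opb M *\<^sub>v (opd M *\<^sub>v x) = - (opd M *\<^sub>v (opb M *\<^sub>v x))"
    using d by (simp add: assoc mat_uminus_vec)
  have "opd M *\<^sub>v (opa M *\<^sub>v x) + opa M *\<^sub>v (opd M *\<^sub>v x) = (opd M * opa M + opa M * opd M) *\<^sub>v x"
    using d by (simp add: mat_vec)
  also have "\<dots> = 0\<^sub>v (rdim M)" unfolding D(15) cb D(12) using d by (intro eq_vecI) (auto simp: mat_vec)
  finally have sum: "opd M *\<^sub>v (opa M *\<^sub>v x) + opa M *\<^sub>v (opd M *\<^sub>v x) = 0\<^sub>v (rdim M)" .
  show "opd M *\<^sub>v (opa M *\<^sub>v x) = - (opa M *\<^sub>v (opd M *\<^sub>v x))"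
  proof (rule eq_vecI)
    fix i assume "i < dim_vec (- (opa M *\<^sub>v (opd M *\<^sub>v x)))"
    then have i: "i < rdim M" using d by simp
    have "(opd M *\<^sub>v (opa M *\<^sub>v x) + opa M *\<^sub>v (opd M *\<^sub>v x)) $ i = 0" unfolding sum using i by simp
    then show "(opd M *\<^sub>v (opa M *\<^sub>v x)) $ i = (- (opa M *\<^sub>v (opd M *\<^sub>v x))) $ i"
      using i d by (simp add: eq_neg_iff_add_eq_0 del: index_mult_mat_vec)
  qed (use d in simp)
qed

lemma mat_vec_uminus:
  fixes A :: "'a::ring mat"
  assumes "dim_col A = dim_vec v"
  shows "A *\<^sub>v (- v) = - (A *\<^sub>v v)"
  using assms by (intro eq_vecI) auto

lemma gens_simps: "opa \<in> gens" "opb \<in> gens" "opc \<in> gens" "opd \<in> gens"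
  by (simp_all add: gens_def)

text \<open>Nakayama's lemma: \<open>a\<close> and \<open>d\<close> generate a nilpotent ideal of the block.\<close>

lemma nakayama:
  assumes M: "block1 M" and U: "submodule_D4 M U" and W: "submodule_D4 M W"
    and gen: "\<And>x. x \<in> U \<Longrightarrow> \<exists>w\<in>W. \<exists>y\<in>U. \<exists>z\<in>U. x = w + (opa M *\<^sub>v y + opd M *\<^sub>v z)"
  shows "U \<subseteq> W"
proof
  have D: "D4_module M" using M by (simp add: block1_def)
  note c = D4_moduleD(2-5)[OF D]
  note LU = lin_subspaceD[OF submodule_D4D(1)[OF U]] and LW = lin_subspaceD[OF submodule_D4D(1)[OF W]]
  note oU = submodule_D4D(2)[OF U] and oW = submodule_D4D(2)[OF W]
  have dimU: "dim_vec u = rdim M" if "u \<in> U" for u using LU(1)[OF that] by simp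
  have dimW: "dim_vec u = rdim M" if "u \<in> W" for u using LW(1)[OF that] by simp
  have d: "dim_row (opa M) = rdim M" "dim_col (opa M) = rdim M" "dim_row (opd M) = rdim M" "dim_col (opd M) = rdim M"
    using c by auto
  have neg: "opa M *\<^sub>v (- v) = - (opa M *\<^sub>v v)" "opd M *\<^sub>v (- v) = - (opd M *\<^sub>v v)" if "v \<in> space M" for v
    using that d by (auto simp: mat_vec_uminus)
  \<comment> \<open>Substitution of the expression for \<open>u\<close>, beginning with the highest
    power of the ideal: in \<open>a d u\<close> the contributions of \<open>y\<close> and
    \<open>z\<close> vanish and \<open>a d w\<close> remains. Then \<open>a u\<close> and
    \<open>d u\<close> lie in \<open>W\<close> up to such terms, and finally \<open>u\<close> itself
    does.\<close>
  have ad: "opa M *\<^sub>v (opd M *\<^sub>v u) \<in> W" if u: "u \<in> U" for u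
  proof -
    obtain w y z where w: "w \<in> W" "y \<in> U" "z \<in> U" "u = w + (opa M *\<^sub>v y + opd M *\<^sub>v z)" using gen[OF u] by auto
    note v = LW(1)[OF w(1)] LU(1)[OF w(2)] LU(1)[OF w(3)]
    have y: "opa M *\<^sub>v y \<in> space M" "opd M *\<^sub>v y \<in> space M" "opd M *\<^sub>v z \<in> space M" using v c by auto
    have "opd M *\<^sub>v u = opd M *\<^sub>v w + - (opa M *\<^sub>v (opd M *\<^sub>v y))"
      unfolding w(4) using v d block1_vec(2)[OF M v(3)] block1_vec(3)[OF M v(2)]
      by (simp add: mat_vec_add) (auto intro!: eq_vecI simp del: index_mult_mat_vec)
    then have "opa M *\<^sub>v (opd M *\<^sub>v u) = opa M *\<^sub>v (opd M *\<^sub>v w) + opa M *\<^sub>v (- (opa M *\<^sub>v (opd M *\<^sub>v y)))"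
      using v d by (simp add: mat_vec_add)
    also have "opa M *\<^sub>v (- (opa M *\<^sub>v (opd M *\<^sub>v y))) = 0\<^sub>v (rdim M)"
      using neg(1)[of "opa M *\<^sub>v (opd M *\<^sub>v y)"] block1_vec(1)[OF M y(2)] y c by auto
    finally have "opa M *\<^sub>v (opd M *\<^sub>v u) = opa M *\<^sub>v (opd M *\<^sub>v w)" using d
      by (auto intro!: eq_vecI simp del: index_mult_mat_vec)
    then show ?thesis using oW w(1) by (simp add: gens_simps)
  qed
  have a: "opa M *\<^sub>v u \<in> W" if u: "u \<in> U" for u
  proof -
    obtain w y z where w: "w \<in> W" "y \<in> U" "z \<in> U" "u = w + (opa M *\<^sub>v y + opd M *\<^sub>v z)" using gen[OF u] by auto
    note v = LW(1)[OF w(1)] LU(1)[OF w(2)] LU(1)[OF w(3)]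
    have "opa M *\<^sub>v u = opa M *\<^sub>v w + opa M *\<^sub>v (opd M *\<^sub>v z)"
      unfolding w(4) using v d block1_vec(1)[OF M v(2)]
      by (simp add: mat_vec_add) (auto intro!: eq_vecI simp del: index_mult_mat_vec)
    then show ?thesis using oW w ad LW(3) by (simp add: gens_simps)
  qed
  have dd: "opd M *\<^sub>v u \<in> W" if u: "u \<in> U" for u
  proof -
    obtain w y z where w: "w \<in> W" "y \<in> U" "z \<in> U" "u = w + (opa M *\<^sub>v y + opd M *\<^sub>v z)" using gen[OF u] by auto
    note v = LW(1)[OF w(1)] LU(1)[OF w(2)] LU(1)[OF w(3)]
    have "opd M *\<^sub>v u = opd M *\<^sub>v w - opa M *\<^sub>v (opd M *\<^sub>v y)"
      unfolding w(4) using v d block1_vec(2)[OF M v(3)] block1_vec(3)[OF M v(2)]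
      by (simp add: mat_vec_add) (auto intro!: eq_vecI simp del: index_mult_mat_vec)
    then show ?thesis using oW w ad LW(5) by (simp add: gens_simps)
  qed
  fix x assume "x \<in> U"
  then obtain w y z where "w \<in> W" "y \<in> U" "z \<in> U" "x = w + (opa M *\<^sub>v y + opd M *\<^sub>v z)" using gen by blast
  then show "x \<in> W" using a dd LW(3) by simp
qed

lemma rep_carrier_block1: "block1 M \<Longrightarrow> rep_carrier M"
  by (simp add: block1_def D4_moduleD(1))

lemma submodule_D4_space:
  assumes "rep_carrier M"
  shows "submodule_D4 M (space M)"
  unfolding submodule_D4_iff lin_subspace_def using mult_mat_vec_carrier[OF rep_carrierD[OF assms]] by auto

section \<open>The syzygies of the simple modules\<close>

text \<open>The basis is \<open>e\<^sub>0, \<dots>, e\<^sub>s, f\<^sub>1, \<dots>, f\<^sub>s\<close>, in this order, with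
  \<open>a e\<^sub>i = f\<^sub>i\<^sub>+\<^sub>1\<close> and \<open>d e\<^sub>i = - f\<^sub>i\<close>, where \<open>f\<^sub>0 = f\<^sub>s\<^sub>+\<^sub>1 = 0\<close>; the scalar \<open>e\<close>
  is the eigenvalue of \<open>b\<close> on the span of the \<open>e\<^sub>i\<close>.\<close>

definition syz :: "nat \<Rightarrow> 'k \<Rightarrow> 'k::field rep" where
  "syz s e = \<lparr>rdim = 2 * s + 1,
     opa = sparse (2 * s + 1) (2 * s + 1) (\<lambda>i. if s < i then 1 else 0) (\<lambda>i. i - Suc s),
     opb = sparse (2 * s + 1) (2 * s + 1) (\<lambda>i. if s < i then - e else e) (\<lambda>i. i),
     opc = sparse (2 * s + 1) (2 * s + 1) (\<lambda>i. if s < i then - e else e) (\<lambda>i. i),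
     opd = sparse (2 * s + 1) (2 * s + 1) (\<lambda>i. if s < i then - 1 else 0) (\<lambda>i. i - s)\<rparr>"

lemma syz_rdim [simp]: "rdim (syz s e) = 2 * s + 1"
  by (simp add: syz_def)

lemma block1_syz:
  assumes e: "e * e = 1"
  shows "block1 (syz s e :: 'k::field rep)"
proof -
  have "opd (syz s e) * opa (syz s e) = (0\<^sub>m (2*s+1) (2*s+1) :: 'k mat)"
    unfolding sparse_zero[of _ _ "\<lambda>i. i - s - Suc s"] by (auto simp: syz_def sparse_simps intro!: sparse_eqI)
  moreover have "opa (syz s e) * opd (syz s e) = (0\<^sub>m (2*s+1) (2*s+1) :: 'k mat)"
    unfolding sparse_zero[of _ _ "\<lambda>i. i - s - Suc s"] by (auto simp: syz_def sparse_simps intro!: sparse_eqI)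
  moreover have "opb (syz s e) * opb (syz s e) = (1\<^sub>m (2*s+1) :: 'k mat)"
    unfolding sparse_one by (auto simp: e syz_def sparse_simps intro!: sparse_eqI)
  moreover have "opa (syz s e) * opa (syz s e) = (0\<^sub>m (2*s+1) (2*s+1) :: 'k mat)"
    unfolding sparse_zero[of _ _ "\<lambda>i. i - s - Suc s"] by (auto simp: syz_def sparse_simps intro!: sparse_eqI)
  moreover have "opd (syz s e) * opd (syz s e) = (0\<^sub>m (2*s+1) (2*s+1) :: 'k mat)"
    unfolding sparse_zero[of _ _ "\<lambda>i. i - s - s"] by (auto simp: syz_def sparse_simps intro!: sparse_eqI)
  moreover have "opb (syz s e) * opa (syz s e) = - (opa (syz s e) * opb (syz s e) :: 'k mat)"
    by (auto simp: syz_def sparse_simps split: if_splits intro!: sparse_eqI)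
  moreover have "opd (syz s e) * opb (syz s e) = - (opb (syz s e) * opd (syz s e) :: 'k mat)"
    by (auto simp: syz_def sparse_simps intro!: sparse_eqI)
  moreover have "opc (syz s e) = (opb (syz s e) :: 'k mat)" by (simp add: syz_def)
  moreover have "opa (syz s e) \<in> carrier_mat (2*s+1) (2*s+1)" "opb (syz s e) \<in> carrier_mat (2*s+1) (2*s+1)"
    "opd (syz s e) \<in> carrier_mat (2*s+1) (2*s+1)" by (simp_all add: syz_def)
  ultimately show ?thesis unfolding block1_def D4_module_def Let_def
    by (simp add: minus_r_inv_mat[of _ "2*s+1" "2*s+1"] mat_add_zero)
qed

lemma simple_V_eq_syz: "simple_V r = syz 0 (pow_neg1 r)"
  by (auto simp: simple_V_def syz_def sparse_def intro!: eq_matI)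

section \<open>The projective cover of an explicit syzygy and its kernel\<close>

definition syz_top :: "nat \<Rightarrow> 'k::field mat" where
  "syz_top s = sparse (2 * s + 1) (s + 1) (\<lambda>i. if s < i then 0 else 1) (\<lambda>i. i)"

text \<open>With free generators \<open>g_0, ..., g_s\<close>, the first matrix sends
  \<open>g_i\<close> to \<open>e_i\<close> and \<open>a g_i\<close> to \<open>f_(i+1)\<close>, the
  second contributes \<open>- f_i\<close> as the image of \<open>d g_i\<close>. The vectors
  \<open>a g_s\<close> and \<open>d g_0\<close>, and the whole block \<open>a d g\<close>, go to
  0.\<close>

definition syz_proj :: "nat \<Rightarrow> 'k::field mat" where
  "syz_proj s = sparse (2 * s + 1) (4 * (s + 1)) (\<lambda>_. 1) (\<lambda>i. i)
     - sparse (2 * s + 1) (4 * (s + 1)) (\<lambda>i. if s < i then 1 else 0) (\<lambda>i. 2 * (s + 1) + i - s)"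

text \<open>The row description of \<open>syz_incl\<close>. For the basis \<open>e'_j\<close>,
  \<open>f'_j\<close> of the next syzygy, \<open>e'_j\<close> goes to
  \<open>a g_(j-1) + d g_j\<close> and \<open>f'_(j+1)\<close> to \<open>a d g_j\<close>, terms out
  of range being 0. These are kernel vectors since \<open>a g_(j-1)\<close> and \<open>d g_j\<close>
  are mapped to \<open>f_j\<close> and \<open>- f_j\<close>.\<close>

definition syz_index :: "nat \<Rightarrow> nat \<Rightarrow> nat" where
  "syz_index s i = (if i < 2 * (s + 1) then i - s else if i < 3 * (s + 1) then i - 2 * (s + 1) else i - 2 * (s + 1)
    + 1)"

definition syz_incl :: "nat \<Rightarrow> 'k::field mat" where
  "syz_incl s = sparse (4 * (s + 1)) (2 * (s + 1) + 1) (\<lambda>i. if i < s + 1 then 0 else 1) (syz_index s)"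

lemma syz_index_less: "i < 4 * (s + 1) \<Longrightarrow> syz_index s i < 2 * (s + 1) + 1"
  by (auto simp: syz_index_def)

lemma syz_incl_mult:
  "syz_incl s * sparse (2 * (s + 1) + 1) k c \<sigma> =
     sparse (4 * (s + 1)) k (\<lambda>i. (if i < s + 1 then 0 else 1) * c (syz_index s i)) (\<lambda>i. \<sigma> (syz_index s i))"
  unfolding syz_incl_def by (rule sparse_mult) (rule syz_index_less)

lemma mult_syz_incl:
  assumes "\<And>i. i < n \<Longrightarrow> \<sigma> i < 4 * (s + 1)"
  shows "sparse n (4 * (s + 1)) c \<sigma> * syz_incl s =
     sparse n (2 * (s + 1) + 1) (\<lambda>i. c i * (if \<sigma> i < s + 1 then 0 else 1)) (\<lambda>i. syz_index s (\<sigma> i))"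
  unfolding syz_incl_def by (rule sparse_mult) (rule assms)

lemma eigen_syz_top: "eigen (syz s e) e (syz_top s)"
  by (auto simp: eigen_def syz_def syz_top_def sparse_simps intro!: sparse_eqI)

text \<open>The explicit matrix is convenient for computing the kernel; its description as a
  \<open>free_hom\<close> supplies the homomorphism property.\<close>

lemma syz_proj_eq: "syz_proj s = free_hom (s + 1) (syz s e) (syz_top s)"
proof -
  have 0: "syz_top s * gcoord (s + 1) 0 = sparse (2*s+1) (4 * (s + 1)) (\<lambda>i. if s < i then 0 else 1) (\<lambda>i. i)"
    by (auto simp: syz_top_def gcoord_def sparse_simps split: if_splits intro!: sparse_eqI)
  have 1: "opa (syz s e) * (syz_top s * gcoord (s + 1) (Suc 0)) = sparse (2*s+1) (4 * (s + 1)) (\<lambda>i. if s < i then 1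
    else 0) (\<lambda>i. i)"
    by (auto simp: syz_def syz_top_def gcoord_def sparse_simps split: if_splits intro!: sparse_eqI)
  have 2: "opd (syz s e) * (syz_top s * gcoord (s + 1) 2) = sparse (2*s+1) (4 * (s + 1)) (\<lambda>i. if s < i then -1 else
    0) (\<lambda>i. 2 * (s + 1) + i - s)"
    by (auto simp: syz_def syz_top_def gcoord_def sparse_simps split: if_splits intro!: sparse_eqI)
  have 3: "opa (syz s e) * (opd (syz s e) * (syz_top s * gcoord (s + 1) 3)) = 0\<^sub>m (2*s+1) (4 * (s + 1))"
    unfolding sparse_zero[of _ _ "\<lambda>i. i"] by (auto simp: syz_def syz_top_def gcoord_def sparse_simps split:
      if_splits intro!: sparse_eqI)
  show ?thesis unfolding free_hom_def syz_proj_def 0 1 2 3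
    by (intro eq_matI) (auto simp: sparse_index)
qed

lemma syz_proj_vec:
  assumes "dim_vec x = 4 * (s + 1)" "i < 2 * s + 1"
  shows "(syz_proj s *\<^sub>v x) $ i = x $ i - (if s < i then x $ (2 * (s + 1) + i - s) else 0)"
  using assms by (simp add: syz_proj_def mat_minus_vec sparse_vec del: index_mult_mat_vec)

lemma projective_cover_syz:
  assumes two: "(2::'k::field) \<noteq> 0" and e: "e * e = (1::'k)"
  shows "projective_cover (free (s + 1) e) (syz_proj s) (syz s e)"
proof -
  define m where "m = s + 1"
  let ?F = "free m e" and ?m = m
  have F: "block1 ?F" by (rule block1_free[OF e])
  have S: "D4_module (syz s e)" using block1_syz[OF e] by (simp add: block1_def)
  have top: "syz_top s \<in> carrier_mat (rdim (syz s e)) ?m" by (simp add: syz_top_def m_def)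
  have hom: "syz_proj s \<in> hom_D4 ?F (syz s e)"
    using free_hom(1)[OF S top[unfolded m_def] eigen_syz_top e] unfolding syz_proj_eq[of s e, symmetric] m_def .
  \<comment> \<open>A linear section: \<open>e_i\<close> is lifted to \<open>g_i\<close> and
    \<open>f_(i+1)\<close> to \<open>a g_i\<close>, that is, to the first \<open>2 * s + 1\<close>
    basis vectors. The second matrix in \<open>syz_proj\<close> looks only at coordinates beyond
    these.\<close>
  have "syz_proj s * sparse (4 * ?m) (2 * s + 1) (\<lambda>i. if i < 2 * s + 1 then 1 else 0) (\<lambda>i. i) = (1\<^sub>m (2 * s + 1) ::
    'k mat)"
  proof -
    let ?R = "sparse (4 * ?m) (2 * s + 1) (\<lambda>i. if i < 2 * s + 1 then 1 else 0) (\<lambda>i. i) :: 'k mat"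
    have 1: "sparse (2 * s + 1) (4 * ?m) (\<lambda>_. 1) (\<lambda>i. i) * ?R = 1\<^sub>m (2 * s + 1)"
      unfolding sparse_one by (subst sparse_mult) (auto simp: m_def intro: sparse_eqI)
    have 2: "sparse (2 * s + 1) (4 * ?m) (\<lambda>i. if s < i then 1 else 0) (\<lambda>i. 2 * ?m + i - s) * ?R = 0\<^sub>m (2 * s + 1) (2
      * s + 1)"
      unfolding sparse_zero[of _ _ "\<lambda>i. 2 * ?m + i - s"] by (subst sparse_mult) (auto simp: m_def intro: sparse_eqI)
    show ?thesis unfolding syz_proj_def m_def[symmetric]
      by (subst mat_minus_mult) (simp_all only: sparse_dim 1 2, intro eq_matI, simp_all)
  qed
  then have "(*\<^sub>v) (syz_proj s) ` space ?F = space (syz s e)"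
    using right_inverse_surj[OF hom_D4D(1)[OF hom], of "sparse (4 * ?m) (2 * s + 1) (\<lambda>i. if i < 2 * s + 1 then 1
      else 0) (\<lambda>i. i)"] by simp
  with hom have epi: "syz_proj s \<in> epi_D4 ?F (syz s e)" by (simp add: epi_D4_def)
  have small: "U = space ?F" if U: "submodule_D4 ?F U"
    and sum: "{u + w |u w. u \<in> U \<and> w \<in> mat_kernel (syz_proj s)} = space ?F" for U
  proof
    show "U \<subseteq> space ?F" using lin_subspaceD(1)[OF submodule_D4D(1)[OF U]] by auto
    show "space ?F \<subseteq> U"
    proof (rule nakayama[OF F submodule_D4_space[OF rep_carrier_block1[OF F]] U])
      fix x assume "x \<in> space ?F"
      then have "x \<in> {u + w |u w. u \<in> U \<and> w \<in> mat_kernel (syz_proj s)}" unfolding sum .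
      then obtain u w where uw: "u \<in> U" "w \<in> mat_kernel (syz_proj s)" "x = u + w" by auto
      then have w: "dim_vec w = 4 * ?m" "syz_proj s *\<^sub>v w = 0\<^sub>v (2 * s + 1)"
        by (auto simp: mat_kernel_def syz_proj_def m_def)
      have "w $ i = 0" if "i < ?m" for i
        using syz_proj_vec[OF w(1)[unfolded m_def], of i] that[unfolded m_def] unfolding w(2) by simp
      then have E0: "gcoord ?m 0 *\<^sub>v w = 0\<^sub>v ?m"
        by (intro eq_vecI) (simp_all add: gcoord_def sparse_vec w(1) del: index_mult_mat_vec)
      \<comment> \<open>The block \<open>a d g\<close> is counted as part of \<open>a F\<close>,
        which explains the summand with \<open>opd\<close> inside \<open>y\<close>.\<close>
      define y where "y = gincl ?m *\<^sub>v (gcoord ?m (Suc 0) *\<^sub>v w) + opd ?F *\<^sub>v (gincl ?m *\<^sub>v (gcoord ?m 3 *\<^sub>v w))"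
      define z where "z = gincl ?m *\<^sub>v (gcoord ?m 2 *\<^sub>v w)"
      have yz: "y \<in> space ?F" "z \<in> space ?F" by (rule carrier_vecI, simp add: y_def z_def)+
      have "w = 1\<^sub>m (4 * ?m) *\<^sub>v w" using w(1) by (simp add: mat_one_vec)
      also have "\<dots> = opa ?F *\<^sub>v y + opd ?F *\<^sub>v z" unfolding free_decomposition[of ?m e] y_def z_def
        using w(1) by (simp add: mat_vec E0 del: mult_Suc_right add_Suc_right) (intro eq_vecI; simp add: add.commute
          add.left_commute del: index_mult_mat_vec)
      finally show "\<exists>w\<in>U. \<exists>y\<in>space ?F. \<exists>z\<in>space ?F. x = w + (opa ?F *\<^sub>v y + opd ?F *\<^sub>v z)"
        using uw(1,3) yz by metis
    qed
  qed
  show ?thesis unfolding projective_cover_def m_def[symmetric]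
    by (intro conjI allI impI free_projective[OF two e] S epi) (elim conjE, rule small)
qed

lemma is_Omega_syz:
  assumes two: "(2::'k::field) \<noteq> 0" and e: "e * e = (1::'k)"
  shows "is_Omega (syz s e) (syz (s + 1) (- e))"
proof -
  let ?F = "free (s + 1) e" and ?m = "s + 1" and ?K = "syz (s + 1) (- e)"
  have K: "D4_module ?K" using block1_syz[of "- e" "s + 1"] e by (simp add: block1_def)
  have hom: "syz_incl s \<in> hom_D4 ?K ?F"
    unfolding hom_D4_def
  proof (intro CollectI conjI)
    show "syz_incl s \<in> carrier_mat (rdim ?F) (rdim ?K)" by (simp add: syz_incl_def)
    show "syz_incl s * opa ?K = opa ?F * syz_incl s"
      unfolding syz_def free_def rep.simps syz_incl_mult
      by (subst mult_syz_incl, force) (rule sparse_eqI; auto simp: syz_index_def split: if_splits)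
    show "syz_incl s * opb ?K = opb ?F * syz_incl s"
      unfolding syz_def free_def rep.simps syz_incl_mult
      by (subst mult_syz_incl, force) (rule sparse_eqI; auto simp: syz_index_def split: if_splits)
    show "syz_incl s * opc ?K = opc ?F * syz_incl s"
      unfolding syz_def free_def rep.simps syz_incl_mult
      by (subst mult_syz_incl, force) (rule sparse_eqI; auto simp: syz_index_def split: if_splits)
    show "syz_incl s * opd ?K = opd ?F * syz_incl s"
      unfolding syz_def free_def rep.simps syz_incl_mult
      by (subst mult_syz_incl, force) (rule sparse_eqI; auto simp: syz_index_def split: if_splits)
  qed
  \<comment> \<open>A left inverse of \<open>syz_incl\<close>, reading each coefficient from one row
    where it occurs: \<open>e'_j\<close> with \<open>j \<le> s\<close> from \<open>d g_j\<close>,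
    the last \<open>e'_(s+1)\<close> from \<open>a g_s\<close>, and \<open>f'_(j+1)\<close> from
    \<open>a d g_j\<close>.\<close>
  define J :: "'k mat" where "J = sparse (2 * ?m + 1) (4 * ?m) (\<lambda>_. 1)
    (\<lambda>i. if i \<le> s then 2 * ?m + i else if i = ?m then 2 * ?m - 1 else 2 * ?m + i - 1)"
  have "J * syz_incl s = 1\<^sub>m (2 * ?m + 1)"
    unfolding sparse_one J_def
    by (subst mult_syz_incl, force) (rule sparse_eqI; auto simp: syz_index_def split: if_splits)
  then have mono: "syz_incl s \<in> mono_D4 ?K ?F"
    using left_inverse_inj[OF hom_D4D(1)[OF hom], of J] hom by (simp add: mono_D4_def J_def)
  have zero: "syz_proj s * syz_incl s = (0\<^sub>m (2 * s + 1) (2 * ?m + 1) :: 'k mat)"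
  proof -
    have "sparse (2 * s + 1) (4 * ?m) (\<lambda>_. 1) (\<lambda>i. i) * syz_incl s =
      (sparse (2 * s + 1) (4 * ?m) (\<lambda>i. if s < i then 1 else 0) (\<lambda>i. 2 * ?m + i - s) * syz_incl s :: 'k mat)"
      by (subst mult_syz_incl, force, subst mult_syz_incl, force)
        (rule sparse_eqI; auto simp: syz_index_def split: if_splits)
    note eq = this
    have "syz_proj s * syz_incl s =
      sparse (2 * s + 1) (4 * ?m) (\<lambda>_. 1) (\<lambda>i. i) * syz_incl s
      - (sparse (2 * s + 1) (4 * ?m) (\<lambda>i. if s < i then 1 else 0) (\<lambda>i. 2 * ?m + i - s) * syz_incl s :: 'k mat)"
      unfolding syz_proj_def by (rule mat_minus_mult) (simp_all add: syz_incl_def)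
    also have "\<dots> = 0\<^sub>m (2 * s + 1) (2 * ?m + 1)"
      unfolding eq by (rule minus_r_inv_mat, rule carrier_matI) (simp_all add: syz_incl_def)
    finally show ?thesis .
  qed
  have "(*\<^sub>v) (syz_incl s) ` space ?K = mat_kernel (syz_proj s :: 'k mat)"
  proof
    show "(*\<^sub>v) (syz_incl s) ` space ?K \<subseteq> mat_kernel (syz_proj s :: 'k mat)"
    proof clarify
      fix y :: "'k vec" assume y: "y \<in> space ?K"
      then have "syz_proj s *\<^sub>v (syz_incl s *\<^sub>v y) = (syz_proj s * syz_incl s) *\<^sub>v y"
        by (simp add: mat_mult_vec_assoc syz_incl_def syz_proj_def)
      then show "syz_incl s *\<^sub>v y \<in> mat_kernel (syz_proj s :: 'k mat)"
        unfolding zero using y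
        by (intro mat_kernelI[of _ "2 * s + 1" "4 * ?m"] carrier_vecI) (simp_all add: mat_vec_zero syz_incl_def
          syz_proj_def minus_carrier_mat)
    qed
    show "mat_kernel (syz_proj s :: 'k mat) \<subseteq> (*\<^sub>v) (syz_incl s) ` space ?K"
    proof
      fix x :: "'k vec" assume "x \<in> mat_kernel (syz_proj s)"
      then have x: "dim_vec x = 4 * ?m" "syz_proj s *\<^sub>v x = 0\<^sub>v (2 * s + 1)" by (auto simp: mat_kernel_def syz_proj_def)
      have ker: "x $ i = (if s < i then x $ (2 * ?m + i - s) else 0)" if "i < 2 * s + 1" for i
        using syz_proj_vec[OF x(1) that] that unfolding x(2) by simp
      have Jx: "dim_vec (J *\<^sub>v x) = 2 * ?m + 1" by (simp add: J_def)
      have J: "(J *\<^sub>v x) $ i = x $ (if i \<le> s then 2 * ?m + i else if i = ?m then 2 * ?m - 1 else 2 * ?m + i - 1)"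
        if "i < 2 * ?m + 1" for i
        using that unfolding J_def by (simp add: sparse_vec x(1) del: index_mult_mat_vec)
      \<comment> \<open>Exactness: a kernel vector is recovered from the coordinates that
        \<open>J\<close> reads.\<close>
      have "x = syz_incl s *\<^sub>v (J *\<^sub>v x)"
      proof (rule eq_vecI)
        fix k assume "k < dim_vec (syz_incl s *\<^sub>v (J *\<^sub>v x))"
        then have k: "k < 4 * ?m" by (simp add: syz_incl_def)
        have eq: "(syz_incl s *\<^sub>v (J *\<^sub>v x)) $ k = (if k < ?m then 0 else 1) * (J *\<^sub>v x) $ syz_index s k"
          unfolding syz_incl_def sparse_vec[OF Jx k] using syz_index_less[OF k] by simp
        define j where "j = (if syz_index s k \<le> s then 2 * ?m + syz_index s k else if syz_index s k = ?m then 2 * ?m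
          - 1 else 2 * ?m + syz_index s k - 1)"
        have J': "(J *\<^sub>v x) $ syz_index s k = x $ j" unfolding J[OF syz_index_less[OF k]] j_def ..
        show "x $ k = (syz_incl s *\<^sub>v (J *\<^sub>v x)) $ k"
        \<comment> \<open>For these \<open>k\<close> the kernel equations decide: the generator
          coordinates vanish, and the coordinate at \<open>a g_j\<close> equals the one at
          \<open>d g_(j+1)\<close>, which \<open>J\<close> reads. All remaining coordinates are read
          by \<open>J\<close> directly.\<close>
        proof (cases "k < 2 * s + 1")
          case True
          have "s < k \<Longrightarrow> j = 2 * ?m + k - s" using True by (auto simp: j_def syz_index_def)
          then show ?thesis unfolding eq J' using ker[OF True] by (cases "s < k") auto
        next
          case False
          consider "k = 2 * s + 1" | i where "k = 2 * ?m + i" "i < ?m" | i where "k = 3 * ?m + i" "i < ?m"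
          proof (cases "k < 3 * ?m")
            case True
            show ?thesis
            proof (cases "k = 2 * s + 1")
              case k': False
              have "k = 2 * ?m + (k - 2 * ?m)" "k - 2 * ?m < ?m" using False k' True by auto
              then show ?thesis using that(2) by blast
            qed (use that(1) in blast)
          next
            case f: False
            have "k = 3 * ?m + (k - 3 * ?m)" "k - 3 * ?m < ?m" using f k by auto
            then show ?thesis using that(3) by blast
          qed
          then have "j = k" by cases (auto simp: j_def syz_index_def)
          then show ?thesis unfolding eq J' using False by simp
        qed
      qed (simp add: x(1) syz_incl_def)
      then show "x \<in> (*\<^sub>v) (syz_incl s) ` space ?K" by (rule image_eqI) (rule carrier_vecI, simp only: Jx syz_rdim)
    qed
  qed
  then show ?thesis unfolding is_Omega_def
    by (intro conjI exI[of _ ?F] exI[of _ "syz_proj s"] exI[of _ "syz_incl s"] K projective_cover_syz[OF two e] mono)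
qed

text \<open>The factor \<open>(- 1) ^ s\<close> arises because each step places the new top inside
  the odd part \<open>a F + d F\<close> of the cover.\<close>

lemma is_Omega_power_syz:
  assumes two: "(2::'k::field) \<noteq> 0" and e: "e * e = (1::'k)" and N: "(is_Omega ^^ s) (syz 0 e) N"
  shows "D4_module N \<and> N \<cong>\<^sub>D syz s ((- 1) ^ s * e)"
  using N
proof (induction s arbitrary: N)
  case 0
  have "D4_module (syz 0 e)" using block1_syz[OF e] by (simp add: block1_def)
  then show ?case using 0 iso_D4_refl[OF D4_moduleD(1)] by auto
next
  case (Suc s)
  then obtain M where M: "(is_Omega ^^ s) (syz 0 e) M" and MN: "is_Omega M N" by auto
  let ?e = "(- 1) ^ s * e"
  have "?e * ?e = 1" using e by (simp add: mult.assoc mult.left_commute[of e] flip: power_mult_distrib)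
  then have "is_Omega (syz s ?e) (syz (s + 1) (- ?e))" by (rule is_Omega_syz[OF two])
  then have "N \<cong>\<^sub>D syz (s + 1) (- ?e)" using is_Omega_cong Suc.IH[OF M] MN by blast
  then show ?case using MN by (simp add: is_Omega_def)
qed

section \<open>Duality\<close>

text \<open>The defining relations are invariant under reversing products, so transposing the operators gives a
  duality fixing the generators; it exchanges \<open>\<Omega>\<close> and \<open>\<Omega>\<^sup>-\<^sup>1\<close>.\<close>

definition dual :: "'k::field rep \<Rightarrow> 'k rep" where
  "dual M = \<lparr>rdim = rdim M, opa = transpose_mat (opa M), opb = transpose_mat (opb M),
     opc = transpose_mat (opc M), opd = transpose_mat (opd M)\<rparr>"

lemma dual_rdim [simp]: "rdim (dual M) = rdim M"
  by (simp add: dual_def)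

lemma dual_dual [simp]: "dual (dual M) = M"
  by (simp add: dual_def)

lemma dual_gens: "t \<in> gens \<Longrightarrow> t (dual M) = transpose_mat (t M)"
  by (auto simp: gens_def dual_def)

lemma rep_carrier_dual: "rep_carrier M \<Longrightarrow> rep_carrier (dual M)"
  unfolding rep_carrier_def by (simp add: dual_gens)

lemma transpose_mult_dim: "dim_col A = dim_row B \<Longrightarrow> transpose_mat (A * B) = transpose_mat B * transpose_mat (A ::
  'a::comm_semiring_0 mat)"
  by (rule transpose_mult[of _ "dim_row A" "dim_col A" _ "dim_col B"]) (simp_all only: carrier_mat_def
    mem_Collect_eq simp_thms)

lemma D4_module_dual:
  assumes "D4_module M"
  shows "D4_module (dual M)"
proof -
  note D = D4_moduleD[OF assms]
  have d: "dim_row (opa M) = rdim M" "dim_col (opa M) = rdim M" "dim_row (opb M) = rdim M" "dim_col (opb M) = rdim M"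
    "dim_row (opc M) = rdim M" "dim_col (opc M) = rdim M" "dim_row (opd M) = rdim M" "dim_col (opd M) = rdim M"
    using D(2-5) by auto
  have tr: "transpose_mat (s M) * transpose_mat (t M) = transpose_mat (t M * s M)" if "s \<in> gens" "t \<in> gens" for s t
    using that d by (auto simp: gens_def transpose_mult_dim)
  note trs = tr[OF gens_simps(1,1)] tr[OF gens_simps(1,2)] tr[OF gens_simps(1,3)] tr[OF gens_simps(1,4)]
    tr[OF gens_simps(2,1)] tr[OF gens_simps(2,2)] tr[OF gens_simps(2,3)] tr[OF gens_simps(2,4)]
    tr[OF gens_simps(3,1)] tr[OF gens_simps(3,2)] tr[OF gens_simps(3,3)] tr[OF gens_simps(3,4)]
    tr[OF gens_simps(4,1)] tr[OF gens_simps(4,2)] tr[OF gens_simps(4,3)] tr[OF gens_simps(4,4)]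
  have "transpose_mat (opd M * opa M + opa M * opd M) = transpose_mat (opa M * opd M) + transpose_mat (opd M * opa M)"
    using d by (intro eq_matI) (simp_all add: add.commute del: index_mult_mat(1))
  moreover have "transpose_mat (1\<^sub>m (rdim M) - opb M * opc M) = 1\<^sub>m (rdim M) - transpose_mat (opc M * opb M)"
    unfolding D(10) using d by (intro eq_matI) (auto simp del: index_mult_mat(1))
  ultimately have "transpose_mat (opa M * opd M) + transpose_mat (opd M * opa M) = 1\<^sub>m (rdim M) - transpose_mat (opc
    M * opb M)"
    unfolding D(15) by simp
  then show ?thesis unfolding D4_module_def Let_def dual_def rep.simps trs
    using D(2-5) by (simp add: D(6-14) transpose_uminus)
qed

lemma hom_D4_dual:
  assumes f: "f \<in> hom_D4 M N" and c: "rep_carrier M" "rep_carrier N"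
  shows "transpose_mat f \<in> hom_D4 (dual N) (dual M)"
  unfolding hom_D4_iff
proof (intro conjI ballI)
  show "transpose_mat f \<in> carrier_mat (rdim (dual M)) (rdim (dual N))" using hom_D4D(1)[OF f] by simp
  fix t :: "'a rep \<Rightarrow> 'a mat" assume t: "t \<in> gens"
  note d = hom_D4D(1)[OF f] rep_carrierD[OF c(1) t] rep_carrierD[OF c(2) t]
  have "transpose_mat f * t (dual N) = transpose_mat (t N * f)"
    unfolding dual_gens[OF t] using d by (subst transpose_mult_dim) auto
  also have "\<dots> = transpose_mat (f * t M)" unfolding hom_D4D(2)[OF f t] ..
  also have "\<dots> = t (dual M) * transpose_mat f"
    unfolding dual_gens[OF t] using d by (subst transpose_mult_dim) auto
  finally show "transpose_mat f * t (dual N) = t (dual M) * transpose_mat f" .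
qed

lemma mono_D4_dual:
  assumes i: "i \<in> mono_D4 M N" and c: "rep_carrier M" "rep_carrier N"
  shows "transpose_mat i \<in> epi_D4 (dual N) (dual M)"
proof -
  have h: "i \<in> hom_D4 M N" using i by (simp add: mono_D4_def)
  obtain L where L: "L \<in> carrier_mat (rdim M) (rdim N)" "L * i = 1\<^sub>m (rdim M)"
    using mono_D4_left_inverse[OF i] by blast
  have "transpose_mat i * transpose_mat L = transpose_mat (L * i)" using L(1) hom_D4D(1)[OF h]
    by (simp add: transpose_mult_dim)
  then have "transpose_mat i * transpose_mat L = 1\<^sub>m (rdim M)" unfolding L(2) by simp
  then have "(*\<^sub>v) (transpose_mat i) ` carrier_vec (rdim N) = carrier_vec (rdim M)"
    using right_inverse_surj[of "transpose_mat i" "rdim M" "rdim N" "transpose_mat L"] hom_D4D(1)[OF h] L(1) by simp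
  then show ?thesis using hom_D4_dual[OF h c] by (simp add: epi_D4_def)
qed

lemma epi_D4_dual:
  assumes p: "p \<in> epi_D4 M N" and c: "rep_carrier M" "rep_carrier N"
  shows "transpose_mat p \<in> mono_D4 (dual N) (dual M)"
proof -
  have h: "p \<in> hom_D4 M N" using p by (simp add: epi_D4_def)
  obtain R where R: "R \<in> carrier_mat (rdim M) (rdim N)" "p * R = 1\<^sub>m (rdim N)"
    using epi_D4_right_inverse[OF p] by blast
  have "transpose_mat R * transpose_mat p = transpose_mat (p * R)" using R(1) hom_D4D(1)[OF h]
    by (simp add: transpose_mult_dim)
  then have "transpose_mat R * transpose_mat p = 1\<^sub>m (rdim N)" unfolding R(2) by simp
  then have "inj_on ((*\<^sub>v) (transpose_mat p)) (carrier_vec (rdim N))"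
    using left_inverse_inj[of "transpose_mat p" "rdim M" "rdim N" "transpose_mat R"] hom_D4D(1)[OF h] R(1) by simp
  then show ?thesis using hom_D4_dual[OF h c] by (simp add: mono_D4_def)
qed

text \<open>Transposition turns a lifting problem along an epimorphism onto \<open>Y\<close> into an
  extension problem along a monomorphism out of \<open>dual Y\<close>.\<close>

lemma injective_dual:
  assumes I: "injective I"
  shows "projective (dual I)"
  unfolding projective_def
proof (intro conjI allI ballI impI)
  have Im: "D4_module I" using I by (simp add: injective_def)
  show "D4_module (dual I)" by (rule D4_module_dual[OF Im])
  fix X Y :: "'a rep" and g f assume g: "g \<in> epi_D4 X Y" and f: "f \<in> hom_D4 (dual I) Y"
    and XY: "D4_module X \<and> D4_module Y"
  note rc = D4_moduleD(1)[OF XY[THEN conjunct1]] D4_moduleD(1)[OF XY[THEN conjunct2]] D4_moduleD(1)[OF Im]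
  have g': "transpose_mat g \<in> mono_D4 (dual Y) (dual X)" by (rule epi_D4_dual[OF g rc(1,2)])
  have f': "transpose_mat f \<in> hom_D4 (dual Y) I"
    using hom_D4_dual[OF f rep_carrier_dual[OF rc(3)] rc(2)] by simp
  have "D4_module (dual Y) \<and> D4_module (dual X)" using XY D4_module_dual by blast
  then obtain h where h: "h \<in> hom_D4 (dual X) I" "h * transpose_mat g = transpose_mat f"
    using I g' f' unfolding injective_def by blast
  have h': "transpose_mat h \<in> hom_D4 (dual I) X"
    using hom_D4_dual[OF h(1) rep_carrier_dual[OF rc(1)] rc(3)] by simp
  have "g \<in> hom_D4 X Y" using g by (simp add: epi_D4_def)
  then have "g * transpose_mat h = transpose_mat (h * transpose_mat g)"
    using hom_D4D(1)[OF h(1)] hom_D4D(1)[of g X Y] by (simp add: transpose_mult_dim)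
  also have "\<dots> = f" unfolding h(2) by simp
  finally show "\<exists>h\<in>hom_D4 (dual I) X. g * h = f" using h' by blast
qed

section \<open>The standard pairing, orthogonal complements, and the dual of an injective
  envelope\<close>

lemma scalar_prod_mult_transpose:
  fixes A :: "'a::comm_semiring_0 mat"
  assumes "A \<in> carrier_mat n m" "x \<in> carrier_vec n" "y \<in> carrier_vec m"
  shows "(transpose_mat A *\<^sub>v x) \<bullet> y = x \<bullet> (A *\<^sub>v y)"
proof -
  have "(transpose_mat A *\<^sub>v x) \<bullet> y = (\<Sum>j = 0..<m. (\<Sum>i = 0..<n. A $$ (i, j) * x $ i) * y $ j)"
    using assms by (auto simp: scalar_prod_def intro!: sum.cong)
  also have "\<dots> = (\<Sum>j = 0..<m. \<Sum>i = 0..<n. x $ i * (A $$ (i, j) * y $ j))"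
    unfolding sum_distrib_right by (intro sum.cong refl) (simp add: ac_simps)
  also have "\<dots> = (\<Sum>i = 0..<n. \<Sum>j = 0..<m. x $ i * (A $$ (i, j) * y $ j))" by (rule sum.swap)
  also have "\<dots> = x \<bullet> (A *\<^sub>v y)"
    using assms by (auto simp: scalar_prod_def sum_distrib_left intro!: sum.cong)
  finally show ?thesis .
qed

lemma scalar_prod_zero_imp:
  fixes x :: "'k::field vec"
  assumes "x \<in> carrier_vec n" "\<And>y. y \<in> carrier_vec n \<Longrightarrow> y \<bullet> x = 0"
  shows "x = 0\<^sub>v n"
proof (rule eq_vecI)
  fix i assume "i < dim_vec (0\<^sub>v n :: 'k vec)"
  then have i: "i < n" by simp
  then have "unit_vec n i \<bullet> x = x $ i" using assms(1) by (simp add: scalar_prod_left_unit)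
  then show "x $ i = 0\<^sub>v n $ i" using assms(2)[of "unit_vec n i"] i by simp
qed (use assms in auto)

text \<open>For \<open>U\<close> the image of \<open>A\<close> with left inverse \<open>B\<close>,
  the matrix \<open>1 - A B\<close> vanishes on \<open>U\<close>, so the image of its transpose is
  orthogonal to \<open>U\<close> and hence zero. Then \<open>A B = 1\<close>, and \<open>U\<close>
  is everything.\<close>

lemma lin_subspace_orth:
  fixes U :: "'k::field vec set"
  assumes U: "lin_subspace n U" and orth: "\<And>x. x \<in> carrier_vec n \<Longrightarrow> (\<And>u. u \<in> U \<Longrightarrow> u \<bullet> x = 0) \<Longrightarrow> x = 0\<^sub>v n"
  shows "U = carrier_vec n"
proof -
  obtain d A B where A: "A \<in> carrier_mat n d" and B: "B \<in> carrier_mat d n" and BA: "B * A = 1\<^sub>m d"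
    and im: "(*\<^sub>v) A ` carrier_vec d = U" using lin_subspace_split[OF U] by metis
  let ?E = "1\<^sub>m n - A * B"
  have E: "?E \<in> carrier_mat n n" using A B by (simp add: minus_carrier_mat)
  have EA: "?E * A = 0\<^sub>m n d" using A B BA by (simp add: mat_ring)
  have "transpose_mat ?E *\<^sub>v y = 0\<^sub>v n" if y: "y \<in> carrier_vec n" for y
  proof (rule orth)
    show "transpose_mat ?E *\<^sub>v y \<in> carrier_vec n" using E y by (intro mult_mat_vec_carrier[of _ n n]) auto
    fix u assume "u \<in> U"
    then obtain z where z: "z \<in> carrier_vec d" "u = A *\<^sub>v z" using im by auto
    then have u: "u \<in> carrier_vec n" using A by auto
    have "?E *\<^sub>v u = (?E * A) *\<^sub>v z" unfolding z(2) using E A z(1) by (simp add: mat_mult_vec_assoc)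
    then have "?E *\<^sub>v u = 0\<^sub>v n" unfolding EA using z(1) by (simp add: mat_vec_zero)
    then have "(transpose_mat ?E *\<^sub>v y) \<bullet> u = 0" unfolding scalar_prod_mult_transpose[OF E y u] using y by simp
    then show "u \<bullet> (transpose_mat ?E *\<^sub>v y) = 0" using u E y by (subst comm_scalar_prod[of _ n]) auto
  qed
  then have "transpose_mat ?E = 0\<^sub>m n n"
    using E by (intro eq_mat_by_vec[of _ n n]) (auto simp: mat_vec_zero)
  then have "?E = 0\<^sub>m n n" by (metis transpose_transpose zero_transpose_mat)
  then have AB: "x = A *\<^sub>v (B *\<^sub>v x)" if "x \<in> carrier_vec n" for x
  proof -
    have "?E *\<^sub>v x = x - A *\<^sub>v (B *\<^sub>v x)" using A B that by (simp add: mat_vec)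
    then have z: "x - A *\<^sub>v (B *\<^sub>v x) = 0\<^sub>v n" unfolding \<open>?E = 0\<^sub>m n n\<close> using that by (simp add: mat_vec_zero)
    show ?thesis
    proof (rule eq_vecI)
      fix i assume "i < dim_vec (A *\<^sub>v (B *\<^sub>v x))"
      then have i: "i < n" using A by auto
      have "(x - A *\<^sub>v (B *\<^sub>v x)) $ i = 0" unfolding z using i by simp
      then show "x $ i = (A *\<^sub>v (B *\<^sub>v x)) $ i" using i A by (simp del: index_mult_mat_vec)
    qed (use A that in auto)
  qed
  show ?thesis
  proof
    show "carrier_vec n \<subseteq> U"
    proof
      fix x :: "'k vec" assume x: "x \<in> carrier_vec n"
      have "A *\<^sub>v (B *\<^sub>v x) \<in> (*\<^sub>v) A ` carrier_vec d" using B x by auto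
      then show "x \<in> U" using AB[OF x] im by simp
    qed
  qed (use lin_subspaceD(1)[OF U] in auto)
qed

lemma is_Omega_inv_dual:
  assumes "is_Omega_inv M C"
  shows "is_Omega (dual M) (dual C)"
proof -
  obtain I i p where C: "D4_module C" and ie: "injective_envelope I i M" and p: "p \<in> epi_D4 I C"
    and ker: "mat_kernel p = (*\<^sub>v) i ` space M" using assms unfolding is_Omega_inv_def by blast
  have inj: "injective I" and I: "D4_module I" and M: "D4_module M" and i: "i \<in> mono_D4 M I"
    and ess: "\<And>U. submodule_D4 I U \<Longrightarrow> U \<inter> (*\<^sub>v) i ` space M = zero_space I \<Longrightarrow> U = zero_space I"
    using ie by (auto simp: injective_envelope_def injective_def)
  note rc = D4_moduleD(1)[OF I] D4_moduleD(1)[OF M] D4_moduleD(1)[OF C]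
  have ih: "i \<in> hom_D4 M I" and ph: "p \<in> hom_D4 I C" using i p by (auto simp: mono_D4_def epi_D4_def)
  note ic = hom_D4D(1)[OF ih] and pc = hom_D4D(1)[OF ph]
  have small: "U = space (dual I)"
    if U: "submodule_D4 (dual I) U" and sum: "{u + w |u w. u \<in> U \<and> w \<in> mat_kernel (transpose_mat i)} = space (dual
      I)" for U
  proof -
    note LU = lin_subspaceD[OF submodule_D4D(1)[OF U], simplified]
    \<comment> \<open>The orthogonal complement of \<open>U\<close>, a submodule of
      \<open>I\<close>. It meets the image of \<open>i\<close> trivially: an element of the
      intersection is orthogonal to \<open>U\<close> and to the kernel of the transpose of
      \<open>i\<close>, whose sum is everything. Essentiality gives \<open>V = 0\<close>, hence
      \<open>U\<close> is everything.\<close>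
    define V where "V = {x \<in> space I. \<forall>u\<in>U. u \<bullet> x = 0}"
    have V: "submodule_D4 I V" unfolding submodule_D4_iff lin_subspace_def
    proof (intro conjI ballI allI)
      show "V \<subseteq> space I" "0\<^sub>v (rdim I) \<in> V" using LU(1) by (auto simp: V_def)
      fix x y assume "x \<in> V" "y \<in> V"
      then show "x + y \<in> V" using LU(1) by (auto simp: V_def scalar_prod_add_distrib[of _ "rdim I"])
    next
      fix k x assume "x \<in> V"
      then show "k \<cdot>\<^sub>v x \<in> V" using LU(1) by (auto simp: V_def)
    next
      fix t :: "'a rep \<Rightarrow> 'a mat" and x assume t: "t \<in> gens" and x: "x \<in> V"
      have "u \<bullet> (t I *\<^sub>v x) = 0" if u: "u \<in> U" for u
      proof -
        have "transpose_mat (t I) *\<^sub>v u \<in> U" using submodule_D4D(2)[OF U t u] by (simp add: dual_gens[OF t])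
        then have "(transpose_mat (t I) *\<^sub>v u) \<bullet> x = 0" using x by (simp add: V_def)
        then show ?thesis using scalar_prod_mult_transpose[OF rep_carrierD[OF rc(1) t] LU(1)[OF u]] x
          by (simp add: V_def)
      qed
      then show "t I *\<^sub>v x \<in> V" using x mult_mat_vec_carrier[OF rep_carrierD[OF rc(1) t]] by (auto simp: V_def)
    qed
    have "V \<inter> (*\<^sub>v) i ` space M = zero_space I"
    proof
      show "V \<inter> (*\<^sub>v) i ` space M \<subseteq> zero_space I"
      proof
        fix x assume "x \<in> V \<inter> (*\<^sub>v) i ` space M"
        then obtain m where x: "x \<in> V" "m \<in> space M" "x = i *\<^sub>v m" by auto
        have xc: "x \<in> space I" using x(1) by (simp add: V_def)
        have "x = 0\<^sub>v (rdim I)"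
        proof (rule scalar_prod_zero_imp[OF xc])
          fix y :: "'a vec" assume "y \<in> space I"
          then have "y \<in> {u + w |u w. u \<in> U \<and> w \<in> mat_kernel (transpose_mat i)}" unfolding sum by simp
          then obtain u w where y: "u \<in> U" "w \<in> mat_kernel (transpose_mat i)" "y = u + w" by auto
          then have w: "w \<in> space I" "transpose_mat i *\<^sub>v w = 0\<^sub>v (rdim M)" using ic by (auto simp: mat_kernel_def)
          have "w \<bullet> x = (transpose_mat i *\<^sub>v w) \<bullet> m" unfolding x(3)
            using scalar_prod_mult_transpose[OF ic w(1) x(2)] by simp
          also have "\<dots> = 0" unfolding w(2) using x(2) by simp
          finally show "y \<bullet> x = 0" using x(1) y(1) xc w(1) LU(1)[OF y(1)] unfolding y(3) V_def
            by (simp add: add_scalar_prod_distrib[of _ "rdim I"])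
        qed
        then show "x \<in> zero_space I" by simp
      qed
      show "zero_space I \<subseteq> V \<inter> (*\<^sub>v) i ` space M"
        using lin_subspaceD(2)[OF submodule_D4D(1)[OF V]] lin_subspaceD(2)[OF lin_subspace_image[OF ic]] by auto
    qed
    then have V0: "V = zero_space I" by (rule ess[OF V])
    have "U = carrier_vec (rdim I)"
    proof (rule lin_subspace_orth)
      show "lin_subspace (rdim I) U" using submodule_D4D(1)[OF U] by simp
      fix x assume "x \<in> carrier_vec (rdim I)" "\<And>u. u \<in> U \<Longrightarrow> u \<bullet> x = 0"
      then have "x \<in> V" by (simp add: V_def)
      then show "x = 0\<^sub>v (rdim I)" unfolding V0 by simp
    qed
    then show ?thesis by simp
  qed
  have pcov: "projective_cover (dual I) (transpose_mat i) (dual M)"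
    unfolding projective_cover_def
    by (intro conjI allI impI injective_dual[OF inj] D4_module_dual[OF M] mono_D4_dual[OF i rc(2,1)])
      (elim conjE, rule small)
  obtain R where R: "R \<in> carrier_mat (rdim I) (rdim C)" "p * R = 1\<^sub>m (rdim C)"
    using epi_D4_right_inverse[OF p] by blast
  have "(*\<^sub>v) (transpose_mat p) ` space (dual C) = mat_kernel (transpose_mat i)"
  proof
    show "(*\<^sub>v) (transpose_mat p) ` space (dual C) \<subseteq> mat_kernel (transpose_mat i)"
    proof clarify
      fix y :: "'a vec" assume "y \<in> space (dual C)"
      then have y: "y \<in> carrier_vec (rdim C)" by simp
      have py: "transpose_mat p *\<^sub>v y \<in> carrier_vec (rdim I)" using pc y
        by (intro mult_mat_vec_carrier[of _ _ "rdim C"]) auto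
      have "transpose_mat i *\<^sub>v (transpose_mat p *\<^sub>v y) = 0\<^sub>v (rdim M)"
      proof (rule scalar_prod_zero_imp)
        show ipy: "transpose_mat i *\<^sub>v (transpose_mat p *\<^sub>v y) \<in> carrier_vec (rdim M)"
          by (rule mult_mat_vec_carrier[OF _ py]) (use ic in simp)
        fix z :: "'a vec" assume z: "z \<in> carrier_vec (rdim M)"
        have iz: "i *\<^sub>v z \<in> carrier_vec (rdim I)" using ic z by auto
        have "i *\<^sub>v z \<in> mat_kernel p" unfolding ker using z by auto
        then have "p *\<^sub>v (i *\<^sub>v z) = 0\<^sub>v (rdim C)" using pc by (auto simp: mat_kernel_def)
        then have "(transpose_mat p *\<^sub>v y) \<bullet> (i *\<^sub>v z) = 0"
          unfolding scalar_prod_mult_transpose[OF pc y iz] using y by simp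
        then have "(transpose_mat i *\<^sub>v (transpose_mat p *\<^sub>v y)) \<bullet> z = 0"
          unfolding scalar_prod_mult_transpose[OF ic py z] .
        then show "z \<bullet> (transpose_mat i *\<^sub>v (transpose_mat p *\<^sub>v y)) = 0"
          by (subst comm_scalar_prod[OF z ipy])
      qed
      then show "transpose_mat p *\<^sub>v y \<in> mat_kernel (transpose_mat i)"
        using ic py by (intro mat_kernelI[of _ "rdim M" "rdim I"]) auto
    qed
    show "mat_kernel (transpose_mat i) \<subseteq> (*\<^sub>v) (transpose_mat p) ` space (dual C)"
    proof
      fix w assume "w \<in> mat_kernel (transpose_mat i)"
      then have w: "w \<in> carrier_vec (rdim I)" "transpose_mat i *\<^sub>v w = 0\<^sub>v (rdim M)" using ic
        by (auto simp: mat_kernel_def)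
      \<comment> \<open>As a functional, \<open>w\<close> vanishes on the image of \<open>i\<close>,
        which is the kernel of \<open>p\<close>; it therefore factors through \<open>p\<close>, and
        composing with the linear section \<open>R\<close> of \<open>p\<close> gives the
        factor.\<close>
      define y where "y = transpose_mat R *\<^sub>v w"
      have y: "y \<in> carrier_vec (rdim C)" unfolding y_def using R(1) w(1)
        by (intro mult_mat_vec_carrier[of _ _ "rdim I"]) auto
      have py: "transpose_mat p *\<^sub>v y \<in> carrier_vec (rdim I)" using pc y
        by (intro mult_mat_vec_carrier[of _ _ "rdim C"]) auto
      have "w - transpose_mat p *\<^sub>v y = 0\<^sub>v (rdim I)"
      proof (rule scalar_prod_zero_imp)
        show "w - transpose_mat p *\<^sub>v y \<in> carrier_vec (rdim I)" using w(1) py by simp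
        fix z :: "'a vec" assume z: "z \<in> carrier_vec (rdim I)"
        have pz: "p *\<^sub>v z \<in> carrier_vec (rdim C)" "R *\<^sub>v (p *\<^sub>v z) \<in> carrier_vec (rdim I)" using pc R(1) z by auto
        define k where "k = z - R *\<^sub>v (p *\<^sub>v z)"
        have k: "k \<in> carrier_vec (rdim I)" unfolding k_def using z pz by simp
        have "p *\<^sub>v k = p *\<^sub>v z - (p * R) *\<^sub>v (p *\<^sub>v z)" unfolding k_def using pc R(1) z pz by (simp add: mat_vec)
        also have "\<dots> = 0\<^sub>v (rdim C)" unfolding R(2) using pz by (simp add: mat_one_vec)
        finally have "k \<in> mat_kernel p" using pc k by (intro mat_kernelI) auto
        then obtain m where m: "m \<in> space M" "k = i *\<^sub>v m" unfolding ker by auto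
        have wk: "w \<bullet> k = 0" unfolding m(2) scalar_prod_mult_transpose[OF ic w(1) m(1), symmetric] w(2) using m(1)
          by simp
        have "(transpose_mat p *\<^sub>v y) \<bullet> z = y \<bullet> (p *\<^sub>v z)" by (rule scalar_prod_mult_transpose[OF pc y z])
        also have "\<dots> = w \<bullet> (R *\<^sub>v (p *\<^sub>v z))" unfolding y_def by (rule scalar_prod_mult_transpose[OF R(1) w(1) pz(1)])
        also have "\<dots> = w \<bullet> z - w \<bullet> k" unfolding k_def using w(1) z pz
          by (subst scalar_prod_minus_distrib[of _ "rdim I"]) auto
        finally have "(w - transpose_mat p *\<^sub>v y) \<bullet> z = 0" unfolding wk using w(1) py z
          by (subst minus_scalar_prod_distrib[of _ "rdim I"]) auto
        then show "z \<bullet> (w - transpose_mat p *\<^sub>v y) = 0" using z w(1) py by (subst comm_scalar_prod[of _ "rdim I"]) auto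
      qed
      then have "w = transpose_mat p *\<^sub>v y"
        using w(1) py by (metis minus_cancel_vec minus_zero_vec eq_vecI carrier_vecD index_minus_vec(1)
          index_zero_vec(1) right_minus_eq)
      then show "w \<in> (*\<^sub>v) (transpose_mat p) ` space (dual C)" using y by auto
    qed
  qed
  then show ?thesis unfolding is_Omega_def
    by (intro conjI exI[of _ "dual I"] exI[of _ "transpose_mat i"] exI[of _ "transpose_mat p"] pcov D4_module_dual[OF C]
      epi_D4_dual[OF p rc(1,3)])
qed

lemma is_Omega_inv_power_dual: "(is_Omega_inv ^^ s) M N \<Longrightarrow> (is_Omega ^^ s) (dual M) (dual N)"
proof (induction s arbitrary: N)
  case (Suc s)
  then obtain K where K: "(is_Omega_inv ^^ s) M K" "is_Omega_inv K N" by auto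
  from Suc.IH[OF K(1)] is_Omega_inv_dual[OF K(2)] show ?case by auto
qed auto

section \<open>Eigenspace dimensions\<close>

text \<open>On \<open>N\<close> the operators \<open>b\<close> and \<open>c\<close> coincide, with eigenvalues \<open>e\<close> and \<open>- e\<close> of multiplicity \<open>n\<^sub>0\<close> and \<open>n\<^sub>1\<close>.\<close>

definition graded :: "'k::field rep \<Rightarrow> 'k \<Rightarrow> nat \<Rightarrow> nat \<Rightarrow> bool" where
  "graded N e n0 n1 \<longleftrightarrow> rdim N = n0 + n1 \<and>
     (\<exists>S T. S \<in> carrier_mat (n0 + n1) (n0 + n1) \<and> T \<in> carrier_mat (n0 + n1) (n0 + n1) \<and>
        S * T = 1\<^sub>m (n0 + n1) \<and> T * S = 1\<^sub>m (n0 + n1) \<and>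
        (\<forall>t\<in>{opb, opc}. t N * S = S * sparse (n0 + n1) (n0 + n1) (\<lambda>i. if i < n0 then e else - e) (\<lambda>i. i)))"

lemma gradedI:
  assumes "rdim N = n0 + n1" "S \<in> carrier_mat (n0 + n1) (n0 + n1)" "T \<in> carrier_mat (n0 + n1) (n0 + n1)"
    "S * T = 1\<^sub>m (n0 + n1)" "T * S = 1\<^sub>m (n0 + n1)"
    "\<And>t. t \<in> {opb, opc} \<Longrightarrow> t N * S = S * sparse (n0 + n1) (n0 + n1) (\<lambda>i. if i < n0 then e else - e) (\<lambda>i. i)"
  shows "graded N e n0 n1"
  unfolding graded_def using assms by blast

lemma graded_syz: "graded (syz s e) e (s + 1) s"
proof (rule gradedI[of _ _ _ "1\<^sub>m (s + 1 + s)" "1\<^sub>m (s + 1 + s)"])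
  fix t :: "'a rep \<Rightarrow> 'a mat" assume t: "t \<in> {opb, opc}"
  have "t (syz s e) = sparse (s + 1 + s) (s + 1 + s) (\<lambda>i. if i < s + 1 then e else - e) (\<lambda>i. i)"
    using t by (auto simp: syz_def mult_2 intro!: sparse_eqI)
  then show "t (syz s e) * 1\<^sub>m (s + 1 + s) = 1\<^sub>m (s + 1 + s) * sparse (s + 1 + s) (s + 1 + s) (\<lambda>i. if i < s + 1 then
    e else - e) (\<lambda>i. i)"
    by (simp add: mat_mult_one)
qed auto

lemma graded_iso:
  assumes "M \<cong>\<^sub>D N" and c: "rep_carrier M" "rep_carrier N" and g: "graded M e n0 n1"
  shows "graded N e n0 n1"
proof -
  obtain f h where f: "f \<in> hom_D4 M N" and h: "h \<in> hom_D4 N M" and hf: "h * f = 1\<^sub>m (rdim M)"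
    and fh: "f * h = 1\<^sub>m (rdim N)"
    and n: "rdim M = rdim N" using iso_D4E[OF assms(1-3)] by metis
  let ?D = "sparse (n0 + n1) (n0 + n1) (\<lambda>i. if i < n0 then e else - e) (\<lambda>i. i)"
  obtain S T where S: "S \<in> carrier_mat (n0 + n1) (n0 + n1)" and T: "T \<in> carrier_mat (n0 + n1) (n0 + n1)"
    and ST: "S * T = 1\<^sub>m (n0 + n1)" and TS: "T * S = 1\<^sub>m (n0 + n1)" and bS: "\<And>t. t \<in> {opb, opc} \<Longrightarrow> t M * S = S * ?D"
    and nM: "rdim M = n0 + n1" using g unfolding graded_def by blast
  have nN: "rdim N = n0 + n1" using n nM by simp
  note d = hom_D4D(1)[OF f, unfolded nM nN] hom_D4D(1)[OF h, unfolded nM nN] S T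
  show ?thesis
  proof (rule gradedI[of _ _ _ "f * S" "T * h"])
    have "f * S * (T * h) = f * ((S * T) * h)" using d by (simp add: mat_mult_assoc)
    then show "f * S * (T * h) = 1\<^sub>m (n0 + n1)" unfolding ST using d fh nN by simp
    have "T * h * (f * S) = T * ((h * f) * S)" using d by (simp add: mat_mult_assoc)
    then show "T * h * (f * S) = 1\<^sub>m (n0 + n1)" unfolding hf nM using d TS by simp
    fix t :: "'a rep \<Rightarrow> 'a mat" assume t: "t \<in> {opb, opc}"
    then have tg: "t \<in> gens" by (auto simp: gens_def)
    note e = rep_carrierD[OF c(1) tg, unfolded nM] rep_carrierD[OF c(2) tg, unfolded nN]
    have "t N * (f * S) = (t N * f) * S" using d e by (simp add: mat_mult_assoc)
    also have "\<dots> = f * (t M * S)" unfolding hom_D4D(2)[OF f tg, symmetric] using d e by (simp add: mat_mult_assoc)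
    also have "\<dots> = f * S * ?D" unfolding bS[OF t] using d by (simp add: mat_mult_assoc)
    finally show "t N * (f * S) = f * S * ?D" .
  qed (use d nN in auto)
qed

text \<open>The basis dual to an eigenbasis is an eigenbasis with the same eigenvalues; its vectors
  are the rows of \<open>T\<close>.\<close>

lemma graded_dual:
  assumes c: "rep_carrier M" and g: "graded M e n0 n1"
  shows "graded (dual M) e n0 n1"
proof -
  let ?D = "sparse (n0 + n1) (n0 + n1) (\<lambda>i. if i < n0 then e else - e) (\<lambda>i. i)"
  obtain S T where S: "S \<in> carrier_mat (n0 + n1) (n0 + n1)" and T: "T \<in> carrier_mat (n0 + n1) (n0 + n1)"
    and ST: "S * T = 1\<^sub>m (n0 + n1)" and TS: "T * S = 1\<^sub>m (n0 + n1)" and bS: "\<And>t. t \<in> {opb, opc} \<Longrightarrow> t M * S = S * ?D"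
    and nM: "rdim M = n0 + n1" using g unfolding graded_def by blast
  have DT: "transpose_mat ?D = ?D" by (intro eq_matI) (auto simp: sparse_index)
  show ?thesis
  proof (rule gradedI[of _ _ _ "transpose_mat T" "transpose_mat S"])
    have "transpose_mat T * transpose_mat S = transpose_mat (S * T)" using S T by (simp add: transpose_mult_dim)
    then show "transpose_mat T * transpose_mat S = 1\<^sub>m (n0 + n1)" unfolding ST by simp
    have "transpose_mat S * transpose_mat T = transpose_mat (T * S)" using S T by (simp add: transpose_mult_dim)
    then show "transpose_mat S * transpose_mat T = 1\<^sub>m (n0 + n1)" unfolding TS by simp
    fix t :: "'a rep \<Rightarrow> 'a mat" assume t: "t \<in> {opb, opc}"
    then have tg: "t \<in> gens" by (auto simp: gens_def)
    note e = rep_carrierD[OF c(1) tg, unfolded nM]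
    have "T * t M = T * t M * (S * T)" unfolding ST using T e by simp
    also have "\<dots> = T * (t M * S) * T" using T S e by (simp add: mat_mult_assoc)
    also have "\<dots> = (T * S) * (?D * T)" unfolding bS[OF t] using T S by (simp add: mat_mult_assoc)
    also have "\<dots> = ?D * T" unfolding TS using T by simp
    finally have "transpose_mat (T * t M) = transpose_mat (?D * T)" by simp
    then show "t (dual M) * transpose_mat T = transpose_mat T * ?D"
      unfolding dual_gens[OF tg] using T e by (simp add: transpose_mult_dim DT)
  qed (use S T nM in auto)
qed

lemma graded_Omega_power:
  assumes two: "(2::'k::field) \<noteq> 0" and e: "e * e = (1::'k)" and N: "(is_Omega ^^ s) (syz 0 e) N"
  shows "D4_module N \<and> graded N ((- 1) ^ s * e) (s + 1) s"
proof -
  have N: "D4_module N" "N \<cong>\<^sub>D syz s ((- 1) ^ s * e)" using is_Omega_power_syz[OF assms] by auto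
  have "((- 1) ^ s * e) * ((- 1) ^ s * e) = 1" using e
    by (simp add: mult.assoc mult.left_commute[of e] flip: power_mult_distrib)
  then have S: "rep_carrier (syz s ((- 1) ^ s * e))" by (rule rep_carrier_block1[OF block1_syz])
  note rN = D4_moduleD(1)[OF N(1)]
  show ?thesis using graded_iso[OF iso_D4_sym[OF N(2) rN S] S rN graded_syz] N(1) by blast
qed

text \<open>The simple modules are self-dual under transposition, which is why \<Omega> and its
  inverse lead to the same eigenspace dimensions.\<close>

lemma dual_syz_0: "dual (syz 0 e) = syz 0 e"
  by (auto simp: dual_def syz_def sparse_def intro!: eq_matI)

lemma graded_Omega_inv_power:
  assumes two: "(2::'k::field) \<noteq> 0" and e: "e * e = (1::'k)" and N: "(is_Omega_inv ^^ s) (syz 0 e) N"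
  shows "D4_module N \<and> graded N ((- 1) ^ s * e) (s + 1) s"
proof -
  have "(is_Omega ^^ s) (syz 0 e) (dual N)" using is_Omega_inv_power_dual[OF N] unfolding dual_syz_0 .
  from graded_Omega_power[OF two e this] have *: "D4_module (dual N)" "graded (dual N) ((- 1) ^ s * e) (s + 1) s"
    by auto
  then show ?thesis using D4_module_dual[OF *(1)] graded_dual[OF D4_moduleD(1)[OF *(1)] *(2)] by simp
qed

section \<open>Tensor products\<close>

definition kronv :: "'k::field vec \<Rightarrow> 'k vec \<Rightarrow> 'k vec" where
  "kronv x y = vec (dim_vec x * dim_vec y) (\<lambda>i. x $ (i div dim_vec y) * y $ (i mod dim_vec y))"

lemma dim_kronv [simp]: "dim_vec (kronv x y) = dim_vec x * dim_vec y"
  by (simp add: kronv_def)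

lemma dim_kron [simp]: "dim_row (kron A B) = dim_row A * dim_row B" "dim_col (kron A B) = dim_col A * dim_col B"
  by (simp_all add: kron_def)

lemma div_mod_bounds:
  fixes i m n :: nat
  assumes "i < m * n"
  shows "i div n < m" "i mod n < n"
proof -
  have "0 < n" using assms by (cases n) auto
  then show "i mod n < n" by simp
  show "i div n < m" using assms by (simp add: less_mult_imp_div_less)
qed

lemma sum_div_mod:
  fixes f g :: "nat \<Rightarrow> 'a::comm_semiring_1"
  shows "(\<Sum>l = 0..<m * n. f (l div n) * g (l mod n)) = (\<Sum>i = 0..<m. f i) * (\<Sum>j = 0..<n. g j)"
proof (induction m)
  case (Suc m)
  have "(\<Sum>l = 0..<Suc m * n. f (l div n) * g (l mod n)) =
    (\<Sum>l = 0..<m * n. f (l div n) * g (l mod n)) + (\<Sum>l = m * n..<Suc m * n. f (l div n) * g (l mod n))"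
    by (rule sum.atLeastLessThan_concat[symmetric]) auto
  also have "(\<Sum>l = m * n..<Suc m * n. f (l div n) * g (l mod n)) = (\<Sum>l = 0..<n. f ((l + m * n) div n) * g ((l + m *
    n) mod n))"
    using sum.shift_bounds_nat_ivl[of "\<lambda>l. f (l div n) * g (l mod n)" 0 "m * n" n] by (simp add: add.commute)
  also have "\<dots> = (\<Sum>l = 0..<n. f m * g l)"
    by (rule sum.cong) auto
  finally show ?case using Suc by (simp add: sum_distrib_left distrib_right)
qed simp

lemma kron_kronv:
  assumes "dim_vec x = dim_col A" "dim_vec y = dim_col B"
  shows "kron A B *\<^sub>v kronv x y = kronv (A *\<^sub>v x) (B *\<^sub>v y)"
proof (rule eq_vecI)
  fix i assume "i < dim_vec (kronv (A *\<^sub>v x) (B *\<^sub>v y))"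
  then have i: "i < dim_row A * dim_row B" by simp
  note b = div_mod_bounds[OF i]
  have "(kron A B *\<^sub>v kronv x y) $ i =
    (\<Sum>l = 0..<dim_col A * dim_col B. (A $$ (i div dim_row B, l div dim_col B) * x $ (l div dim_col B)) * (B $$ (i
      mod dim_row B, l mod dim_col B) * y $ (l mod dim_col B)))"
    using i assms by (auto simp: scalar_prod_def kron_def kronv_def intro!: sum.cong)
  also have "\<dots> = (\<Sum>k = 0..<dim_col A. A $$ (i div dim_row B, k) * x $ k) * (\<Sum>k = 0..<dim_col B. B $$ (i mod dim_row
    B, k) * y $ k)"
    by (rule sum_div_mod)
  also have "\<dots> = kronv (A *\<^sub>v x) (B *\<^sub>v y) $ i"
    using i b assms by (simp add: kronv_def scalar_prod_def)
  finally show "(kron A B *\<^sub>v kronv x y) $ i = kronv (A *\<^sub>v x) (B *\<^sub>v y) $ i" .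
qed (use assms in simp)

lemma unit_vec_kronv:
  assumes "k < m * n"
  shows "(unit_vec (m * n) k :: 'k::field vec) = kronv (unit_vec m (k div n)) (unit_vec n (k mod n))"
proof (rule eq_vecI)
  fix i assume "i < dim_vec (kronv (unit_vec m (k div n)) (unit_vec n (k mod n)) :: 'k vec)"
  then have i: "i < m * n" by simp
  have "i = k \<longleftrightarrow> i div n = k div n \<and> i mod n = k mod n" by (metis div_mult_mod_eq)
  then show "(unit_vec (m * n) k :: 'k vec) $ i = kronv (unit_vec m (k div n)) (unit_vec n (k mod n)) $ i"
    using i assms div_mod_bounds[OF i] div_mod_bounds[OF assms] by (auto simp: kronv_def unit_vec_def)
qed simp

text \<open>Closure under linear combinations of several vectors without an induction on their
  number: for \<open>U\<close> the image of \<open>B\<close> with left inverse \<open>C\<close>, the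
  projection \<open>B C\<close> fixes every column of \<open>S\<close>, hence \<open>S\<close>
  itself.\<close>

lemma lin_subspace_mult_vec:
  fixes U :: "'k::field vec set"
  assumes U: "lin_subspace n U" and A: "S \<in> carrier_mat n m" and cols: "\<And>j. j < m \<Longrightarrow> col S j \<in> U"
    and y: "y \<in> carrier_vec m"
  shows "S *\<^sub>v y \<in> U"
proof -
  obtain d B C where B: "B \<in> carrier_mat n d" and C: "C \<in> carrier_mat d n" and CB: "C * B = 1\<^sub>m d"
    and im: "(*\<^sub>v) B ` carrier_vec d = U" using lin_subspace_split[OF U] by metis
  have "B * (C * S) = S"
  proof (rule mat_col_eqI)
    fix j assume "j < dim_col S"
    then have j: "j < m" using A by simp
    then obtain z where z: "z \<in> carrier_vec d" "col S j = B *\<^sub>v z" using cols im by blast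
    have "col (B * (C * S)) j = B *\<^sub>v (C *\<^sub>v col S j)"
      using col_mult2[OF B mult_carrier_mat[OF C A] j] col_mult2[OF C A j] by simp
    also have "\<dots> = B *\<^sub>v ((C * B) *\<^sub>v z)" unfolding z(2) using B C z(1) by (simp add: mat_mult_vec_assoc)
    also have "\<dots> = col S j" unfolding CB z(2) using z(1) by (simp add: mat_one_vec)
    finally show "col (B * (C * S)) j = col S j" .
  qed (use A B in auto)
  then have "S *\<^sub>v y = (B * (C * S)) *\<^sub>v y" by simp
  also have "\<dots> = B *\<^sub>v (C *\<^sub>v (S *\<^sub>v y))" using A B C y by (simp add: mat_mult_vec_assoc)
  finally show ?thesis using im A C y by (auto intro!: mult_mat_vec_carrier[of _ d n])
qed

lemma kronv_span:
  fixes U :: "'k::field vec set"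
  assumes U: "lin_subspace (m * n) U" and all: "\<And>x y. x \<in> carrier_vec m \<Longrightarrow> y \<in> carrier_vec n \<Longrightarrow> kronv x y \<in> U"
  shows "U = carrier_vec (m * n)"
proof
  show "carrier_vec (m * n) \<subseteq> U"
  proof
    fix z :: "'k vec" assume z: "z \<in> carrier_vec (m * n)"
    have "1\<^sub>m (m * n) *\<^sub>v z \<in> U"
    proof (rule lin_subspace_mult_vec[OF U _ _ z])
      fix j assume "j < m * n"
      then have "unit_vec (m * n) j \<in> U" using all[of "unit_vec m (j div n)" "unit_vec n (j mod n)"]
        by (simp add: unit_vec_kronv)
      then show "col (1\<^sub>m (m * n)) j \<in> U" using \<open>j < m * n\<close> by simp
    qed simp
    then show "z \<in> U" using z by simp
  qed
qed (use lin_subspaceD(1)[OF U] in auto)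

lemma eq_mat_by_kronv:
  fixes A B :: "'k::field mat"
  assumes A: "A \<in> carrier_mat k (m * n)" and B: "B \<in> carrier_mat k (m * n)"
    and eq: "\<And>x y. x \<in> carrier_vec m \<Longrightarrow> y \<in> carrier_vec n \<Longrightarrow> A *\<^sub>v kronv x y = B *\<^sub>v kronv x y"
  shows "A = B"
proof (rule mat_col_eqI)
  fix j assume "j < dim_col B"
  then have j: "j < m * n" using B by simp
  have "A *\<^sub>v unit_vec (m * n) j = B *\<^sub>v unit_vec (m * n) j" unfolding unit_vec_kronv[OF j] by (rule eq) auto
  then show "col A j = col B j" using mat_mult_unit_vec[OF A j] mat_mult_unit_vec[OF B j] by simp
qed (use A B in auto)

lemma kron_mult:
  fixes A B C D :: "'k::field mat"
  assumes "dim_col A = dim_row C" "dim_col B = dim_row D"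
  shows "kron A B * kron C D = kron (A * C) (B * D)"
proof (rule eq_mat_by_kronv[of _ "dim_row A * dim_row B" "dim_col C" "dim_col D"])
  show "kron A B * kron C D \<in> carrier_mat (dim_row A * dim_row B) (dim_col C * dim_col D)"
    by (rule carrier_matI) simp_all
  show "kron (A * C) (B * D) \<in> carrier_mat (dim_row A * dim_row B) (dim_col C * dim_col D)"
    by (rule carrier_matI) simp_all
  fix x y :: "'k vec" assume "x \<in> carrier_vec (dim_col C)" "y \<in> carrier_vec (dim_col D)"
  then have xy: "dim_vec x = dim_col C" "dim_vec y = dim_col D" by auto
  show "(kron A B * kron C D) *\<^sub>v kronv x y = kron (A * C) (B * D) *\<^sub>v kronv x y"
    using assms xy by (simp add: mat_mult_vec_assoc kron_kronv)
qed

lemma kron_add: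
  assumes "dim_row A = dim_row B" "dim_col A = dim_col B"
  shows "kron (A + B) C = kron A C + kron B C" "kron C (A + B) = kron C A + kron C B"
  using assms by (auto intro!: eq_matI simp: kron_def div_mod_bounds distrib_left distrib_right)

lemma kron_minus:
  assumes "dim_row A = dim_row B" "dim_col A = dim_col B"
  shows "kron (A - B) C = kron A C - kron B C" "kron C (A - B) = kron C A - kron C B"
  using assms by (auto intro!: eq_matI simp: kron_def div_mod_bounds left_diff_distrib right_diff_distrib)

lemma kron_uminus: "kron (- A) C = - kron A C" "kron C (- A) = - kron C A"
  by (auto intro!: eq_matI simp: kron_def div_mod_bounds)

lemma kron_one: "kron (1\<^sub>m m) (1\<^sub>m n) = (1\<^sub>m (m * n) :: 'k::field mat)"
proof (rule eq_mat_by_kronv[of _ "m * n" m n])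
  fix x y :: "'k vec" assume "x \<in> carrier_vec m" "y \<in> carrier_vec n"
  then show "kron (1\<^sub>m m) (1\<^sub>m n) *\<^sub>v kronv x y = 1\<^sub>m (m * n) *\<^sub>v kronv x y"
    by (simp add: kron_kronv mat_one_vec)
qed (auto intro!: carrier_matI)

lemma kron_zero: "kron (0\<^sub>m m n) C = 0\<^sub>m (m * dim_row C) (n * dim_col C)" "kron C (0\<^sub>m m n) = 0\<^sub>m (dim_row C * m)
  (dim_col C * n)"
  by (auto intro!: eq_matI simp: kron_def div_mod_bounds)

section \<open>The tensor product as a module\<close>

lemma tensor_rdim [simp]: "rdim (M \<otimes>\<^sub>D N) = rdim M * rdim N"
  by (simp add: tensor_def)

text \<open>The comultiplication respects the defining relations. After expanding with
  \<open>(A \<otimes> B)(C \<otimes> D) = AC \<otimes> BD\<close>, the mixed terms cancel because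
  \<open>b\<close> and \<open>c\<close> anticommute with \<open>a\<close> and with
  \<open>d\<close>.\<close>

lemma D4_module_tensor:
  assumes M: "D4_module M" and N: "D4_module N"
  shows "D4_module (M \<otimes>\<^sub>D N)"
proof -
  note A = D4_moduleD[OF M] and B = D4_moduleD[OF N]
  have dA: "dim_row (opa M) = rdim M" "dim_col (opa M) = rdim M" "dim_row (opb M) = rdim M" "dim_col (opb M) = rdim M"
    "dim_row (opc M) = rdim M" "dim_col (opc M) = rdim M" "dim_row (opd M) = rdim M" "dim_col (opd M) = rdim M"
    using A(2-5) by auto
  have dB: "dim_row (opa N) = rdim N" "dim_col (opa N) = rdim N" "dim_row (opb N) = rdim N" "dim_col (opb N) = rdim N"
    "dim_row (opc N) = rdim N" "dim_col (opc N) = rdim N" "dim_row (opd N) = rdim N" "dim_col (opd N) = rdim N"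
    using B(2-5) by auto
  let ?n = "rdim M * rdim N"
  let ?a = "kron (opa M) (opb N) + kron (1\<^sub>m (rdim M)) (opa N)"
  let ?b = "kron (opb M) (opb N)"
  let ?c = "kron (opc M) (opc N)"
  let ?d = "kron (opd M) (opc N) + kron (1\<^sub>m (rdim M)) (opd N)"
  note dims = dA dB
  note expand = mat_ring(1-3) mat_uminus_mult kron_mult kron_uminus mat_mult_one mat_mult_zero kron_zero kron_one
    mat_add_zero
  have "?b * ?a = - (?a * ?b)"
    by (simp add: expand dims A(6) B(6)) (auto intro!: eq_matI simp: dims algebra_simps simp del: index_mult_mat(1))
  moreover have "?c * ?a = - (?a * ?c)"
    by (simp add: expand dims A(8) B(8,10)) (auto intro!: eq_matI simp: dims algebra_simps simp del: index_mult_mat(1))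
  moreover have "?d * ?b = - (?b * ?d)"
    by (simp add: expand dims A(7) B(7,10)) (auto intro!: eq_matI simp: dims algebra_simps simp del: index_mult_mat(1))
  moreover have "?d * ?c = - (?c * ?d)"
    by (simp add: expand dims A(9) B(9)) (auto intro!: eq_matI simp: dims algebra_simps simp del: index_mult_mat(1))
  ultimately have rs: "?b * ?a = - (?a * ?b)" "?c * ?a = - (?a * ?c)" "?d * ?b = - (?b * ?d)" "?d * ?c = - (?c * ?d)"
    by simp_all
  have bc: "?b * ?c = ?c * ?b" "?b * ?b = 1\<^sub>m ?n" "?c * ?c = 1\<^sub>m ?n"
    by (simp_all add: expand dims A(10,12,13) B(10,12,13))
  have aa: "?a * ?a = 0\<^sub>m ?n ?n"
    by (simp add: expand dims A(11) B(11,12,6)) (auto intro!: eq_matI simp: dims simp del: index_mult_mat(1))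
  have dd: "?d * ?d = 0\<^sub>m ?n ?n"
    by (simp add: expand dims A(14) B(14,13,9)) (auto intro!: eq_matI simp: dims simp del: index_mult_mat(1))
  \<comment> \<open>The mixed terms cancel in pairs, leaving
    \<open>(da + ad) \<otimes> bc + 1 \<otimes> (da + ad)\<close>, which is
    \<open>(1 - bc) \<otimes> bc + 1 \<otimes> (1 - bc)\<close> and telescopes to
    \<open>1 - bc \<otimes> bc\<close>.\<close>
  have ad: "?d * ?a + ?a * ?d = 1\<^sub>m ?n - ?b * ?c"
  proof -
    have 1: "kron (opd M * opa M) (opb N * opc N) + kron (opa M * opd M) (opb N * opc N) = kron (1\<^sub>m (rdim M)) (opb
      N * opc N) - kron (opb M * opc M) (opb N * opc N)"
      unfolding A(15)[symmetric] by (subst kron_add(1)[symmetric], simp add: dims, simp add: dims)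
        (subst kron_minus(1)[symmetric], simp_all add: dims A(15))
    have 2: "kron (1\<^sub>m (rdim M)) (opd N * opa N) + kron (1\<^sub>m (rdim M)) (opa N * opd N) = 1\<^sub>m ?n - kron (1\<^sub>m (rdim
      M)) (opb N * opc N)"
      by (subst kron_add(2)[symmetric], simp add: dims, simp add: dims)
        (simp add: B(15) kron_minus kron_one dims)
    have "?d * ?a = kron (opd M * opa M) (opb N * opc N) + kron (opd M) (opc N * opa N) + (kron (opa M) (opd N * opb
      N) + kron (1\<^sub>m (rdim M)) (opd N * opa N))"
      by (simp add: expand dims B(10)) (auto intro!: eq_matI simp: dims algebra_simps simp del: index_mult_mat(1))
    moreover have "?a * ?d = kron (opa M * opd M) (opb N * opc N) - kron (opa M) (opd N * opb N) + (- kron (opd M)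
      (opc N * opa N) + kron (1\<^sub>m (rdim M)) (opa N * opd N))"
      unfolding B(7,8) by (simp add: expand dims) (auto intro!: eq_matI simp: dims simp del: index_mult_mat(1))
    moreover have "?b * ?c = kron (opb M * opc M) (opb N * opc N)" by (simp add: expand dims)
    ultimately show ?thesis
    proof (intro eq_matI)
      fix i j assume ij: "i < dim_row (1\<^sub>m ?n - ?b * ?c)" "j < dim_col (1\<^sub>m ?n - ?b * ?c)"
      then have ij: "i < ?n" "j < ?n" by (simp_all add: dims)
      let ?K = "\<lambda>X Y. kron X Y $$ (i, j)"
      have 1: "?K (opd M * opa M) (opb N * opc N) + ?K (opa M * opd M) (opb N * opc N) = ?K (1\<^sub>m (rdim M)) (opb N *
        opc N) - ?K (opb M * opc M) (opb N * opc N)"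
        using arg_cong[OF 1, of "\<lambda>X. X $$ (i, j)"] ij by (simp add: dims)
      have 2: "?K (1\<^sub>m (rdim M)) (opd N * opa N) + ?K (1\<^sub>m (rdim M)) (opa N * opd N) = 1\<^sub>m ?n $$ (i, j) - ?K (1\<^sub>m
        (rdim M)) (opb N * opc N)"
        using arg_cong[OF 2, of "\<lambda>X. X $$ (i, j)"] ij by (simp add: dims)
      assume eq: "?d * ?a = kron (opd M * opa M) (opb N * opc N) + kron (opd M) (opc N * opa N) + (kron (opa M) (opd
        N * opb N) + kron (1\<^sub>m (rdim M)) (opd N * opa N))"
        "?a * ?d = kron (opa M * opd M) (opb N * opc N) - kron (opa M) (opd N * opb N) + (- kron (opd M) (opc N *
          opa N) + kron (1\<^sub>m (rdim M)) (opa N * opd N))"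
        "?b * ?c = kron (opb M * opc M) (opb N * opc N)"
      show "(?d * ?a + ?a * ?d) $$ (i, j) = (1\<^sub>m ?n - ?b * ?c) $$ (i, j)"
        unfolding eq using ij 1 2 by (simp add: dims algebra_simps)
    qed (simp_all add: dims)
  qed
  have car: "?a \<in> carrier_mat ?n ?n" "?b \<in> carrier_mat ?n ?n" "?c \<in> carrier_mat ?n ?n" "?d \<in> carrier_mat ?n ?n"
    by (rule carrier_matI; simp add: dims)+
  show ?thesis unfolding D4_module_def Let_def tensor_def rep.simps
    by (intro conjI rs bc aa dd ad car)
qed

lemma tensor_kronv:
  assumes M: "D4_module M" and N: "D4_module N" and x: "x \<in> space M" and y: "y \<in> space N"
  shows "opa (M \<otimes>\<^sub>D N) *\<^sub>v kronv x y = kronv (opa M *\<^sub>v x) (opb N *\<^sub>v y) + kronv x (opa N *\<^sub>v y)"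
    "opb (M \<otimes>\<^sub>D N) *\<^sub>v kronv x y = kronv (opb M *\<^sub>v x) (opb N *\<^sub>v y)"
    "opc (M \<otimes>\<^sub>D N) *\<^sub>v kronv x y = kronv (opc M *\<^sub>v x) (opc N *\<^sub>v y)"
    "opd (M \<otimes>\<^sub>D N) *\<^sub>v kronv x y = kronv (opd M *\<^sub>v x) (opc N *\<^sub>v y) + kronv x (opd N *\<^sub>v y)"
proof -
  note c = D4_moduleD(2-5)[OF M] D4_moduleD(2-5)[OF N]
  have d: "dim_row (opa M) = rdim M" "dim_col (opa M) = rdim M" "dim_row (opb M) = rdim M" "dim_col (opb M) = rdim M"
    "dim_row (opc M) = rdim M" "dim_col (opc M) = rdim M" "dim_row (opd M) = rdim M" "dim_col (opd M) = rdim M"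
    "dim_row (opa N) = rdim N" "dim_col (opa N) = rdim N" "dim_row (opb N) = rdim N" "dim_col (opb N) = rdim N"
    "dim_row (opc N) = rdim N" "dim_col (opc N) = rdim N" "dim_row (opd N) = rdim N" "dim_col (opd N) = rdim N"
    "dim_vec x = rdim M" "dim_vec y = rdim N"
    using c x y by auto
  show "opa (M \<otimes>\<^sub>D N) *\<^sub>v kronv x y = kronv (opa M *\<^sub>v x) (opb N *\<^sub>v y) + kronv x (opa N *\<^sub>v y)"
    "opb (M \<otimes>\<^sub>D N) *\<^sub>v kronv x y = kronv (opb M *\<^sub>v x) (opb N *\<^sub>v y)"
    "opc (M \<otimes>\<^sub>D N) *\<^sub>v kronv x y = kronv (opc M *\<^sub>v x) (opc N *\<^sub>v y)"
    "opd (M \<otimes>\<^sub>D N) *\<^sub>v kronv x y = kronv (opd M *\<^sub>v x) (opc N *\<^sub>v y) + kronv x (opd N *\<^sub>v y)"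
    by (simp_all add: tensor_def mat_add_vec kron_kronv mat_one_vec d)
qed

lemma kronv_add:
  assumes "dim_vec x = dim_vec y"
  shows "kronv (x + y) z = kronv x z + kronv y z" "kronv z (x + y) = kronv z x + kronv z y"
  using assms by (auto intro!: eq_vecI simp: kronv_def div_mod_bounds distrib_left distrib_right)

lemma kronv_smult: "kronv (k \<cdot>\<^sub>v x) z = k \<cdot>\<^sub>v kronv x z" "kronv z (k \<cdot>\<^sub>v x) = k \<cdot>\<^sub>v kronv z x"
  by (auto intro!: eq_vecI simp: kronv_def div_mod_bounds)

lemma kronv_zero: "kronv (0\<^sub>v n) z = 0\<^sub>v (n * dim_vec z)" "kronv z (0\<^sub>v n) = 0\<^sub>v (dim_vec z * n)"
  by (auto intro!: eq_vecI simp: kronv_def div_mod_bounds)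

text \<open>If \<open>U\<close> contains \<open>v \<otimes> N\<close>, then the \<open>x\<close> with \<open>x \<otimes> N \<subseteq> U\<close> form a submodule of \<open>M\<close>:
  for instance \<open>a x \<otimes> u = a (x \<otimes> b u) - x \<otimes> a b u\<close>.\<close>

lemma tensor_generated:
  assumes M: "D4_module M" and N: "D4_module N"
    and gen: "\<And>W. submodule_D4 M W \<Longrightarrow> v \<in> W \<Longrightarrow> W = space M" and v: "v \<in> space M"
    and U: "submodule_D4 (M \<otimes>\<^sub>D N) U" and vU: "\<And>u. u \<in> space N \<Longrightarrow> kronv v u \<in> U"
  shows "U = space (M \<otimes>\<^sub>D N)"
proof -
  note LU = lin_subspaceD[OF submodule_D4D(1)[OF U]] and oU = submodule_D4D(2)[OF U]
  note cM = D4_moduleD(2-5)[OF M] and cN = D4_moduleD(2-5)[OF N]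
  note car = mult_mat_vec_carrier
  have cancel: "x \<in> U" if "x + y \<in> U" "y \<in> U" "dim_vec x = dim_vec y" for x y
  proof -
    have "x + y - y \<in> U" by (rule LU(5)[OF that(1,2)])
    also have "x + y - y = x" using that(3) by (intro eq_vecI) auto
    finally show ?thesis .
  qed
  have bb: "opb N *\<^sub>v (opb N *\<^sub>v u) = u" "opc N *\<^sub>v (opc N *\<^sub>v u) = u" if u: "u \<in> space N" for u
  proof -
    have "opb N *\<^sub>v (opb N *\<^sub>v u) = (opb N * opb N) *\<^sub>v u" "opc N *\<^sub>v (opc N *\<^sub>v u) = (opc N * opc N) *\<^sub>v u"
      using cN u by (simp_all add: mat_mult_vec_assoc)
    then show "opb N *\<^sub>v (opb N *\<^sub>v u) = u" "opc N *\<^sub>v (opc N *\<^sub>v u) = u" using D4_moduleD(12,13)[OF N] u by simp_all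
  qed
  \<comment> \<open>The operator \<open>t\<close> is moved to the first factor by applying it to
    \<open>x \<otimes> b u\<close> or \<open>x \<otimes> c u\<close> instead of
    \<open>x \<otimes> u\<close>: since \<open>b\<close> and \<open>c\<close> are involutions on
    \<open>N\<close>, the second factor returns to \<open>u\<close>.\<close>
  define W where "W = {x \<in> space M. \<forall>u\<in>space N. kronv x u \<in> U}"
  have "submodule_D4 M W" unfolding submodule_D4_iff lin_subspace_def
  proof (intro conjI ballI allI)
    show "W \<subseteq> space M" "0\<^sub>v (rdim M) \<in> W" using LU(2) by (auto simp: W_def kronv_zero)
    fix x y assume "x \<in> W" "y \<in> W"
    then show "x + y \<in> W" using LU(3) by (auto simp: W_def kronv_add)
  next
    fix k x assume "x \<in> W"
    then show "k \<cdot>\<^sub>v x \<in> W" using LU(4) by (auto simp: W_def kronv_smult)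
  next
    fix t :: "'a rep \<Rightarrow> 'a mat" and x assume t: "t \<in> gens" and xW: "x \<in> W"
    then have x: "x \<in> space M" and xU: "\<And>u. u \<in> space N \<Longrightarrow> kronv x u \<in> U" by (auto simp: W_def)
    have "kronv (t M *\<^sub>v x) u \<in> U" if u: "u \<in> space N" for u
    proof -
      note bu = car[OF cN(2) u] and cu = car[OF cN(3) u]
      consider "t = opa" | "t = opb" | "t = opc" | "t = opd" using t by (auto simp: gens_def)
      then show ?thesis
      proof cases
        case 1
        have "opa (M \<otimes>\<^sub>D N) *\<^sub>v kronv x (opb N *\<^sub>v u) \<in> U" using oU gens_simps(1) xU[OF bu] by blast
        then have "kronv (opa M *\<^sub>v x) u + kronv x (opa N *\<^sub>v (opb N *\<^sub>v u)) \<in> U"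
          unfolding tensor_kronv[OF M N x bu] bb[OF u] .
        then show ?thesis unfolding 1
          by (rule cancel[OF _ xU[OF car[OF cN(1) bu]]]) (use cM cN x u in simp)
      next
        case 2
        have "opb (M \<otimes>\<^sub>D N) *\<^sub>v kronv x (opb N *\<^sub>v u) \<in> U" using oU gens_simps(2) xU[OF bu] by blast
        then show ?thesis unfolding tensor_kronv[OF M N x bu] bb[OF u] 2 .
      next
        case 3
        have "opc (M \<otimes>\<^sub>D N) *\<^sub>v kronv x (opc N *\<^sub>v u) \<in> U" using oU gens_simps(3) xU[OF cu] by blast
        then show ?thesis unfolding tensor_kronv[OF M N x cu] bb[OF u] 3 .
      next
        case 4
        have "opd (M \<otimes>\<^sub>D N) *\<^sub>v kronv x (opc N *\<^sub>v u) \<in> U" using oU gens_simps(4) xU[OF cu] by blast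
        then have "kronv (opd M *\<^sub>v x) u + kronv x (opd N *\<^sub>v (opc N *\<^sub>v u)) \<in> U"
          unfolding tensor_kronv[OF M N x cu] bb[OF u] .
        then show ?thesis unfolding 4
          by (rule cancel[OF _ xU[OF car[OF cN(4) cu]]]) (use cM cN x u in simp)
      qed
    qed
    then show "t M *\<^sub>v x \<in> W" using car[OF rep_carrierD[OF D4_moduleD(1)[OF M] t] x] by (simp add: W_def)
  qed
  then have "W = space M" by (rule gen) (use v vU in \<open>simp add: W_def\<close>)
  then have "kronv x u \<in> U" if "x \<in> space M" "u \<in> space N" for x u using that by (auto simp: W_def)
  then show ?thesis using kronv_span[of "rdim M" "rdim N" U] submodule_D4D(1)[OF U] by simp
qed

section \<open>Maps out of direct sums\<close>

lemma dsum_rdim: "rdim (dsum Ms) = sum_list (map rdim Ms)"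
  by (simp add: dsum_def)

lemma dsum_gens: "t \<in> gens \<Longrightarrow> t (dsum Ms) = diag_block_mat (map t Ms)"
  by (auto simp: gens_def dsum_def)

lemma rep_carrier_dsum:
  assumes "\<forall>M\<in>set Ms. rep_carrier M"
  shows "rep_carrier (dsum Ms)"
  unfolding rep_carrier_def
proof (intro ballI)
  fix t :: "'a rep \<Rightarrow> 'a mat" assume t: "t \<in> gens"
  have c: "dim_row (t M) = rdim M" "dim_col (t M) = rdim M" if "M \<in> set Ms" for M
    using carrier_matD[OF rep_carrierD[OF _ t, of M]] assms that by auto
  have "sum_list (map (\<lambda>M. dim_row (t M)) Ms) = sum_list (map rdim Ms)" "sum_list (map (\<lambda>M. dim_col (t M)) Ms) =
    sum_list (map rdim Ms)"
    by (rule arg_cong[of _ _ sum_list], rule map_cong; simp add: c)+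
  then show "t (dsum Ms) \<in> carrier_mat (rdim (dsum Ms)) (rdim (dsum Ms))"
    unfolding dsum_gens[OF t] dsum_rdim by (intro carrier_matI) (simp_all add: dim_diag_block_mat o_def)
qed

text \<open>The map is the block row formed by \<open>h\<close> and \<open>H\<close>, written as a
  four-block matrix with empty lower blocks. The conclusion keeps track of images because
  surjectivity is what the later comparison of dimensions starts from.\<close>

lemma dsum_Cons_hom:
  assumes M: "rep_carrier M" "\<forall>M\<in>set Ms. rep_carrier M" and X: "rep_carrier X"
    and h: "h \<in> hom_D4 M X" and H: "H \<in> hom_D4 (dsum Ms) X"
  obtains G where "G \<in> hom_D4 (dsum (M # Ms)) X"
    "(*\<^sub>v) h ` space M \<subseteq> (*\<^sub>v) G ` space (dsum (M # Ms))" "(*\<^sub>v) H ` space (dsum Ms) \<subseteq> (*\<^sub>v) G ` space (dsum (M # Ms))"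
proof -
  let ?m = "rdim M" and ?n = "rdim (dsum Ms)" and ?x = "rdim X"
  define G where "G = four_block_mat h H (0\<^sub>m 0 ?m) (0\<^sub>m 0 ?n)"
  note rD = rep_carrier_dsum[OF M(2)]
  note hc = hom_D4D(1)[OF h] and Hc = hom_D4D(1)[OF H]
  have n: "rdim (dsum (M # Ms)) = ?m + ?n" by (simp add: dsum_rdim)
  have Gc: "G \<in> carrier_mat ?x (?m + ?n)" unfolding G_def
    using hc Hc four_block_carrier_mat[of h ?x ?m "0\<^sub>m 0 ?n" 0 ?n] by simp
  have Ghom: "G \<in> hom_D4 (dsum (M # Ms)) X" unfolding hom_D4_iff n
  proof (intro conjI ballI)
    fix t :: "'a rep \<Rightarrow> 'a mat" assume t: "t \<in> gens"
    note tc = rep_carrierD[OF M(1) t] rep_carrierD[OF rD t] rep_carrierD[OF X t]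
    have t1: "t (dsum (M # Ms)) = four_block_mat (t M) (0\<^sub>m ?m ?n) (0\<^sub>m ?n ?m) (t (dsum Ms))"
      using tc unfolding dsum_gens[OF t] by (simp add: Let_def)
    have "G * t (dsum (M # Ms)) = four_block_mat (h * t M) (H * t (dsum Ms)) (0\<^sub>m 0 ?m) (0\<^sub>m 0 ?n)"
      unfolding G_def t1 using hc Hc tc
      by (subst mult_four_block_mat[of _ ?x ?m _ ?n _ 0 _ _ ?m _ ?n]) (auto simp: mat_mult_zero mat_add_zero)
    also have "\<dots> = t X * G" unfolding hom_D4D(2)[OF h t] hom_D4D(2)[OF H t]
    proof (rule eq_mat_by_vec[of _ ?x "?m + ?n"])
      show "four_block_mat (t X * h) (t X * H) (0\<^sub>m 0 ?m) (0\<^sub>m 0 ?n) \<in> carrier_mat ?x (?m + ?n)"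
        using tc hc Hc four_block_carrier_mat[of "t X * h" ?x ?m "0\<^sub>m 0 ?n" 0 ?n] by simp
      show "t X * G \<in> carrier_mat ?x (?m + ?n)" using tc Gc by simp
      fix z :: "'a vec" assume z: "z \<in> carrier_vec (?m + ?n)"
      define z1 where "z1 = vec_first z ?m"
      define z2 where "z2 = vec_last z ?n"
      have z12: "z = z1 @\<^sub>v z2" "z1 \<in> carrier_vec ?m" "z2 \<in> carrier_vec ?n"
        unfolding z1_def z2_def using vec_first_last_append[OF z] by auto
      have e: "y @\<^sub>v w = y" if "w \<in> carrier_vec 0" for y w :: "'a vec" using that by (intro eq_vecI) auto
      have "G *\<^sub>v z = (h *\<^sub>v z1 + H *\<^sub>v z2) @\<^sub>v (0\<^sub>m 0 ?m *\<^sub>v z1 + 0\<^sub>m 0 ?n *\<^sub>v z2)"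
        unfolding G_def z12(1) by (rule four_block_mat_mult_vec[OF hc Hc _ _ z12(2,3)]) auto
      also have "\<dots> = h *\<^sub>v z1 + H *\<^sub>v z2" by (rule e) (use z12 in \<open>simp add: mat_vec_zero\<close>)
      finally have Gz: "G *\<^sub>v z = h *\<^sub>v z1 + H *\<^sub>v z2" .
      have "four_block_mat (t X * h) (t X * H) (0\<^sub>m 0 ?m) (0\<^sub>m 0 ?n) *\<^sub>v z =
        ((t X * h) *\<^sub>v z1 + (t X * H) *\<^sub>v z2) @\<^sub>v (0\<^sub>m 0 ?m *\<^sub>v z1 + 0\<^sub>m 0 ?n *\<^sub>v z2)"
        unfolding z12(1) by (rule four_block_mat_mult_vec[OF _ _ _ _ z12(2,3)]) (use tc hc Hc in auto)
      also have "\<dots> = (t X * h) *\<^sub>v z1 + (t X * H) *\<^sub>v z2" by (rule e) (use z12 in \<open>simp add: mat_vec_zero\<close>)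
      also have "\<dots> = (t X * G) *\<^sub>v z"
        using tc hc Hc Gc z z12(2,3) by (simp add: mat_mult_vec_assoc Gz mat_vec_add)
      finally show "four_block_mat (t X * h) (t X * H) (0\<^sub>m 0 ?m) (0\<^sub>m 0 ?n) *\<^sub>v z = (t X * G) *\<^sub>v z" .
    qed
    finally show "G * t (dsum (M # Ms)) = t X * G" .
  qed (rule Gc)
  have Gz: "G *\<^sub>v (z1 @\<^sub>v z2) = h *\<^sub>v z1 + H *\<^sub>v z2" if z: "z1 \<in> carrier_vec ?m" "z2 \<in> carrier_vec ?n" for z1 z2
  proof -
    have e: "y @\<^sub>v w = y" if "w \<in> carrier_vec 0" for y w :: "'a vec" using that by (intro eq_vecI) auto
    have "G *\<^sub>v (z1 @\<^sub>v z2) = (h *\<^sub>v z1 + H *\<^sub>v z2) @\<^sub>v (0\<^sub>m 0 ?m *\<^sub>v z1 + 0\<^sub>m 0 ?n *\<^sub>v z2)"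
      unfolding G_def by (rule four_block_mat_mult_vec[OF hc Hc _ _ z]) auto
    also have "\<dots> = h *\<^sub>v z1 + H *\<^sub>v z2" by (rule e) (use z in \<open>simp add: mat_vec_zero\<close>)
    finally show ?thesis .
  qed
  have "(*\<^sub>v) h ` space M \<subseteq> (*\<^sub>v) G ` space (dsum (M # Ms))"
  proof clarify
    fix z assume z: "z \<in> space M"
    have "h *\<^sub>v z = G *\<^sub>v (z @\<^sub>v 0\<^sub>v ?n)" using Gz[OF z, of "0\<^sub>v ?n"] hc Hc z by (simp add: mat_vec_zero)
    then show "h *\<^sub>v z \<in> (*\<^sub>v) G ` space (dsum (M # Ms))" unfolding n using z by (intro image_eqI) auto
  qed
  moreover have "(*\<^sub>v) H ` space (dsum Ms) \<subseteq> (*\<^sub>v) G ` space (dsum (M # Ms))"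
  proof clarify
    fix z assume z: "z \<in> space (dsum Ms)"
    have "H *\<^sub>v z = G *\<^sub>v (0\<^sub>v ?m @\<^sub>v z)" using Gz[of "0\<^sub>v ?m", OF _ z] hc Hc z by (simp add: mat_vec_zero)
    then show "H *\<^sub>v z \<in> (*\<^sub>v) G ` space (dsum (M # Ms))" unfolding n using z by (intro image_eqI) auto
  qed
  ultimately show thesis by (rule that[OF Ghom])
qed

lemma dsum_Nil_hom: "rep_carrier X \<Longrightarrow> 0\<^sub>m (rdim X) 0 \<in> hom_D4 (dsum []) X"
  unfolding hom_D4_iff by (auto simp: dsum_rdim dsum_gens mat_mult_zero dest!: rep_carrierD)

section \<open>Tensor products with the projective modules\<close>

lemma pow_neg1_square [simp]: "pow_neg1 q * pow_neg1 q = (1 :: 'k::field)"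
  by (simp add: pow_neg1_def)

text \<open>\<open>v\<close> generates \<open>P\<close> and corresponds to the generator of the free module of rank one.\<close>

definition generator :: "'k::field rep \<Rightarrow> 'k \<Rightarrow> 'k vec \<Rightarrow> bool" where
  "generator P e v \<longleftrightarrow> v \<in> space P \<and> opb P *\<^sub>v v = e \<cdot>\<^sub>v v \<and> opc P *\<^sub>v v = e \<cdot>\<^sub>v v \<and>
     (\<forall>W. submodule_D4 P W \<and> v \<in> W \<longrightarrow> W = space P) \<and>
     (\<forall>X w. D4_module X \<and> w \<in> space X \<and> opb X *\<^sub>v w = e \<cdot>\<^sub>v w \<and> opc X *\<^sub>v w = e \<cdot>\<^sub>v w \<longrightarrow>
        (\<exists>h\<in>hom_D4 P X. h *\<^sub>v v = w))"

text \<open>The free module of rank one is a projective cover of the same simple module, so it is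
  isomorphic to \<open>P\<close>; dimension, generator and universal property are transported along
  the isomorphism.\<close>

lemma is_P_structure:
  assumes two: "(2::'k::field) \<noteq> 0" and P: "is_P q (P :: 'k rep)"
  obtains v where "D4_module P" "rdim P = 4" "generator P (pow_neg1 q) v"
proof -
  let ?e = "pow_neg1 q :: 'k" and ?F = "free 1 (pow_neg1 q) :: 'k rep"
  obtain p where p: "projective_cover P p (syz 0 ?e)" using P unfolding is_P_def simple_V_eq_syz by blast
  have F: "projective_cover ?F (syz_proj 0) (syz 0 ?e)" using projective_cover_syz[OF two, of ?e 0] by simp
  have Pm: "D4_module P" using p by (simp add: projective_cover_def projective_def)
  have Fm: "D4_module ?F" using F by (simp add: projective_cover_def projective_def)
  have S: "D4_module (syz 0 ?e)" using p by (simp add: projective_cover_def)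
  note one = one_hom_D4[OF D4_moduleD(1)[OF S]]
  have oo: "1\<^sub>m (rdim (syz 0 ?e)) * 1\<^sub>m (rdim (syz 0 ?e)) = (1\<^sub>m (rdim (syz 0 ?e)) :: 'k mat)" by simp
  obtain h k where h: "h \<in> hom_D4 P ?F" and k: "k \<in> hom_D4 ?F P" and kh: "k * h = 1\<^sub>m (rdim P)"
    and hk: "h * k = 1\<^sub>m (rdim ?F)"
    using projective_cover_unique[OF p F one one oo oo] by metis
  note hc = hom_D4D(1)[OF h] and kc = hom_D4D(1)[OF k]
  have dim: "rdim P = 4" using two_sided_inverse_dim[OF hc kc kh hk] by simp
  define V where "V = k * gincl 1"
  have Vc: "V \<in> carrier_mat (rdim P) 1" unfolding V_def using kc gincl_carrier(1)[of 1] by auto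
  have gi: "t ?F * gincl 1 = ?e \<cdot>\<^sub>m gincl 1" if "t \<in> {opb, opc}" for t
    using eigen_gincl[of 1 ?e] that by (auto simp: eigen_def)
  have tV: "t P * V = ?e \<cdot>\<^sub>m V" if t: "t \<in> {opb, opc}" for t
  proof -
    have tg: "t \<in> gens" using t by (auto simp: gens_def)
    note tc = rep_carrierD[OF D4_moduleD(1)[OF Pm] tg] rep_carrierD[OF D4_moduleD(1)[OF Fm] tg]
    have "t P * V = (t P * k) * gincl 1" unfolding V_def using tc kc by (simp add: mat_mult_assoc)
    also have "\<dots> = k * (t ?F * gincl 1)" unfolding hom_D4D(2)[OF k tg, symmetric] using tc kc
      by (simp add: mat_mult_assoc)
    finally show ?thesis unfolding gi[OF t] V_def using kc by (simp add: mat_mult_smult)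
  qed
  define v where "v = col V 0"
  have v: "v \<in> space P" unfolding v_def by (rule carrier_vecI) (use Vc in simp)
  have tv: "t P *\<^sub>v v = ?e \<cdot>\<^sub>v v" if t: "t \<in> {opb, opc}" for t
  proof -
    have tg: "t \<in> gens" using t by (auto simp: gens_def)
    have "t P *\<^sub>v v = col (t P * V) 0" unfolding v_def
      using col_mult2[OF rep_carrierD[OF D4_moduleD(1)[OF Pm] tg] Vc, of 0] by simp
    then show ?thesis unfolding tV[OF t] v_def using Vc by (auto intro!: eq_vecI)
  qed
  have eV: "eigen P ?e V" using tV Vc by (simp add: eigen_def)
  have k_eq: "k = free_hom 1 P V" using free_hom_unique[OF Pm _ k] unfolding V_def by simp
  have Vz: "V *\<^sub>v z = z $ 0 \<cdot>\<^sub>v v" if "dim_vec z = 1" for z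
    using that Vc by (intro eq_vecI) (auto simp: v_def scalar_prod_def)
  have gen: "W = space P" if W: "submodule_D4 P W" and vW: "v \<in> W" for W
  proof
    note LW = lin_subspaceD[OF submodule_D4D(1)[OF W]] and oW = submodule_D4D(2)[OF W]
    show "W \<subseteq> space P" using LW(1) by auto
    show "space P \<subseteq> W"
    proof
      fix x assume x: "x \<in> space P"
      define y where "y = h *\<^sub>v x"
      have y: "dim_vec y = 4" unfolding y_def using hc by auto
      have VW: "V *\<^sub>v (gcoord 1 j *\<^sub>v y) \<in> W" for j
        using Vz[of "gcoord 1 j *\<^sub>v y"] LW(4)[OF vW] by simp
      have "x = (k * h) *\<^sub>v x" unfolding kh using x by simp
      also have "\<dots> = k *\<^sub>v y" unfolding y_def using hc kc x by (simp add: mat_mult_vec_assoc)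
      also have "\<dots> = V *\<^sub>v (gcoord 1 0 *\<^sub>v y) + opa P *\<^sub>v (V *\<^sub>v (gcoord 1 (Suc 0) *\<^sub>v y)) + opd P *\<^sub>v (V *\<^sub>v
        (gcoord 1 2 *\<^sub>v y))
          + opa P *\<^sub>v (opd P *\<^sub>v (V *\<^sub>v (gcoord 1 3 *\<^sub>v y)))"
        unfolding k_eq free_hom_def using y Vc D4_moduleD(2-5)[OF Pm] by (simp add: mat_vec)
      also have "\<dots> \<in> W" by (intro LW(3) oW gens_simps VW)
      finally show "x \<in> W" .
    qed
  qed
  have univ: "\<exists>g\<in>hom_D4 P X. g *\<^sub>v v = w"
    if X: "D4_module X" and w: "w \<in> space X" and bw: "opb X *\<^sub>v w = ?e \<cdot>\<^sub>v w" and cw: "opc X *\<^sub>v w = ?e \<cdot>\<^sub>v w" for X w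
  proof -
    define W where "W = mat_of_cols (rdim X) [w]"
    have Wc: "W \<in> carrier_mat (rdim X) 1" using mat_of_cols_carrier(1)[of "rdim X" "[w]"] by (simp add: W_def)
    have colW: "col W 0 = w" using w by (simp add: W_def)
    have "t X * W = ?e \<cdot>\<^sub>m W" if t: "t \<in> {opb, opc}" for t
    proof (rule mat_col_eqI)
      have tg: "t \<in> gens" using t by (auto simp: gens_def)
      fix j assume "j < dim_col (?e \<cdot>\<^sub>m W)"
      then have j: "j = 0" using Wc by simp
      have "col (t X * W) 0 = t X *\<^sub>v w"
        using col_mult2[OF rep_carrierD[OF D4_moduleD(1)[OF X] tg] Wc, of 0] colW by simp
      also have "\<dots> = ?e \<cdot>\<^sub>v col W 0" using t bw cw colW by auto
      also have "\<dots> = col (?e \<cdot>\<^sub>m W) 0" using Wc by (intro eq_vecI) auto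
      finally show "col (t X * W) j = col (?e \<cdot>\<^sub>m W) j" unfolding j .
    next
      have tg: "t \<in> gens" using t by (auto simp: gens_def)
      show "dim_row (t X * W) = dim_row (?e \<cdot>\<^sub>m W)" "dim_col (t X * W) = dim_col (?e \<cdot>\<^sub>m W)"
        using rep_carrierD[OF D4_moduleD(1)[OF X] tg] Wc by auto
    qed
    then have "eigen X ?e W" using Wc by (simp add: eigen_def)
    from free_hom[OF X Wc this] have f: "free_hom 1 X W \<in> hom_D4 ?F X" "free_hom 1 X W * gincl 1 = W" by auto
    note fc = hom_D4D(1)[OF f(1)]
    have g: "free_hom 1 X W * h \<in> hom_D4 P X"
      by (rule hom_D4_comp[OF h f(1)]) (rule D4_moduleD(1)[OF Pm] D4_moduleD(1)[OF Fm] D4_moduleD(1)[OF X])+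
    have "(free_hom 1 X W * h) * V = free_hom 1 X W * ((h * k) * gincl 1)"
      unfolding V_def using fc hc kc by (simp add: mat_mult_assoc)
    also have "\<dots> = W" unfolding hk using f(2) by simp
    finally have gV: "(free_hom 1 X W * h) * V = W" .
    have "(free_hom 1 X W * h) *\<^sub>v v = col ((free_hom 1 X W * h) * V) 0"
      unfolding v_def using col_mult2[OF hom_D4D(1)[OF g] Vc, of 0] by simp
    then show ?thesis unfolding gV colW using g by blast
  qed
  have tv': "opb P *\<^sub>v v = ?e \<cdot>\<^sub>v v" "opc P *\<^sub>v v = ?e \<cdot>\<^sub>v v" using tv by auto
  have "generator P ?e v" unfolding generator_def
    by (intro conjI allI impI v tv'; elim conjE; (rule gen | rule univ))
  then show thesis by (rule that[OF Pm dim])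
qed

lemma is_P_module:
  assumes two: "(2::'k::field) \<noteq> 0" and P: "is_P q (P :: 'k rep)"
  shows "D4_module P" "rdim P = 4"
  by (rule is_P_structure[OF assms], assumption)+

text \<open>One copy of \<open>A\<close> for each eigenvector in the list, whose generator is sent
  to that eigenvector.\<close>

lemma copies_hom:
  assumes two: "(2::'k::field) \<noteq> 0" and A: "is_P q (A :: 'k rep)" and X: "D4_module X"
    and ws: "\<forall>w\<in>set ws. w \<in> space X \<and> opb X *\<^sub>v w = pow_neg1 q \<cdot>\<^sub>v w \<and> opc X *\<^sub>v w = pow_neg1 q \<cdot>\<^sub>v w"
  shows "\<exists>H\<in>hom_D4 (copies (length ws) A) X. set ws \<subseteq> (*\<^sub>v) H ` space (copies (length ws) A)"
  using ws
proof (induction ws)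
  case Nil
  show ?case using dsum_Nil_hom[OF D4_moduleD(1)[OF X]] by (auto simp: copies_def)
next
  case (Cons w ws)
  obtain v where Am: "D4_module A" and gen: "generator A (pow_neg1 q) v"
    using is_P_structure[OF two A] by metis
  then have v: "v \<in> space A" by (simp add: generator_def)
  obtain h where h: "h \<in> hom_D4 A X" "h *\<^sub>v v = w" using gen X Cons.prems unfolding generator_def by force
  obtain H where H: "H \<in> hom_D4 (dsum (replicate (length ws) A)) X" "set ws \<subseteq> (*\<^sub>v) H ` space (dsum (replicate
    (length ws) A))"
    using Cons unfolding copies_def by auto
  have r: "\<forall>M\<in>set (replicate (length ws) A). rep_carrier M" using D4_moduleD(1)[OF Am] by auto
  obtain G where "G \<in> hom_D4 (dsum (A # replicate (length ws) A)) X"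
    "(*\<^sub>v) h ` space A \<subseteq> (*\<^sub>v) G ` space (dsum (A # replicate (length ws) A))"
    "(*\<^sub>v) H ` space (dsum (replicate (length ws) A)) \<subseteq> (*\<^sub>v) G ` space (dsum (A # replicate (length ws) A))"
    using dsum_Cons_hom[OF D4_moduleD(1)[OF Am] r D4_moduleD(1)[OF X] h(1) H(1)] by metis
  moreover have "w \<in> (*\<^sub>v) h ` space A" using h(2) v by auto
  ultimately show ?case using H(2) unfolding copies_def by (intro bexI[of _ G]) auto
qed

lemma surj_hom_iso:
  assumes G: "G \<in> hom_D4 D X" and dim: "rdim D = rdim X" and surj: "(*\<^sub>v) G ` space D = space X"
    and c: "rep_carrier D" "rep_carrier X"
  shows "X \<cong>\<^sub>D D"
proof -
  have Gc: "G \<in> carrier_mat (rdim X) (rdim X)" using hom_D4D(1)[OF G] dim by simp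
  obtain R where R: "R \<in> carrier_mat (rdim X) (rdim X)" "G * R = 1\<^sub>m (rdim X)"
    using surj_right_inverse[OF Gc] surj dim by metis
  have "R * G = 1\<^sub>m (rdim X)" by (rule mat_mult_left_right_inverse[OF Gc R])
  then have "D \<cong>\<^sub>D X" using iso_D4I[OF G, of R] R dim by simp
  then show ?thesis by (rule iso_D4_sym[OF _ c])
qed

lemma dsum_pair_hom:
  assumes H: "H \<in> hom_D4 C X" "H' \<in> hom_D4 C' X" and c: "rep_carrier C" "rep_carrier C'" "rep_carrier X"
  obtains G where "G \<in> hom_D4 (dsum [C, C']) X"
    "(*\<^sub>v) H ` space C \<subseteq> (*\<^sub>v) G ` space (dsum [C, C'])" "(*\<^sub>v) H' ` space C' \<subseteq> (*\<^sub>v) G ` space (dsum [C, C'])"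
proof -
  have nil: "\<forall>M\<in>set []. rep_carrier (M :: 'a rep)" by simp
  obtain G1 where G1: "G1 \<in> hom_D4 (dsum [C']) X" "(*\<^sub>v) H' ` space C' \<subseteq> (*\<^sub>v) G1 ` space (dsum [C'])"
    "(*\<^sub>v) (0\<^sub>m (rdim X) 0) ` space (dsum []) \<subseteq> (*\<^sub>v) G1 ` space (dsum [C'])"
    by (rule dsum_Cons_hom[OF c(2) nil c(3) H(2) dsum_Nil_hom[OF c(3)]])
  have C': "\<forall>M\<in>set [C']. rep_carrier M" using c by simp
  obtain G where G: "G \<in> hom_D4 (dsum [C, C']) X" "(*\<^sub>v) H ` space C \<subseteq> (*\<^sub>v) G ` space (dsum [C, C'])"
    "(*\<^sub>v) G1 ` space (dsum [C']) \<subseteq> (*\<^sub>v) G ` space (dsum [C, C'])"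
    by (rule dsum_Cons_hom[OF c(1) C' c(3) H(1) G1(1)])
  show thesis by (rule that[OF G(1,2) subset_trans[OF G1(2) G(3)]])
qed

lemma copies_rdim: "rdim (copies n M) = n * rdim M"
  by (simp add: copies_def dsum_rdim sum_list_replicate)

lemma rep_carrier_copies: "rep_carrier M \<Longrightarrow> rep_carrier (copies n M)"
  unfolding copies_def by (rule rep_carrier_dsum) simp

text \<open>If \<open>v\<close> generates \<open>P\<close>, the vectors \<open>v \<otimes> u\<close>, with \<open>u\<close> running over a basis of eigenvectors of \<open>N\<close>,
  generate \<open>P \<otimes> N\<close>; each is the image of the generator of some \<open>P(q)\<close>, and dimensions match.\<close>

lemma tensor_projective:
  assumes two: "(2::'k::field) \<noteq> 0" and P: "is_P r (P :: 'k rep)" and A: "is_P q0 A" and B: "is_P q1 B"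
    and N: "D4_module N" and g: "graded N e n0 n1"
    and q: "pow_neg1 q0 = pow_neg1 r * e" "pow_neg1 q1 = - (pow_neg1 r * e)"
  shows "P \<otimes>\<^sub>D N \<cong>\<^sub>D dsum [copies n0 A, copies n1 B]" "P \<otimes>\<^sub>D N \<cong>\<^sub>D dsum [copies n1 B, copies n0 A]"
proof -
  let ?X = "P \<otimes>\<^sub>D N" and ?n = "n0 + n1"
  let ?D = "sparse ?n ?n (\<lambda>i. if i < n0 then e else - e) (\<lambda>i. i)"
  obtain v where Pm: "D4_module P" and dP: "rdim P = 4" and "generator P (pow_neg1 r) v"
    using is_P_structure[OF two P] by metis
  then have v: "v \<in> space P" and bv: "opb P *\<^sub>v v = pow_neg1 r \<cdot>\<^sub>v v" and cv: "opc P *\<^sub>v v = pow_neg1 r \<cdot>\<^sub>v v"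
    and gen: "\<And>W. submodule_D4 P W \<Longrightarrow> v \<in> W \<Longrightarrow> W = space P"
    by (auto simp: generator_def)
  note Am = is_P_module[OF two A] and Bm = is_P_module[OF two B]
  have Xm: "D4_module ?X" by (rule D4_module_tensor[OF Pm N])
  note rX = D4_moduleD(1)[OF Xm]
  obtain S T where S: "S \<in> carrier_mat ?n ?n" and T: "T \<in> carrier_mat ?n ?n"
    and ST: "S * T = 1\<^sub>m ?n" and bS: "\<And>t. t \<in> {opb, opc} \<Longrightarrow> t N * S = S * ?D"
    and nN: "rdim N = ?n" using g unfolding graded_def by blast
  have colS: "col S j \<in> space N" if "j < ?n" for j using S nN that by auto
  have eig: "t N *\<^sub>v col S j = (if j < n0 then e else - e) \<cdot>\<^sub>v col S j" if t: "t \<in> {opb, opc}" and j: "j < ?n" for t j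
  proof -
    have tg: "t \<in> gens" using t by (auto simp: gens_def)
    have "t N *\<^sub>v col S j = col (t N * S) j"
      using col_mult2[OF rep_carrierD[OF D4_moduleD(1)[OF N] tg, unfolded nN] S j] by simp
    also have "\<dots> = S *\<^sub>v col ?D j" unfolding bS[OF t] by (rule col_mult2[OF S _ j]) simp
    also have "col ?D j = (if j < n0 then e else - e) \<cdot>\<^sub>v unit_vec ?n j"
      using j by (intro eq_vecI) (auto simp: sparse_index unit_vec_def)
    finally show ?thesis using S j by (simp add: mat_vec_smult mat_mult_unit_vec[OF S j])
  qed
  define w where "w j = kronv v (col S j)" for j
  have wc: "w j \<in> space ?X" if "j < ?n" for j
    using v S nN that by (intro carrier_vecI) (simp add: w_def)
  \<comment> \<open>As \<open>b\<close> and \<open>c\<close> are grouplike, eigenvalues multiply;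
    their product is the sign of the projective module that maps onto the submodule generated by
    \<open>w j\<close>.\<close>
  have tw: "t ?X *\<^sub>v w j = (pow_neg1 r * (if j < n0 then e else - e)) \<cdot>\<^sub>v w j" if t: "t \<in> {opb, opc}"
    and j: "j < ?n" for t j
  proof -
    have "t ?X *\<^sub>v w j = kronv (t P *\<^sub>v v) (t N *\<^sub>v col S j)"
      using t tensor_kronv(2,3)[OF Pm N v colS[OF j]] by (auto simp: w_def)
    also have "\<dots> = kronv (pow_neg1 r \<cdot>\<^sub>v v) ((if j < n0 then e else - e) \<cdot>\<^sub>v col S j)"
      unfolding eig[OF t j] using t bv cv by auto
    also have "\<dots> = (pow_neg1 r * (if j < n0 then e else - e)) \<cdot>\<^sub>v w j"
      by (simp add: kronv_smult w_def smult_smult_assoc mult.commute)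
    finally show ?thesis .
  qed
  have "\<forall>x\<in>set (map w [0..<n0]). x \<in> space ?X \<and> opb ?X *\<^sub>v x = pow_neg1 q0 \<cdot>\<^sub>v x \<and> opc ?X *\<^sub>v x = pow_neg1 q0 \<cdot>\<^sub>v x"
    using wc tw[of opb] tw[of opc] by (auto simp: q)
  from copies_hom[OF two A Xm this] obtain H0 where H0: "H0 \<in> hom_D4 (copies n0 A) ?X" "w ` {0..<n0} \<subseteq> (*\<^sub>v) H0 `
    space (copies n0 A)"
    by auto
  have "\<forall>x\<in>set (map w [n0..<?n]). x \<in> space ?X \<and> opb ?X *\<^sub>v x = pow_neg1 q1 \<cdot>\<^sub>v x \<and> opc ?X *\<^sub>v x = pow_neg1 q1 \<cdot>\<^sub>v x"
    using wc tw[of opb] tw[of opc] by (auto simp: q)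
  from copies_hom[OF two B Xm this] obtain H1 where H1: "H1 \<in> hom_D4 (copies n1 B) ?X" "w ` {n0..<?n} \<subseteq> (*\<^sub>v) H1 `
    space (copies n1 B)"
    by auto
  note rA = rep_carrier_copies[OF D4_moduleD(1)[OF Am(1)], of n0]
    and rB = rep_carrier_copies[OF D4_moduleD(1)[OF Bm(1)], of n1]
  \<comment> \<open>Stated for an arbitrary source \<open>D\<close>, so that both orders of the two
    summands are covered.\<close>
  have iso: "?X \<cong>\<^sub>D D"
    if G: "G \<in> hom_D4 D ?X" and im0: "(*\<^sub>v) H0 ` space (copies n0 A) \<subseteq> (*\<^sub>v) G ` space D"
      and im1: "(*\<^sub>v) H1 ` space (copies n1 B) \<subseteq> (*\<^sub>v) G ` space D" and rD: "rep_carrier D"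
        and dD: "rdim D = 4 * ?n" for D G
  proof (rule surj_hom_iso[OF G _ _ rD rX])
    show "rdim D = rdim ?X" by (simp add: dD dP nN)
    define U where "U = (*\<^sub>v) G ` space D"
    have U: "submodule_D4 ?X U" unfolding U_def by (rule submodule_D4_image[OF G rD rX])
    note LU = lin_subspaceD[OF submodule_D4D(1)[OF U]]
    have wU: "w j \<in> U" if "j < ?n" for j
    proof (cases "j < n0")
      case True
      then have "w j \<in> w ` {0..<n0}" by simp
      then show ?thesis using H0(2) im0 unfolding U_def by blast
    next
      case False
      then have "w j \<in> w ` {n0..<?n}" using that by simp
      then show ?thesis using H1(2) im1 unfolding U_def by blast
    qed
    \<comment> \<open>The vectors \<open>u\<close> with \<open>v \<otimes> u\<close> in the image
      form a subspace containing the eigenbasis, hence all of \<open>N\<close>.\<close>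
    define K where "K = {u \<in> carrier_vec ?n. kronv v u \<in> U}"
    have K: "lin_subspace ?n K" unfolding lin_subspace_def
      using LU(2-4) v nN by (auto simp: K_def kronv_add kronv_smult kronv_zero)
    show "(*\<^sub>v) G ` space D = space ?X" unfolding U_def[symmetric]
    proof (rule tensor_generated[OF Pm N gen v U])
      fix u assume "u \<in> space N"
      then have u: "u \<in> carrier_vec ?n" using nN by simp
      have "S *\<^sub>v (T *\<^sub>v u) \<in> K"
      proof (rule lin_subspace_mult_vec[OF K S])
        fix j assume "j < ?n"
        then show "col S j \<in> K" using wU colS nN by (auto simp: K_def w_def)
      qed (use T u in auto)
      moreover have "S *\<^sub>v (T *\<^sub>v u) = (S * T) *\<^sub>v u" using S T u by (simp add: mat_mult_vec_assoc)
      ultimately show "kronv v u \<in> U" unfolding ST using u by (simp add: K_def)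
    qed
  qed
  obtain G where G: "G \<in> hom_D4 (dsum [copies n0 A, copies n1 B]) ?X"
    "(*\<^sub>v) H0 ` space (copies n0 A) \<subseteq> (*\<^sub>v) G ` space (dsum [copies n0 A, copies n1 B])"
    "(*\<^sub>v) H1 ` space (copies n1 B) \<subseteq> (*\<^sub>v) G ` space (dsum [copies n0 A, copies n1 B])"
    using dsum_pair_hom[OF H0(1) H1(1) rA rB rX] by metis
  show "?X \<cong>\<^sub>D dsum [copies n0 A, copies n1 B]"
    by (rule iso[OF G rep_carrier_dsum]) (use rA rB in \<open>auto simp: dsum_rdim copies_rdim Am Bm\<close>)
  obtain G' where G': "G' \<in> hom_D4 (dsum [copies n1 B, copies n0 A]) ?X"
    "(*\<^sub>v) H1 ` space (copies n1 B) \<subseteq> (*\<^sub>v) G' ` space (dsum [copies n1 B, copies n0 A])"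
    "(*\<^sub>v) H0 ` space (copies n0 A) \<subseteq> (*\<^sub>v) G' ` space (dsum [copies n1 B, copies n0 A])"
    using dsum_pair_hom[OF H1(1) H0(1) rB rA rX] by metis
  show "?X \<cong>\<^sub>D dsum [copies n1 B, copies n0 A]"
    by (rule iso[OF G'(1,3,2) rep_carrier_dsum]) (use rA rB in \<open>auto simp: dsum_rdim copies_rdim Am Bm\<close>)
qed

section \<open>Indecomposable modules\<close>

text \<open>\<open>A\<close> parametrizes the image of \<open>E\<close>, on which \<open>E\<close>
  is the identity, so \<open>E A = A\<close>; for a left inverse \<open>B\<close> of
  \<open>A\<close> the projection is \<open>p = B E\<close>.\<close>

lemma idempotent_split:
  fixes E :: "'k::field mat"
  assumes E: "E \<in> carrier_mat n n" "E * E = E"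
  obtains d A p where "A \<in> carrier_mat n d" "p \<in> carrier_mat d n" "p * A = 1\<^sub>m d" "A * p = E"
proof -
  obtain d A B where A: "A \<in> carrier_mat n d" and B: "B \<in> carrier_mat d n" and BA: "B * A = 1\<^sub>m d"
    and im: "(*\<^sub>v) A ` carrier_vec d = (*\<^sub>v) E ` carrier_vec n"
    using lin_subspace_split[OF lin_subspace_image[OF E(1)]] by metis
  have EA: "E * A = A"
  proof (rule eq_mat_by_vec[of _ n d])
    fix z :: "'k vec" assume z: "z \<in> carrier_vec d"
    then obtain x where x: "x \<in> carrier_vec n" "A *\<^sub>v z = E *\<^sub>v x" using im by blast
    have "(E * A) *\<^sub>v z = E *\<^sub>v (E *\<^sub>v x)" using E A z x by (simp add: mat_mult_vec_assoc)
    also have "\<dots> = (E * E) *\<^sub>v x" using E(1) x(1) by (simp add: mat_mult_vec_assoc)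
    finally show "(E * A) *\<^sub>v z = A *\<^sub>v z" unfolding E(2) x(2) .
  qed (use E A in auto)
  have ABE: "A * (B * E) = E"
  proof (rule eq_mat_by_vec[of _ n n])
    fix x :: "'k vec" assume x: "x \<in> carrier_vec n"
    then have "E *\<^sub>v x \<in> (*\<^sub>v) A ` carrier_vec d" unfolding im by blast
    then obtain z where z: "z \<in> carrier_vec d" "E *\<^sub>v x = A *\<^sub>v z" by auto
    have "(A * (B * E)) *\<^sub>v x = A *\<^sub>v (B *\<^sub>v (E *\<^sub>v x))" using E(1) A B x by (simp add: mat_mult_vec_assoc)
    also have "\<dots> = A *\<^sub>v ((B * A) *\<^sub>v z)" unfolding z(2) using A B z(1) by (simp add: mat_mult_vec_assoc)
    finally show "(A * (B * E)) *\<^sub>v x = E *\<^sub>v x" unfolding BA z(2) using z(1) by (simp add: mat_one_vec)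
  qed (use E A B in auto)
  have "(B * E) * A = 1\<^sub>m d" using E(1) A B EA BA by (simp add: mat_mult_assoc)
  with that[of A d "B * E"] A B E(1) ABE show thesis by auto
qed

text \<open>The image of the idempotent \<open>A p\<close> in coordinates, with inclusion
  \<open>A\<close> and projection \<open>p\<close>.\<close>

definition retract :: "'k::field rep \<Rightarrow> nat \<Rightarrow> 'k mat \<Rightarrow> 'k mat \<Rightarrow> 'k rep" where
  "retract M d A p = \<lparr>rdim = d, opa = p * (opa M * A), opb = p * (opb M * A), opc = p * (opc M * A), opd = p * (opd
    M * A)\<rparr>"

text \<open>Since \<open>A p = E\<close> commutes with the generators and fixes \<open>A\<close>,
  one has \<open>A p t A = t A\<close>. Products of compressed operators are therefore compressions
  of products, and the relations pass to the image.\<close>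

lemma retract_module:
  assumes M: "D4_module M" and E: "E \<in> hom_D4 M M"
    and A: "A \<in> carrier_mat (rdim M) d" and p: "p \<in> carrier_mat d (rdim M)" and pA: "p * A = 1\<^sub>m d" and Ap: "A * p = E"
  shows "D4_module (retract M d A p)" "A \<in> hom_D4 (retract M d A p) M"
proof -
  let ?n = "rdim M"
  note D = D4_moduleD[OF M]
  have EA: "E * A = A" unfolding Ap[symmetric] using A p pA by (simp add: mat_mult_assoc)
  have gt: "t (retract M d A p) = p * (t M * A)" if "t \<in> gens" for t using that by (auto simp: gens_def retract_def)
  have At: "A * (p * (t M * A)) = t M * A" if t: "t \<in> gens" for t
  proof -
    note tc = rep_carrierD[OF D(1) t]
    have "A * (p * (t M * A)) = (E * t M) * A" unfolding Ap[symmetric] using A p tc by (simp add: mat_mult_assoc)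
    also have "\<dots> = t M * (E * A)" unfolding hom_D4D(2)[OF E t] using A hom_D4D(1)[OF E] tc by (simp add: mat_mult_assoc)
    finally show ?thesis unfolding EA .
  qed
  show "A \<in> hom_D4 (retract M d A p) M"
    unfolding hom_D4_iff using A At gt by (simp add: retract_def)
  have prod: "(p * (s M * A)) * (p * (t M * A)) = p * ((s M * t M) * A)" if s: "s \<in> gens" and t: "t \<in> gens" for s t
  proof -
    note c = rep_carrierD[OF D(1) s] rep_carrierD[OF D(1) t]
    have "(p * (s M * A)) * (p * (t M * A)) = p * (s M * (A * (p * (t M * A))))" using A p c
      by (simp add: mat_mult_assoc)
    then show ?thesis unfolding At[OF t] using A p c by (simp add: mat_mult_assoc)
  qed
  note prods = prod[OF gens_simps(1,1)] prod[OF gens_simps(1,2)] prod[OF gens_simps(1,3)] prod[OF gens_simps(1,4)]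
    prod[OF gens_simps(2,1)] prod[OF gens_simps(2,2)] prod[OF gens_simps(2,3)] prod[OF gens_simps(2,4)]
    prod[OF gens_simps(3,1)] prod[OF gens_simps(3,2)] prod[OF gens_simps(3,3)] prod[OF gens_simps(3,4)]
    prod[OF gens_simps(4,1)] prod[OF gens_simps(4,2)] prod[OF gens_simps(4,3)] prod[OF gens_simps(4,4)]
  have lin: "p * ((X + Y) * A) = p * (X * A) + p * (Y * A)" "p * ((X - Y) * A) = p * (X * A) - p * (Y * A)" "p * ((-
    X) * A) = - (p * (X * A))"
    if "X \<in> carrier_mat ?n ?n" "Y \<in> carrier_mat ?n ?n" for X Y
    using that A p by (simp_all add: mat_ring)
  have z: "p * (0\<^sub>m ?n ?n * A) = 0\<^sub>m d d" "p * (1\<^sub>m ?n * A) = 1\<^sub>m d"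
    using A p pA by (simp_all add: mat_ring)
  have pc: "s M * t M \<in> carrier_mat ?n ?n" if "s \<in> gens" "t \<in> gens" for s t
    using rep_carrierD[OF D(1) that(1)] rep_carrierD[OF D(1) that(2)] by auto
  have "p * ((opd M * opa M) * A) + p * ((opa M * opd M) * A) = p * ((1\<^sub>m ?n - opb M * opc M) * A)"
    unfolding D(15)[symmetric] by (rule lin(1)[symmetric, OF pc[OF gens_simps(4) gens_simps(1)] pc[OF gens_simps(1)
      gens_simps(4)]])
  also have "\<dots> = 1\<^sub>m d - p * ((opb M * opc M) * A)"
    unfolding z(2)[symmetric] by (rule lin(2)[OF one_carrier_mat pc[OF gens_simps(2) gens_simps(3)]])
  finally have ad: "p * ((opd M * opa M) * A) + p * ((opa M * opd M) * A) = 1\<^sub>m d - p * ((opb M * opc M) * A)" .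
  have sgn: "p * (opb M * opa M * A) = - (p * (opa M * opb M * A))" "p * (opd M * opb M * A) = - (p * (opb M * opd M
    * A))"
    "p * (opc M * opa M * A) = - (p * (opa M * opc M * A))" "p * (opd M * opc M * A) = - (p * (opc M * opd M * A))"
    unfolding D(6-9) by (rule lin(3); rule pc; rule gens_simps)+
  have car: "p * (t M * A) \<in> carrier_mat d d" if "t \<in> gens" for t using rep_carrierD[OF D(1) that] A p by auto
  show "D4_module (retract M d A p)"
    unfolding D4_module_def Let_def retract_def rep.simps prods
    using sgn ad by (intro conjI car gens_simps) (simp_all add: D(10-14) z)
qed

text \<open>\<open>M\<close> is the direct sum of the images of \<open>E\<close> and
  \<open>1 - E\<close>. Indecomposability speaks of isomorphisms onto \<open>dsum\<close>, so the
  decomposition is turned into an explicit one; the summand of dimension 0 decides between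
  \<open>E = 0\<close> and \<open>E = 1\<close>.\<close>

lemma indecomposable_idempotent:
  assumes M: "indecomposable M" and E: "E \<in> hom_D4 M M" "E * E = E"
  shows "E = 0\<^sub>m (rdim M) (rdim M) \<or> E = 1\<^sub>m (rdim M)"
proof -
  let ?n = "rdim M"
  have Mm: "D4_module M" using M by (simp add: indecomposable_def)
  note rM = D4_moduleD(1)[OF Mm]
  note Ec = hom_D4D(1)[OF E(1)]
  define F where "F = 1\<^sub>m ?n - E"
  have Fc: "F \<in> carrier_mat ?n ?n" unfolding F_def using Ec by (simp add: minus_carrier_mat)
  have FF: "F * F = F" unfolding F_def using Ec E(2) by (simp add: mat_ring) (auto intro!: eq_matI)
  have EF: "E * F = 0\<^sub>m ?n ?n" "F * E = 0\<^sub>m ?n ?n" unfolding F_def using Ec E(2) by (simp_all add: mat_ring)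
  have Fh: "F \<in> hom_D4 M M" unfolding hom_D4_iff
  proof (intro conjI ballI)
    fix t :: "'a rep \<Rightarrow> 'a mat" assume t: "t \<in> gens"
    show "F * t M = t M * F" unfolding F_def
      using Ec rep_carrierD[OF rM t] hom_D4D(2)[OF E(1) t] by (simp add: mat_ring)
  qed (rule Fc)
  obtain d A p where A: "A \<in> carrier_mat ?n d" "p \<in> carrier_mat d ?n" "p * A = 1\<^sub>m d" "A * p = E"
    using idempotent_split[OF Ec E(2)] by metis
  obtain d' A' p' where A': "A' \<in> carrier_mat ?n d'" "p' \<in> carrier_mat d' ?n" "p' * A' = 1\<^sub>m d'" "A' * p' = F"
    using idempotent_split[OF Fc FF] by metis
  let ?X = "retract M d A p" and ?Y = "retract M d' A' p'"
  note X = retract_module[OF Mm E(1) A] and Y = retract_module[OF Mm Fh A']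
  have dX: "rdim ?X = d" "rdim ?Y = d'" by (simp_all add: retract_def)
  have pA': "p * A' = 0\<^sub>m d d'"
  proof -
    have "p * A' = (p * A) * p * (A' * (p' * A'))" unfolding A(3) A'(3) using A(2) A'(1) by simp
    also have "\<dots> = p * ((A * p) * (A' * p')) * A'" using A(1,2) A'(1,2) by (simp add: mat_mult_assoc)
    finally show ?thesis unfolding A(4) A'(4) EF(1) using A(2) A'(1) by (simp add: mat_mult_zero)
  qed
  have p'A: "p' * A = 0\<^sub>m d' d"
  proof -
    have "p' * A = (p' * A') * p' * (A * (p * A))" unfolding A(3) A'(3) using A(1) A'(2) by simp
    also have "\<dots> = p' * ((A' * p') * (A * p)) * A" using A(1,2) A'(1,2) by (simp add: mat_mult_assoc)
    finally show ?thesis unfolding A(4) A'(4) EF(2) using A(1) A'(2) by (simp add: mat_mult_zero)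
  qed
  \<comment> \<open>The two inclusions, side by side, have a left inverse; this bounds
    \<open>d + d'\<close> by the dimension of \<open>M\<close>. The opposite inequality will come
    from surjectivity of \<open>G\<close>.\<close>
  have "four_block_mat p (0\<^sub>m d 0) p' (0\<^sub>m d' 0) * four_block_mat A A' (0\<^sub>m 0 d) (0\<^sub>m 0 d') = 1\<^sub>m (d + d')"
    using A A' pA' p'A by (subst mult_four_block_mat[of _ d ?n _ 0 _ d' _ _ d _ d']) (auto simp: mat_mult_zero
      mat_add_zero)
  moreover have "four_block_mat A A' (0\<^sub>m 0 d) (0\<^sub>m 0 d') \<in> carrier_mat ?n (d + d')"
    using four_block_carrier_mat[of A ?n d "0\<^sub>m 0 d'" 0 d'] A(1) by simp
  moreover have "four_block_mat p (0\<^sub>m d 0) p' (0\<^sub>m d' 0) \<in> carrier_mat (d + d') ?n"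
    using four_block_carrier_mat[of p d ?n "0\<^sub>m d' 0" d' 0] A(2) by simp
  ultimately have le: "d + d' \<le> ?n" using left_inverse_le by metis
  obtain G where G: "G \<in> hom_D4 (dsum [?X, ?Y]) M"
    "(*\<^sub>v) A ` space ?X \<subseteq> (*\<^sub>v) G ` space (dsum [?X, ?Y])" "(*\<^sub>v) A' ` space ?Y \<subseteq> (*\<^sub>v) G ` space (dsum [?X, ?Y])"
    by (rule dsum_pair_hom[OF X(2) Y(2) D4_moduleD(1)[OF X(1)] D4_moduleD(1)[OF Y(1)] rM])
  note Gc = hom_D4D(1)[OF G(1)]
  have dD: "rdim (dsum [?X, ?Y]) = d + d'" by (simp add: dsum_rdim dX)
  have rD: "rep_carrier (dsum [?X, ?Y])" using D4_moduleD(1)[OF X(1)] D4_moduleD(1)[OF Y(1)]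
    by (intro rep_carrier_dsum) simp
  note LG = lin_subspaceD[OF lin_subspace_image[OF Gc]]
  have surj: "(*\<^sub>v) G ` space (dsum [?X, ?Y]) = space M"
  proof
    show "(*\<^sub>v) G ` space (dsum [?X, ?Y]) \<subseteq> space M" using LG(1) by blast
    show "space M \<subseteq> (*\<^sub>v) G ` space (dsum [?X, ?Y])"
    proof
      fix x assume x: "x \<in> space M"
      have "A *\<^sub>v (p *\<^sub>v x) \<in> (*\<^sub>v) G ` space (dsum [?X, ?Y])"
        by (rule subsetD[OF G(2)]) (use A x dX in auto)
      moreover have "A' *\<^sub>v (p' *\<^sub>v x) \<in> (*\<^sub>v) G ` space (dsum [?X, ?Y])"
        by (rule subsetD[OF G(3)]) (use A' x dX in auto)
      ultimately have "A *\<^sub>v (p *\<^sub>v x) + A' *\<^sub>v (p' *\<^sub>v x) \<in> (*\<^sub>v) G ` space (dsum [?X, ?Y])" by (rule LG(3))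
      moreover have "A *\<^sub>v (p *\<^sub>v x) + A' *\<^sub>v (p' *\<^sub>v x) = (A * p) *\<^sub>v x + (A' * p') *\<^sub>v x"
        using A(1,2) A'(1,2) x by (simp add: mat_mult_vec_assoc)
      moreover have "\<dots> = x" unfolding A(4) A'(4) F_def using Ec x
        by (simp add: mat_minus_vec mat_one_vec) (auto intro!: eq_vecI simp del: index_mult_mat_vec)
      ultimately show "x \<in> (*\<^sub>v) G ` space (dsum [?X, ?Y])" by simp
    qed
  qed
  obtain R where R: "R \<in> carrier_mat (d + d') ?n" "G * R = 1\<^sub>m ?n"
    by (rule surj_right_inverse[OF Gc surj, unfolded dD])
  have "?n \<le> d + d'" using left_inverse_le[OF R(1) _ R(2)] Gc dD by simp
  then have "rdim (dsum [?X, ?Y]) = ?n" using le dD by simp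
  from surj_hom_iso[OF G(1) this surj rD rM] have iso: "M \<cong>\<^sub>D dsum [?X, ?Y]" .
  have "rdim ?X = 0 \<or> rdim ?Y = 0"
    using M[unfolded indecomposable_def, THEN conjunct2, THEN conjunct2, rule_format, OF conjI[OF X(1) conjI[OF Y(1)
      iso]]] .
  then have "d = 0 \<or> d' = 0" unfolding dX .
  then show ?thesis
  proof
    assume d: "d = 0"
    have "E = 0\<^sub>m ?n ?n" unfolding A(4)[symmetric] using A(1,2) unfolding d
      by (intro eq_matI) (auto simp: scalar_prod_def)
    then show ?thesis ..
  next
    assume d': "d' = 0"
    have F0: "F = 0\<^sub>m ?n ?n" unfolding A'(4)[symmetric] using A'(1,2) unfolding d'
      by (intro eq_matI) (auto simp: scalar_prod_def)
    have "E = 1\<^sub>m ?n - F" unfolding F_def using Ec by (intro eq_matI) auto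
    then have "E = 1\<^sub>m ?n" unfolding F0 by (simp, intro eq_matI) auto
    then show ?thesis ..
  qed
qed

section \<open>Modules containing a copy of \<open>M_1\<close> lie in the block of the trivial
  module\<close>

lemma M_one_bc: "opb (M_one r \<eta>) * opc (M_one r \<eta>) = (1\<^sub>m 2 :: 'k::field mat)"
  "opc (M_one r \<eta>) \<in> carrier_mat 2 2" "opb (M_one r \<eta>) \<in> carrier_mat 2 2" "rdim (M_one r \<eta>) = 2"
proof -
  have *: "mat_of_rows_list 2 [[x, 0], [0, y]] * mat_of_rows_list 2 [[x, 0], [0, y]] = (1\<^sub>m 2 :: 'k mat)"
    if "x * x = 1" "y * y = 1" for x y
  proof -
    have "mat_of_rows_list 2 [[x, 0], [0, y]] = sparse 2 2 (\<lambda>i. if i = 0 then x else y) (\<lambda>i. i)"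
      by (rule eq_matI) (auto simp: mat_of_rows_list_def sparse_index less_2_cases_iff)
    then show ?thesis using that unfolding sparse_one by (auto simp: sparse_mult intro!: sparse_eqI)
  qed
  have op: "opb (M_one r \<eta>) = mat_of_rows_list 2 [[pow_neg1 (r + 1), 0], [0, pow_neg1 r :: 'k]]"
    "opc (M_one r \<eta>) = mat_of_rows_list 2 [[pow_neg1 (r + 1), 0], [0, pow_neg1 r :: 'k]]"
    and dim: "rdim (M_one r \<eta>) = 2"
    by (induct r \<eta> rule: M_one.induct) simp_all
  show "opb (M_one r \<eta>) * opc (M_one r \<eta>) = (1\<^sub>m 2 :: 'k mat)"
    unfolding op by (rule *; rule pow_neg1_square)
  show "opc (M_one r \<eta>) \<in> carrier_mat 2 2" "opb (M_one r \<eta>) \<in> carrier_mat 2 2" "rdim (M_one r \<eta>) = 2"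
    unfolding op dim by (rule carrier_matI; simp add: mat_of_rows_list_def)+ (rule refl)
qed

text \<open>\<open>b c\<close> is central of order two, so \<open>(1 + b c)/2\<close> is a central idempotent.\<close>

lemma block1_of_M_one:
  assumes two: "(2::'k::field) \<noteq> 0" and M: "indecomposable (M :: 'k rep)" and i: "i \<in> mono_D4 (M_one r \<eta>) M"
  shows "block1 M"
proof -
  let ?n = "rdim M" and ?z = "opb M * opc M"
  have Mm: "D4_module M" using M by (simp add: indecomposable_def)
  note D = D4_moduleD[OF Mm]
  have d: "dim_row (opa M) = ?n" "dim_col (opa M) = ?n" "dim_row (opb M) = ?n" "dim_col (opb M) = ?n"
    "dim_row (opc M) = ?n" "dim_col (opc M) = ?n" "dim_row (opd M) = ?n" "dim_col (opd M) = ?n"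
    using D(2-5) by auto
  have bd: "opb M * opd M = - (opd M * opb M)" "opc M * opd M = - (opd M * opc M)" unfolding D(7,9) by simp_all
  have zc: "?z \<in> carrier_mat ?n ?n" by (rule carrier_matI) (simp_all add: d)
  have zt: "?z * t M = t M * ?z" if t: "t \<in> gens" for t
  proof -
    consider "t = opa" | "t = opb" | "t = opc" | "t = opd" using t by (auto simp: gens_def)
    then show ?thesis
    proof cases
      case 1
      have "?z * opa M = opb M * (opc M * opa M)" using d by (simp add: mat_mult_assoc)
      also have "\<dots> = - ((opb M * opa M) * opc M)" unfolding D(8) using d by (simp add: mat_ring)
      also have "\<dots> = opa M * ?z" unfolding D(6) using d by (simp add: mat_ring)
      finally show ?thesis unfolding 1 .
    next
      case 2
      have "?z * opb M = opb M * (opc M * opb M)" using d by (simp add: mat_mult_assoc)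
      then show ?thesis unfolding 2 D(10) using d by (simp add: mat_mult_assoc)
    next
      case 3
      have "?z * opc M = (opc M * opb M) * opc M" unfolding D(10) ..
      then show ?thesis unfolding 3 using d by (simp add: mat_mult_assoc)
    next
      case 4
      have "?z * opd M = opb M * (opc M * opd M)" using d by (simp add: mat_mult_assoc)
      also have "\<dots> = - ((opb M * opd M) * opc M)" unfolding bd(2) using d by (simp add: mat_ring)
      also have "\<dots> = opd M * ?z" unfolding bd(1) using d by (simp add: mat_ring)
      finally show ?thesis unfolding 4 .
    qed
  qed
  have zz: "?z * ?z = 1\<^sub>m ?n"
  proof -
    have "?z * ?z = opb M * ((opc M * opb M) * opc M)" using d by (simp add: mat_mult_assoc)
    also have "\<dots> = (opb M * opb M) * (opc M * opc M)" unfolding D(10)[symmetric] using d by (simp add: mat_mult_assoc)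
    finally show ?thesis unfolding D(12,13) by simp
  qed
  define z where "z = ?z"
  have zc': "dim_row z = ?n" "dim_col z = ?n" using d by (simp_all add: z_def)
  define E where "E = (1/2) \<cdot>\<^sub>m (1\<^sub>m ?n + z)"
  have Ec: "E \<in> carrier_mat ?n ?n" unfolding E_def by (rule carrier_matI) (simp_all add: zc')
  have "E \<in> hom_D4 M M" unfolding hom_D4_iff
  proof (intro conjI ballI)
    fix t :: "'k rep \<Rightarrow> 'k mat" assume t: "t \<in> gens"
    show "E * t M = t M * E" unfolding E_def
      using zc' rep_carrierD[OF D(1) t] zt[OF t, folded z_def] by (simp add: mat_ring)
  qed (rule Ec)
  moreover have "E * E = E"
  proof -
    have "E * E = (1/2) \<cdot>\<^sub>m ((1/2) \<cdot>\<^sub>m (1\<^sub>m ?n + z) + (1/2) \<cdot>\<^sub>m (z + z * z))"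
      unfolding E_def using zc' by (simp add: mat_ring)
    also have "\<dots> = (1/2) \<cdot>\<^sub>m (1\<^sub>m ?n + z)" unfolding zz[folded z_def]
    proof (rule eq_matI)
      fix i j assume "i < dim_row ((1/2) \<cdot>\<^sub>m (1\<^sub>m ?n + z))" "j < dim_col ((1/2) \<cdot>\<^sub>m (1\<^sub>m ?n + z))"
      then have ij: "i < ?n" "j < ?n" using zc' by simp_all
      have half: "(1/2) * ((1/2) * (x + y) + (1/2) * (y + x)) = (1/2) * (x + y)" for x y :: 'k
      proof -
        have "(1/2) * u + (1/2) * u = u" for u :: 'k using two by (simp add: field_simps)
        then show ?thesis by (metis add.commute)
      qed
      show "((1/2) \<cdot>\<^sub>m ((1/2) \<cdot>\<^sub>m (1\<^sub>m ?n + z) + (1/2) \<cdot>\<^sub>m (z + 1\<^sub>m ?n))) $$ (i, j) = ((1/2) \<cdot>\<^sub>m (1\<^sub>m ?n + z)) $$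
        (i, j)"
        by (simp only: index_smult_mat index_add_mat index_one_mat(2,3) ij zc' half)
    qed (simp_all add: zc')
    finally show ?thesis unfolding E_def .
  qed
  ultimately consider "E = 0\<^sub>m ?n ?n" | "E = 1\<^sub>m ?n" using indecomposable_idempotent[OF M] by blast
  then show ?thesis
  proof cases
    case 1
    \<comment> \<open>In this case \<open>bc\<close> is \<open>- 1\<close> on \<open>M\<close>. On
      \<open>M_1\<close> it is \<open>1\<close>, so the embedding satisfies \<open>i = - i\<close>
      and vanishes, which contradicts injectivity.\<close>
    have zneg: "z = - 1\<^sub>m ?n"
    proof (rule eq_matI)
      fix j k assume jk: "j < dim_row (- 1\<^sub>m ?n :: 'k mat)" "k < dim_col (- 1\<^sub>m ?n :: 'k mat)"
      then have "E $$ (j, k) = 0" unfolding 1 by simp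
      then have "(1\<^sub>m ?n + z) $$ (j, k) = 0" using jk zc' two unfolding E_def by simp
      then show "z $$ (j, k) = (- 1\<^sub>m ?n) $$ (j, k)" using jk zc' by (auto simp: add_eq_0_iff)
    qed (simp_all add: zc')
    have ih: "i \<in> hom_D4 (M_one r \<eta>) M" using i by (simp add: mono_D4_def)
    note ic = hom_D4D(1)[OF ih, unfolded M_one_bc(4)]
    have ib: "i * opb (M_one r \<eta>) = opb M * i" "i * opc (M_one r \<eta>) = opc M * i" using ih by (auto simp: hom_D4_def)
    have "i = i * (opb (M_one r \<eta>) * opc (M_one r \<eta>))" unfolding M_one_bc(1) using ic by simp
    also have "\<dots> = (i * opb (M_one r \<eta>)) * opc (M_one r \<eta>)" using ic M_one_bc(2,3)[of r \<eta>] by (simp add: mat_mult_assoc)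
    also have "\<dots> = opb M * (i * opc (M_one r \<eta>))" unfolding ib(1) using ic d M_one_bc(2)[of r \<eta>]
      by (simp add: mat_mult_assoc)
    also have "\<dots> = z * i" unfolding ib(2) z_def using ic d by (simp add: mat_mult_assoc)
    also have "\<dots> = - i" unfolding zneg using ic by (simp add: mat_ring)
    finally have neg: "i = - i" .
    have i0: "i = 0\<^sub>m ?n 2"
    proof (rule eq_matI)
      fix j k assume jk: "j < dim_row (0\<^sub>m ?n 2 :: 'k mat)" "k < dim_col (0\<^sub>m ?n 2 :: 'k mat)"
      have "i $$ (j, k) = (- i) $$ (j, k)" by (rule arg_cong[OF neg, of "\<lambda>X. X $$ (j, k)"])
      also have "(- i) $$ (j, k) = - (i $$ (j, k))" using jk ic by simp
      finally have "2 * i $$ (j, k) = 0" by (simp only: mult_2 eq_neg_iff_add_eq_0)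
      then show "i $$ (j, k) = 0\<^sub>m ?n 2 $$ (j, k)" using two jk by simp
    qed (use ic in auto)
    have "inj_on ((*\<^sub>v) i) (carrier_vec 2)" using i M_one_bc(4)[of r \<eta>] by (simp add: mono_D4_def)
    moreover have "i *\<^sub>v unit_vec 2 0 = i *\<^sub>v 0\<^sub>v 2" unfolding i0 by (simp add: mat_vec_zero)
    ultimately have "unit_vec 2 0 = (0\<^sub>v 2 :: 'k vec)" by (auto dest: inj_onD)
    then have "(unit_vec 2 0 :: 'k vec) $ 0 = 0" by simp
    then show ?thesis by simp
  next
    case 2
    have z1: "z = 1\<^sub>m ?n"
    proof (rule eq_matI)
      fix j k assume jk: "j < dim_row (1\<^sub>m ?n :: 'k mat)" "k < dim_col (1\<^sub>m ?n :: 'k mat)"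
      have "E $$ (j, k) = 1\<^sub>m ?n $$ (j, k)" unfolding 2 ..
      then have "1\<^sub>m ?n $$ (j, k) + z $$ (j, k) = 2 * 1\<^sub>m ?n $$ (j, k)" using jk zc' two unfolding E_def
        by (simp add: field_simps)
      then show "z $$ (j, k) = 1\<^sub>m ?n $$ (j, k)" using jk by (auto split: if_splits)
    qed (simp_all add: zc')
    have "opc M = (opb M * opb M) * opc M" unfolding D(12) using d by simp
    also have "\<dots> = opb M * z" unfolding z_def using d by (simp add: mat_mult_assoc)
    also have "\<dots> = opb M" unfolding z1 using d by simp
    finally show ?thesis using Mm by (simp add: block1_def)
  qed
qed

section \<open>Radical and socle\<close>

text \<open>The product of \<open>U\<close> with the ideal generated by \<open>a\<close> and
  \<open>d\<close>, the augmentation ideal of the exterior algebra.\<close>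

definition augm :: "'k::field rep \<Rightarrow> 'k vec set \<Rightarrow> 'k vec set" where
  "augm M U = {opa M *\<^sub>v y + opd M *\<^sub>v z | y z. y \<in> U \<and> z \<in> U}"

lemma augmI: "y \<in> U \<Longrightarrow> z \<in> U \<Longrightarrow> opa M *\<^sub>v y + opd M *\<^sub>v z \<in> augm M U"
  by (auto simp: augm_def)

lemma block1_dims:
  assumes "block1 M"
  shows "opa M \<in> carrier_mat (rdim M) (rdim M)" "opb M \<in> carrier_mat (rdim M) (rdim M)" "opd M \<in> carrier_mat (rdim
    M) (rdim M)"
    "dim_row (opa M) = rdim M" "dim_col (opa M) = rdim M" "dim_row (opb M) = rdim M" "dim_col (opb M) = rdim M"
    "dim_row (opd M) = rdim M" "dim_col (opd M) = rdim M"
  using D4_moduleD(2-5)[of M] assms by (auto simp: block1_def)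

lemma block1_submoduleI:
  assumes "block1 M" "lin_subspace (rdim M) U"
    "\<And>u. u \<in> U \<Longrightarrow> opa M *\<^sub>v u \<in> U" "\<And>u. u \<in> U \<Longrightarrow> opb M *\<^sub>v u \<in> U" "\<And>u. u \<in> U \<Longrightarrow> opd M *\<^sub>v u \<in> U"
  shows "submodule_D4 M U"
  unfolding submodule_D4_iff using assms by (auto simp: gens_def block1_def)

lemma submodule_augm:
  assumes M: "block1 M" and U: "submodule_D4 M U"
  shows "submodule_D4 M (augm M U)" "augm M U \<subseteq> U"
proof -
  note LU = lin_subspaceD[OF submodule_D4D(1)[OF U]] and oU = submodule_D4D(2)[OF U]
  note d = block1_dims[OF M]
  show sub: "augm M U \<subseteq> U" using LU(3) oU gens_simps unfolding augm_def by blast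
  have neg: "- u \<in> U" if "u \<in> U" for u
  proof -
    have "(- 1) \<cdot>\<^sub>v u \<in> U" by (rule LU(4)[OF that])
    also have "(- 1) \<cdot>\<^sub>v u = - u" by (intro eq_vecI) auto
    finally show ?thesis .
  qed
  have av: "opa M *\<^sub>v y \<in> U" "opd M *\<^sub>v y \<in> U" "opb M *\<^sub>v y \<in> U" if "y \<in> U" for y
    using oU[OF gens_simps(1) that] oU[OF gens_simps(2) that] oU[OF gens_simps(4) that] by auto
  have dimU: "dim_vec u = rdim M" if "u \<in> U" for u using LU(1)[OF that] by simp
  show "submodule_D4 M (augm M U)"
  proof (rule block1_submoduleI[OF M])
    show "lin_subspace (rdim M) (augm M U)" unfolding lin_subspace_def
    proof (intro conjI ballI allI)
      show "augm M U \<subseteq> space M" using sub LU(1) by blast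
      have "opa M *\<^sub>v 0\<^sub>v (rdim M) + opd M *\<^sub>v 0\<^sub>v (rdim M) \<in> augm M U" by (rule augmI[OF LU(2) LU(2)])
      then show "0\<^sub>v (rdim M) \<in> augm M U" using d by (simp add: mat_vec_zero)
    next
      fix u v assume "u \<in> augm M U" "v \<in> augm M U"
      then obtain y z y' z' where yz: "y \<in> U" "z \<in> U" "y' \<in> U" "z' \<in> U" "u = opa M *\<^sub>v y + opd M *\<^sub>v z" "v = opa M
        *\<^sub>v y' + opd M *\<^sub>v z'"
        unfolding augm_def by blast
      have "opa M *\<^sub>v (y + y') + opd M *\<^sub>v (z + z') \<in> augm M U" by (rule augmI[OF LU(3) LU(3)]) (use yz in auto)
      moreover have "opa M *\<^sub>v (y + y') + opd M *\<^sub>v (z + z') = u + v"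
        unfolding yz(5,6) using d dimU[OF yz(1)] dimU[OF yz(2)] dimU[OF yz(3)] dimU[OF yz(4)]
        by (simp add: mat_vec_add) (intro eq_vecI; simp add: algebra_simps del: index_mult_mat_vec)
      ultimately show "u + v \<in> augm M U" by simp
    next
      fix k u assume "u \<in> augm M U"
      then obtain y z where yz: "y \<in> U" "z \<in> U" "u = opa M *\<^sub>v y + opd M *\<^sub>v z" unfolding augm_def by blast
      have "opa M *\<^sub>v (k \<cdot>\<^sub>v y) + opd M *\<^sub>v (k \<cdot>\<^sub>v z) \<in> augm M U" by (rule augmI[OF LU(4) LU(4)]) (use yz in auto)
      moreover have "opa M *\<^sub>v (k \<cdot>\<^sub>v y) + opd M *\<^sub>v (k \<cdot>\<^sub>v z) = k \<cdot>\<^sub>v u"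
        unfolding yz(3) using d dimU[OF yz(1)] dimU[OF yz(2)]
        by (simp add: mat_vec_smult) (intro eq_vecI; simp add: algebra_simps del: index_mult_mat_vec)
      ultimately show "k \<cdot>\<^sub>v u \<in> augm M U" by simp
    qed
  next
    fix u assume "u \<in> augm M U"
    then have u: "u \<in> U" using sub by blast
    have "opa M *\<^sub>v u + opd M *\<^sub>v 0\<^sub>v (rdim M) \<in> augm M U" "opa M *\<^sub>v 0\<^sub>v (rdim M) + opd M *\<^sub>v u \<in> augm M U"
      by (rule augmI[OF u LU(2)], rule augmI[OF LU(2) u])
    then show "opa M *\<^sub>v u \<in> augm M U" "opd M *\<^sub>v u \<in> augm M U"
      using d LU(1)[OF av(1)[OF u]] LU(1)[OF av(2)[OF u]] by (simp_all add: mat_vec_zero)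
  next
    fix u assume "u \<in> augm M U"
    then obtain y z where yz: "y \<in> U" "z \<in> U" "u = opa M *\<^sub>v y + opd M *\<^sub>v z" unfolding augm_def by blast
    \<comment> \<open>Moving \<open>b\<close> past \<open>a\<close> and \<open>d\<close> changes the
      sign, so \<open>b\<close> takes \<open>a y + d z\<close> to
      \<open>a (- b y) + d (- b z)\<close>.\<close>
    have "opa M *\<^sub>v (- (opb M *\<^sub>v y)) + opd M *\<^sub>v (- (opb M *\<^sub>v z)) \<in> augm M U"
      by (rule augmI[OF neg neg]) (use av yz in auto)
    moreover have "opa M *\<^sub>v (- (opb M *\<^sub>v y)) + opd M *\<^sub>v (- (opb M *\<^sub>v z)) = opb M *\<^sub>v u"
      unfolding yz(3) using d dimU[OF yz(1)] dimU[OF yz(2)] block1_vec(5)[OF M LU(1)[OF yz(1)]] block1_vec(6)[OF M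
        LU(1)[OF yz(2)]]
      by (simp add: mat_vec_add mat_vec_uminus)
    ultimately show "opb M *\<^sub>v u \<in> augm M U" by simp
  qed
qed

section \<open>Components for the two eigenvalues of \<open>b\<close>, and the radical of a
  submodule\<close>

lemma eigen_parts:
  assumes two: "(2::'k::field) \<noteq> 0" and M: "block1 (M :: 'k rep)" and x: "x \<in> space M" and s: "\<sigma> * \<sigma> = (1::'k)"
  defines "y \<equiv> (1/2) \<cdot>\<^sub>v (x + \<sigma> \<cdot>\<^sub>v (opb M *\<^sub>v x))"
  shows "opb M *\<^sub>v y = \<sigma> \<cdot>\<^sub>v y" "y \<in> space M"
proof -
  note d = block1_dims[OF M]
  have xd: "dim_vec x = rdim M" using x by simp
  show "y \<in> space M" unfolding y_def by (rule carrier_vecI) (simp add: xd d)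
  have ss: "\<sigma> * (\<sigma> * z) = z" for z using s by (simp add: mult.assoc[symmetric])
  have "opb M *\<^sub>v y = (1/2) \<cdot>\<^sub>v (opb M *\<^sub>v x + \<sigma> \<cdot>\<^sub>v x)"
    unfolding y_def using d xd block1_vec(4)[OF M x] by (simp add: mat_vec_smult mat_vec_add)
  also have "\<dots> = \<sigma> \<cdot>\<^sub>v y" unfolding y_def using d xd
    by (intro eq_vecI) (simp_all add: ss algebra_simps del: index_mult_mat_vec)
  finally show "opb M *\<^sub>v y = \<sigma> \<cdot>\<^sub>v y" .
qed

lemma submodule_eigen_parts:
  assumes "block1 M" "submodule_D4 M U" "x \<in> U"
  shows "(1/2) \<cdot>\<^sub>v (x + \<sigma> \<cdot>\<^sub>v (opb M *\<^sub>v x)) \<in> U"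
proof -
  note LU = lin_subspaceD[OF submodule_D4D(1)[OF assms(2)]] and oU = submodule_D4D(2)[OF assms(2)]
  show ?thesis by (intro LU(3,4) oU gens_simps assms(3))
qed

lemma eigen_parts_sum:
  assumes two: "(2::'k::field) \<noteq> 0" and M: "block1 (M :: 'k rep)" and x: "x \<in> space M"
  shows "x = (1/2) \<cdot>\<^sub>v (x + 1 \<cdot>\<^sub>v (opb M *\<^sub>v x)) + (1/2) \<cdot>\<^sub>v (x + (- 1) \<cdot>\<^sub>v (opb M *\<^sub>v x))"
  using x block1_dims[OF M] two by (intro eq_vecI) (simp_all add: field_simps del: index_mult_mat_vec)

text \<open>A hyperplane of \<open>U\<close> which contains \<open>a U + d U\<close> and is stable under \<open>b\<close> is a maximal submodule.\<close>

lemma rad_block1: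
  assumes two: "(2::'k::field) \<noteq> 0" and M: "block1 (M :: 'k rep)" and U: "submodule_D4 M U"
  shows "rad M U = augm M U"
proof
  note LU = lin_subspaceD[OF submodule_D4D(1)[OF U]] and oU = submodule_D4D(2)[OF U]
  note J = submodule_augm[OF M U]
  note LJ = lin_subspaceD[OF submodule_D4D(1)[OF J(1)]] and oJ = submodule_D4D(2)[OF J(1)]
  note d = block1_dims[OF M]
  have dimU: "dim_vec u = rdim M" if "u \<in> U" for u using LU(1)[OF that] by simp
  let ?n = "rdim M"
  show "augm M U \<subseteq> rad M U" unfolding rad_def
  proof (intro Int_greatest J(2) Inter_greatest)
    fix W assume "W \<in> {W. maximal_in M W U}"
    then have W: "submodule_D4 M W" "W \<subset> U" and max: "\<And>X. submodule_D4 M X \<Longrightarrow> W \<subset> X \<Longrightarrow> \<not> X \<subset> U"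
      by (auto simp: maximal_in_def)
    note LW = lin_subspaceD[OF submodule_D4D(1)[OF W(1)]] and oW = submodule_D4D(2)[OF W(1)]
    \<comment> \<open>\<open>X = W + (a U + d U)\<close> lies between \<open>W\<close> and
      \<open>U\<close>, so by maximality it is one of them. Nakayama's lemma excludes
      \<open>U\<close>, hence \<open>a U + d U\<close> is contained in \<open>W\<close>.\<close>
    define X where "X = {w + j | w j. w \<in> W \<and> j \<in> augm M U}"
    have XI: "w + j \<in> X" if "w \<in> W" "j \<in> augm M U" for w j using that by (auto simp: X_def)
    have "submodule_D4 M X" unfolding submodule_D4_iff lin_subspace_def
    proof (intro conjI ballI allI)
      show "X \<subseteq> space M" using LW(1) LJ(1) by (auto simp: X_def)
      show "0\<^sub>v ?n \<in> X" using XI[OF LW(2) LJ(2)] by simp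
    next
      fix u v assume "u \<in> X" "v \<in> X"
      then obtain w j w' j' where *: "w \<in> W" "w' \<in> W" "j \<in> augm M U" "j' \<in> augm M U" "u = w + j" "v = w' + j'"
        by (auto simp: X_def)
      have "(w + w') + (j + j') = u + v" unfolding *(5,6)
        using LW(1)[OF *(1)] LW(1)[OF *(2)] LJ(1)[OF *(3)] LJ(1)[OF *(4)]
        by (intro eq_vecI) auto
      then show "u + v \<in> X" using XI[OF LW(3)[OF *(1,2)] LJ(3)[OF *(3,4)]] by simp
    next
      fix k u assume "u \<in> X"
      then obtain w j where *: "w \<in> W" "j \<in> augm M U" "u = w + j" by (auto simp: X_def)
      have "k \<cdot>\<^sub>v w + k \<cdot>\<^sub>v j = k \<cdot>\<^sub>v u" unfolding *(3) using LW(1)[OF *(1)] LJ(1)[OF *(2)]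
        by (intro eq_vecI) (auto simp: distrib_left)
      then show "k \<cdot>\<^sub>v u \<in> X" using XI[OF LW(4)[OF *(1)] LJ(4)[OF *(2)]] by metis
    next
      fix t :: "'k rep \<Rightarrow> 'k mat" and u assume t: "t \<in> gens" and "u \<in> X"
      then obtain w j where *: "w \<in> W" "j \<in> augm M U" "u = w + j" by (auto simp: X_def)
      have "t M *\<^sub>v w + t M *\<^sub>v j = t M *\<^sub>v u" unfolding *(3)
        using LW(1)[OF *(1)] LJ(1)[OF *(2)] rep_carrierD[OF rep_carrier_block1[OF M] t] by (simp add: mat_vec_add)
      then show "t M *\<^sub>v u \<in> X" using XI[OF oW[OF t *(1)] oJ[OF t *(2)]] by simp
    qed
    moreover have "X \<subseteq> U" using W(2) J(2) LU(3) unfolding X_def by blast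
    moreover have WX: "W \<subseteq> X"
    proof
      fix w assume w: "w \<in> W"
      have "w + 0\<^sub>v ?n \<in> X" by (rule XI[OF w LJ(2)])
      then show "w \<in> X" using LW(1)[OF w] by simp
    qed
    moreover have "X \<noteq> U"
    proof
      assume XU: "X = U"
      have "U \<subseteq> W"
      proof (rule nakayama[OF M U W(1)])
        fix x assume "x \<in> U"
        then have "x \<in> X" using XU by simp
        then obtain w j where "w \<in> W" "j \<in> augm M U" "x = w + j" by (auto simp: X_def)
        then show "\<exists>w\<in>W. \<exists>y\<in>U. \<exists>z\<in>U. x = w + (opa M *\<^sub>v y + opd M *\<^sub>v z)" unfolding augm_def by blast
      qed
      then show False using W(2) by blast
    qed
    ultimately have "X = W" using max[of X] by blast
    moreover have "augm M U \<subseteq> X"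
    proof
      fix j assume j: "j \<in> augm M U"
      have "0\<^sub>v ?n + j \<in> X" by (rule XI[OF LW(2) j])
      then show "j \<in> X" using LJ(1)[OF j] by simp
    qed
    ultimately show "augm M U \<subseteq> W" by simp
  qed
  show "rad M U \<subseteq> augm M U"
  proof (rule ccontr)
    assume "\<not> rad M U \<subseteq> augm M U"
    then obtain x where xr: "x \<in> rad M U" and xJ: "x \<notin> augm M U" by blast
    have xU: "x \<in> U" using xr by (simp add: rad_def)
    have xc: "x \<in> space M" by (rule LU(1)[OF xU])
    let ?part = "\<lambda>\<sigma> u. (1/2) \<cdot>\<^sub>v (u + \<sigma> \<cdot>\<^sub>v (opb M *\<^sub>v u)) :: 'k vec"
    \<comment> \<open>One of the eigencomponents of \<open>x\<close> stays outside
      \<open>a U + d U\<close>. Working with an eigenvector makes it possible to choose a hyperplane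
      stable under \<open>b\<close>.\<close>
    have "?part 1 x \<notin> augm M U \<or> ?part (- 1) x \<notin> augm M U"
    proof (rule ccontr)
      assume "\<not> ?thesis"
      then have "?part 1 x + ?part (- 1) x \<in> augm M U" using LJ(3) by blast
      then show False using eigen_parts_sum[OF two M xc] xJ by simp
    qed
    then obtain \<sigma> where s: "\<sigma> * \<sigma> = 1" and part: "?part \<sigma> x \<notin> augm M U" by (metis mult_1 minus_mult_minus)
    define y where "y = ?part \<sigma> x"
    have opy: "opb M *\<^sub>v y = \<sigma> \<cdot>\<^sub>v y" and yc: "y \<in> space M" unfolding y_def using eigen_parts[OF two M xc s] by auto
    have yU: "y \<in> U" unfolding y_def by (rule submodule_eigen_parts[OF M U xU])
    obtain m A B where A: "A \<in> carrier_mat ?n m" and B: "B \<in> carrier_mat m ?n" and BA: "B * A = 1\<^sub>m m"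
      and im: "(*\<^sub>v) A ` carrier_vec m = augm M U" using lin_subspace_split[OF submodule_D4D(1)[OF J(1)]] by metis
    define E where "E = 1\<^sub>m ?n - A * B"
    have Ec: "E \<in> carrier_mat ?n ?n" unfolding E_def using A B by (simp add: minus_carrier_mat)
    have EJ: "E *\<^sub>v j = 0\<^sub>v ?n" if j: "j \<in> augm M U" for j
    proof -
      obtain z where z: "z \<in> carrier_vec m" "j = A *\<^sub>v z" using j unfolding im[symmetric] by auto
      have "E *\<^sub>v j = A *\<^sub>v z - A *\<^sub>v ((B * A) *\<^sub>v z)" unfolding z(2) E_def using A B z(1) by (simp add: mat_vec)
      then show ?thesis unfolding BA using A z(1) by (simp add: mat_one_vec)
    qed
    have "E *\<^sub>v y \<noteq> 0\<^sub>v ?n"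
    proof
      assume "E *\<^sub>v y = 0\<^sub>v ?n"
      then have z: "y - A *\<^sub>v (B *\<^sub>v y) = 0\<^sub>v ?n" unfolding E_def using A B yc by (simp add: mat_vec)
      have "y = A *\<^sub>v (B *\<^sub>v y)"
      proof (rule eq_vecI)
        fix i assume "i < dim_vec (A *\<^sub>v (B *\<^sub>v y))"
        then have i: "i < ?n" using A by simp
        have "(y - A *\<^sub>v (B *\<^sub>v y)) $ i = 0" unfolding z using i by simp
        then show "y $ i = (A *\<^sub>v (B *\<^sub>v y)) $ i" using i A by (simp del: index_mult_mat_vec)
      qed (use A yc in simp)
      moreover have "A *\<^sub>v (B *\<^sub>v y) \<in> augm M U" unfolding im[symmetric] using B yc by simp
      ultimately show False using part unfolding y_def[symmetric] by simp
    qed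
    have "\<exists>k<?n. (E *\<^sub>v y) $ k \<noteq> 0"
    proof (rule ccontr)
      assume *: "\<not> ?thesis"
      have "E *\<^sub>v y = 0\<^sub>v ?n"
        by (rule eq_vecI) (use * Ec in \<open>auto simp del: index_mult_mat_vec\<close>)
      then show False using \<open>E *\<^sub>v y \<noteq> 0\<^sub>v ?n\<close> by simp
    qed
    then obtain k where k: "k < ?n" "(E *\<^sub>v y) $ k \<noteq> 0" by blast
    \<comment> \<open>A functional that takes the component for \<open>\<sigma>\<close>, applies a
      linear projection killing \<open>a U + d U\<close>, and reads a coordinate which is nonzero at
      \<open>y\<close>. It is an eigenvector for \<open>b\<close>, so its kernel in \<open>U\<close>
      is \<open>b\<close>-stable; as \<open>x\<close> has component \<open>y\<close>, it does not
      vanish at \<open>x\<close>.\<close>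
    define \<phi> where "\<phi> u = (E *\<^sub>v ?part \<sigma> u) $ k" for u
    have \<phi>_add: "\<phi> (u + v) = \<phi> u + \<phi> v" and \<phi>_smult: "\<phi> (c \<cdot>\<^sub>v u) = c * \<phi> u"
      if "u \<in> U" "v \<in> U" for u v c
    proof -
      note uv = dimU[OF that(1)] dimU[OF that(2)]
      have "?part \<sigma> (u + v) = ?part \<sigma> u + ?part \<sigma> v"
        using uv d by (simp add: mat_vec_add) (intro eq_vecI; simp add: algebra_simps del: index_mult_mat_vec)
      then show "\<phi> (u + v) = \<phi> u + \<phi> v" unfolding \<phi>_def using Ec uv d k(1)
        by (simp add: mat_vec_add del: index_mult_mat_vec)
      have "?part \<sigma> (c \<cdot>\<^sub>v u) = c \<cdot>\<^sub>v ?part \<sigma> u"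
        using uv d by (simp add: mat_vec_smult) (intro eq_vecI; simp add: algebra_simps del: index_mult_mat_vec)
      then show "\<phi> (c \<cdot>\<^sub>v u) = c * \<phi> u" unfolding \<phi>_def using Ec uv d k(1)
        by (simp add: mat_vec_smult del: index_mult_mat_vec)
    qed
    have ss: "\<sigma> * (\<sigma> * z) = z" for z using s by (simp add: mult.assoc[symmetric])
    have \<phi>_b: "\<phi> (opb M *\<^sub>v u) = \<sigma> * \<phi> u" if u: "u \<in> U" for u
    proof -
      have "?part \<sigma> (opb M *\<^sub>v u) = \<sigma> \<cdot>\<^sub>v ?part \<sigma> u"
        using dimU[OF u] d block1_vec(4)[OF M LU(1)[OF u]]
          by (intro eq_vecI) (simp_all add: ss algebra_simps del: index_mult_mat_vec)
      then show ?thesis unfolding \<phi>_def using Ec dimU[OF u] d k(1) by (simp add: mat_vec_smult del: index_mult_mat_vec)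
    qed
    have \<phi>_J: "\<phi> j = 0" if j: "j \<in> augm M U" for j
      unfolding \<phi>_def EJ[OF submodule_eigen_parts[OF M J(1) j]] using k(1) by simp
    define W where "W = {u \<in> U. \<phi> u = 0}"
    have LWs: "lin_subspace ?n W" unfolding lin_subspace_def
    proof (intro conjI ballI allI)
      show "W \<subseteq> space M" using LU(1) by (auto simp: W_def)
      show "0\<^sub>v ?n \<in> W" using LU(2) \<phi>_J[OF LJ(2)] by (simp add: W_def)
      fix u v assume "u \<in> W" "v \<in> W" then show "u + v \<in> W" using LU(3) \<phi>_add by (simp add: W_def)
    next
      fix c u assume "u \<in> W" then show "c \<cdot>\<^sub>v u \<in> W" using LU(4) \<phi>_smult[of u u c] by (simp add: W_def)
    qed
    have JW: "augm M U \<subseteq> W" using J(2) \<phi>_J by (auto simp: W_def)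
    have aJ: "opa M *\<^sub>v u \<in> augm M U" "opd M *\<^sub>v u \<in> augm M U" if u: "u \<in> U" for u
    proof -
      have "opa M *\<^sub>v u + opd M *\<^sub>v 0\<^sub>v ?n \<in> augm M U" "opa M *\<^sub>v 0\<^sub>v ?n + opd M *\<^sub>v u \<in> augm M U"
        by (rule augmI[OF u LU(2)], rule augmI[OF LU(2) u])
      then show "opa M *\<^sub>v u \<in> augm M U" "opd M *\<^sub>v u \<in> augm M U"
        using LU(1)[OF oU[OF gens_simps(1) u]] LU(1)[OF oU[OF gens_simps(4) u]] d by (simp_all add: mat_vec_zero)
    qed
    have Ws: "submodule_D4 M W"
    proof (rule block1_submoduleI[OF M LWs])
      fix u assume u: "u \<in> W"
      then have uU: "u \<in> U" by (simp add: W_def)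
      show "opa M *\<^sub>v u \<in> W" "opd M *\<^sub>v u \<in> W" using aJ[OF uU] JW by auto
      show "opb M *\<^sub>v u \<in> W" using u \<phi>_b[OF uU] oU[OF gens_simps(2) uU] by (simp add: W_def)
    qed
    have \<phi>y: "\<phi> y \<noteq> 0"
    proof -
      have "?part \<sigma> y = y" unfolding opy using dimU[OF yU] two by (intro eq_vecI) (simp_all add: ss field_simps)
      then show ?thesis unfolding \<phi>_def using k(2) by simp
    qed
    have "maximal_in M W U" unfolding maximal_in_def
    proof (intro conjI Ws U notI)
      show "W \<subset> U" using \<phi>y yU by (auto simp: W_def)
      assume "\<exists>X. submodule_D4 M X \<and> W \<subset> X \<and> X \<subset> U"
      then obtain X where X: "submodule_D4 M X" "W \<subset> X" "X \<subset> U" by blast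
      note LX = lin_subspaceD[OF submodule_D4D(1)[OF X(1)]]
      obtain u where u: "u \<in> X" "u \<notin> W" using X(2) by blast
      then have uU: "u \<in> U" and \<phi>u: "\<phi> u \<noteq> 0" using X(3) by (auto simp: W_def)
      \<comment> \<open>Modulo the kernel of the functional, every \<open>v\<close> in
        \<open>U\<close> is a multiple of \<open>u\<close>, so nothing fits strictly between a
        hyperplane and \<open>U\<close>.\<close>
      have "U \<subseteq> X"
      proof
        fix v assume v: "v \<in> U"
        define c where "c = \<phi> v / \<phi> u"
        have wU: "v + (- c) \<cdot>\<^sub>v u \<in> U" by (rule LU(3)[OF v LU(4)[OF uU]])
        have "\<phi> (v + (- c) \<cdot>\<^sub>v u) = \<phi> v + (- c) * \<phi> u"
          using \<phi>_add[OF v LU(4)[OF uU]] \<phi>_smult[OF uU uU] by simp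
        also have "\<dots> = 0" using \<phi>u by (simp add: c_def)
        finally have "v + (- c) \<cdot>\<^sub>v u \<in> X" using wU X(2) by (auto simp: W_def)
        then have "(v + (- c) \<cdot>\<^sub>v u) + c \<cdot>\<^sub>v u \<in> X" by (rule LX(3)[OF _ LX(4)[OF u(1)]])
        also have "(v + (- c) \<cdot>\<^sub>v u) + c \<cdot>\<^sub>v u = v" using dimU[OF v] dimU[OF uU] by (intro eq_vecI) auto
        finally show "v \<in> X" .
      qed
      then show False using X(3) by blast
    qed
    then have "x \<in> W" using xr by (simp add: rad_def)
    then have "\<phi> x = 0" by (simp add: W_def)
    moreover have "\<phi> x = \<phi> y"
    proof -
      have "?part \<sigma> y = y" unfolding opy using dimU[OF yU] two by (intro eq_vecI) (simp_all add: ss field_simps)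
      then show ?thesis unfolding \<phi>_def y_def[symmetric] by simp
    qed
    ultimately show False using \<phi>y by simp
  qed
qed

text \<open>The vector \<open>a d x\<close> lies in the second radical power, which vanishes at
  Loewy length 2.\<close>

lemma loewy_two:
  assumes two: "(2::'k::field) \<noteq> 0" and M: "block1 (M :: 'k rep)" and L: "loewy_length M = 2" and x: "x \<in> space M"
  shows "opa M *\<^sub>v (opd M *\<^sub>v x) = 0\<^sub>v (rdim M)"
proof -
  let ?n = "rdim M"
  note d = block1_dims[OF M]
  define J0 where "J0 = space M"
  define J1 where "J1 = augm M J0"
  define J2 where "J2 = augm M J1"
  define J3 where "J3 = augm M J2"
  have s0: "submodule_D4 M J0" unfolding J0_def by (rule submodule_D4_space[OF rep_carrier_block1[OF M]])
  have s1: "submodule_D4 M J1" unfolding J1_def by (rule submodule_augm(1)[OF M s0])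
  have s2: "submodule_D4 M J2" unfolding J2_def by (rule submodule_augm(1)[OF M s1])
  have s3: "submodule_D4 M J3" unfolding J3_def by (rule submodule_augm(1)[OF M s2])
  have r: "rad M J0 = J1" "rad M J1 = J2" "rad M J2 = J3"
    using rad_block1[OF two M s0] rad_block1[OF two M s1] rad_block1[OF two M s2] by (auto simp: J1_def J2_def J3_def)
  have mv: "opa M *\<^sub>v v \<in> space M" "opd M *\<^sub>v v \<in> space M" if "v \<in> space M" for v using d(1,3) that by auto
  have kill1: "opa M *\<^sub>v (opd M *\<^sub>v u) = 0\<^sub>v ?n" if u: "u \<in> J1" for u
  proof -
    obtain y z where yz: "y \<in> space M" "z \<in> space M" "u = opa M *\<^sub>v y + opd M *\<^sub>v z" using u
      unfolding J1_def J0_def augm_def by blast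
    note m = mv[OF yz(1)] mv[OF yz(2)]
    have "opd M *\<^sub>v u = - (opa M *\<^sub>v (opd M *\<^sub>v y)) + 0\<^sub>v ?n"
      unfolding yz(3) using block1_vec(3)[OF M yz(1)] block1_vec(2)[OF M yz(2)] m d by (simp add: mat_vec_add)
    also have "\<dots> = - (opa M *\<^sub>v (opd M *\<^sub>v y))" using d by (intro eq_vecI) auto
    finally have "opa M *\<^sub>v (opd M *\<^sub>v u) = - (opa M *\<^sub>v (opa M *\<^sub>v (opd M *\<^sub>v y)))" using d
      by (simp add: mat_vec_uminus)
    also have "\<dots> = 0\<^sub>v ?n" unfolding block1_vec(1)[OF M m(2)] by (intro eq_vecI) auto
    finally show ?thesis .
  qed
  have kill2: "opa M *\<^sub>v u = 0\<^sub>v ?n" "opd M *\<^sub>v u = 0\<^sub>v ?n" if u: "u \<in> J2" for u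
  proof -
    obtain y z where yz: "y \<in> J1" "z \<in> J1" "u = opa M *\<^sub>v y + opd M *\<^sub>v z" using u unfolding J2_def augm_def by blast
    have c: "y \<in> space M" "z \<in> space M" using yz(1,2) lin_subspaceD(1)[OF submodule_D4D(1)[OF s1]] by auto
    note m = mv[OF c(1)] mv[OF c(2)]
    have "opa M *\<^sub>v u = 0\<^sub>v ?n + 0\<^sub>v ?n"
      unfolding yz(3) using block1_vec(1)[OF M c(1)] kill1[OF yz(2)] m d by (simp add: mat_vec_add)
    then show "opa M *\<^sub>v u = 0\<^sub>v ?n" by simp
    have "opd M *\<^sub>v u = - 0\<^sub>v ?n + 0\<^sub>v ?n"
      unfolding yz(3) using block1_vec(3)[OF M c(1)] block1_vec(2)[OF M c(2)] kill1[OF yz(1)] m d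
        by (simp add: mat_vec_add)
    also have "\<dots> = 0\<^sub>v ?n" by (intro eq_vecI) auto
    finally show "opd M *\<^sub>v u = 0\<^sub>v ?n" .
  qed
  have "J3 = zero_space M"
  proof
    show "J3 \<subseteq> zero_space M"
    proof
      fix u assume "u \<in> J3"
      then obtain y z where "y \<in> J2" "z \<in> J2" "u = opa M *\<^sub>v y + opd M *\<^sub>v z" unfolding J3_def augm_def by blast
      then show "u \<in> zero_space M" using kill2 by simp
    qed
  qed (use lin_subspaceD(2)[OF submodule_D4D(1)[OF s3]] in simp)
  \<comment> \<open>The third radical power vanishes for every module of the block. This witness is
    required before the minimum in \<open>loewy_length\<close> can be used.\<close>
  then have "(rad M ^^ 3) (space M) = zero_space M" using r by (simp add: numeral_3_eq_3 J0_def)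
  then have "(rad M ^^ loewy_length M) (space M) = zero_space M" unfolding loewy_length_def by (rule LeastI)
  then have J2: "J2 = zero_space M" unfolding L using r by (simp add: numeral_2_eq_2 J0_def)
  have z: "0\<^sub>v ?n \<in> space M" by simp
  have "opa M *\<^sub>v 0\<^sub>v ?n + opd M *\<^sub>v x \<in> J1" unfolding J1_def by (rule augmI) (use x in \<open>auto simp: J0_def\<close>)
  then have dx: "opd M *\<^sub>v x \<in> J1" using mv[OF x] d by (simp add: mat_vec_zero)
  have "opa M *\<^sub>v (opd M *\<^sub>v x) + opd M *\<^sub>v 0\<^sub>v ?n \<in> J2"
    unfolding J2_def by (rule augmI[OF dx lin_subspaceD(2)[OF submodule_D4D(1)[OF s1]]])
  then show ?thesis unfolding J2 using mv[OF mv(2)[OF x]] d by (simp add: mat_vec_zero)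
qed

text \<open>The common kernel of \<open>a\<close> and \<open>d\<close> is a submodule that meets
  every nonzero submodule, so each simple submodule is contained in it. Conversely, it is spanned by
  eigenvectors of \<open>b\<close>, and each nonzero one spans a simple submodule.\<close>

lemma soc_block1:
  assumes two: "(2::'k::field) \<noteq> 0" and M: "block1 (M :: 'k rep)"
  shows "soc M = {x \<in> space M. opa M *\<^sub>v x = 0\<^sub>v (rdim M) \<and> opd M *\<^sub>v x = 0\<^sub>v (rdim M)}" (is "_ = ?K")
proof
  let ?n = "rdim M"
  note d = block1_dims[OF M]
  define K where "K = ?K"
  have neg0: "- 0\<^sub>v ?n = (0\<^sub>v ?n :: 'k vec)" by (intro eq_vecI) auto
  have mv: "opa M *\<^sub>v v \<in> space M" "opd M *\<^sub>v v \<in> space M" "opb M *\<^sub>v v \<in> space M" if "v \<in> space M" for v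
    using d(1-3) that by auto
  have K: "submodule_D4 M K"
  proof (rule block1_submoduleI[OF M])
    show "lin_subspace ?n K" unfolding lin_subspace_def
    proof (intro conjI ballI allI)
      show "K \<subseteq> space M" "0\<^sub>v ?n \<in> K" using d by (auto simp: K_def mat_vec_zero)
      fix u v assume "u \<in> K" "v \<in> K" then show "u + v \<in> K" using d by (auto simp: K_def mat_vec_add)
    next
      fix k u assume "u \<in> K" then show "k \<cdot>\<^sub>v u \<in> K" using d by (auto simp: K_def mat_vec_smult)
    qed
    fix u assume "u \<in> K"
    then have u: "u \<in> space M" "opa M *\<^sub>v u = 0\<^sub>v ?n" "opd M *\<^sub>v u = 0\<^sub>v ?n" by (auto simp: K_def)
    show "opa M *\<^sub>v u \<in> K" "opd M *\<^sub>v u \<in> K" unfolding u(2,3) using d by (auto simp: K_def mat_vec_zero)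
    have "- (opa M *\<^sub>v (opb M *\<^sub>v u)) = 0\<^sub>v ?n" "- (opd M *\<^sub>v (opb M *\<^sub>v u)) = 0\<^sub>v ?n"
      unfolding block1_vec(5,6)[OF M u(1), symmetric] u(2,3) using d by (simp_all add: mat_vec_zero)
    then have "opa M *\<^sub>v (opb M *\<^sub>v u) = - 0\<^sub>v ?n" "opd M *\<^sub>v (opb M *\<^sub>v u) = - 0\<^sub>v ?n" by (metis uminus_uminus_vec)+
    then show "opb M *\<^sub>v u \<in> K" unfolding neg0 using mv(3)[OF u(1)] by (simp add: K_def)
  qed
  \<comment> \<open>If the intersection were zero, then for \<open>u\<close> in \<open>X\<close> the
    vectors \<open>a d u\<close>, \<open>d u\<close>, \<open>a u\<close> and \<open>u\<close> would
    vanish in this order, each being killed by \<open>a\<close> and \<open>d\<close> once the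
    earlier ones are zero.\<close>
  have inK: "X \<inter> K \<noteq> zero_space M" if X: "submodule_D4 M X" "X \<noteq> zero_space M" for X
  proof
    assume 0: "X \<inter> K = zero_space M"
    note LX = lin_subspaceD[OF submodule_D4D(1)[OF X(1)]] and oX = submodule_D4D(2)[OF X(1)]
    obtain u where u: "u \<in> X" "u \<noteq> 0\<^sub>v ?n" using X(2) LX(2) by blast
    note uc = LX(1)[OF u(1)]
    note aX = oX[OF gens_simps(1)] and dX = oX[OF gens_simps(4)]
    have z: "v = 0\<^sub>v ?n" if "v \<in> X" "opa M *\<^sub>v v = 0\<^sub>v ?n" "opd M *\<^sub>v v = 0\<^sub>v ?n" for v
    proof -
      have "v \<in> X \<inter> K" using that LX(1) by (simp add: K_def)
      then show ?thesis unfolding 0 by simp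
    qed
    note m = mv[OF uc] mv[OF mv(2)[OF uc]]
    have "opd M *\<^sub>v (opa M *\<^sub>v (opd M *\<^sub>v u)) = - (opa M *\<^sub>v (opd M *\<^sub>v (opd M *\<^sub>v u)))"
      by (rule block1_vec(3)[OF M m(2)])
    also have "\<dots> = 0\<^sub>v ?n" unfolding block1_vec(2)[OF M uc] using d neg0 by (simp add: mat_vec_zero)
    finally have 1: "opa M *\<^sub>v (opd M *\<^sub>v u) = 0\<^sub>v ?n"
      using z[OF aX[OF dX[OF u(1)]] block1_vec(1)[OF M m(2)]] by blast
    then have 2: "opd M *\<^sub>v u = 0\<^sub>v ?n" using z[OF dX[OF u(1)] _ block1_vec(2)[OF M uc]] by blast
    have "opd M *\<^sub>v (opa M *\<^sub>v u) = 0\<^sub>v ?n" unfolding block1_vec(3)[OF M uc] 1 neg0 ..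
    then have "opa M *\<^sub>v u = 0\<^sub>v ?n" using z[OF aX[OF u(1)] block1_vec(1)[OF M uc]] by blast
    then show False using z[OF u(1) _ 2] u(2) by blast
  qed
  have "soc M \<subseteq> K" unfolding soc_def
  proof (rule Inter_lower, intro CollectI conjI allI impI K)
    fix U assume U: "simple_submodule M U"
    then have Us: "submodule_D4 M U" "U \<noteq> zero_space M" by (auto simp: simple_submodule_def)
    have "submodule_D4 M (U \<inter> K)"
      using Us(1) K unfolding submodule_D4_def by blast
    then have "U \<inter> K = zero_space M \<or> U \<inter> K = U" using U unfolding simple_submodule_def by blast
    then show "U \<subseteq> K" using inK[OF Us] by blast
  qed
  then show "soc M \<subseteq> ?K" unfolding K_def .
  have "K \<subseteq> soc M" unfolding soc_def
  proof (rule Inter_greatest)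
    fix X assume "X \<in> {X. submodule_D4 M X \<and> (\<forall>U. simple_submodule M U \<longrightarrow> U \<subseteq> X)}"
    then have X: "submodule_D4 M X" and all: "\<And>U. simple_submodule M U \<Longrightarrow> U \<subseteq> X" by auto
    note LX = lin_subspaceD[OF submodule_D4D(1)[OF X]]
    have eig: "y \<in> X" if y: "y \<in> K" "opb M *\<^sub>v y = \<sigma> \<cdot>\<^sub>v y" for y \<sigma>
    proof (cases "y = 0\<^sub>v ?n")
      case False
      have yc: "y \<in> space M" "opa M *\<^sub>v y = 0\<^sub>v ?n" "opd M *\<^sub>v y = 0\<^sub>v ?n" using y(1) by (auto simp: K_def)
      define L where "L = range (\<lambda>k. k \<cdot>\<^sub>v y)"
      have LI: "k \<cdot>\<^sub>v y \<in> L" for k by (simp add: L_def)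
      have zL: "0\<^sub>v ?n \<in> L"
      proof -
        have "0\<^sub>v ?n = 0 \<cdot>\<^sub>v y" using yc by (intro eq_vecI) auto
        then show ?thesis using LI by metis
      qed
      have Ls: "submodule_D4 M L"
      proof (rule block1_submoduleI[OF M])
        show "lin_subspace ?n L" unfolding lin_subspace_def
        proof (intro conjI ballI allI)
          show "L \<subseteq> space M" using yc by (auto simp: L_def)
          fix u v assume "u \<in> L" "v \<in> L"
          then obtain k l where "u = k \<cdot>\<^sub>v y" "v = l \<cdot>\<^sub>v y" by (auto simp: L_def)
          then have "u + v = (k + l) \<cdot>\<^sub>v y" by (intro eq_vecI) (auto simp: distrib_right)
          then show "u + v \<in> L" using LI by metis
        next
          fix c u assume "u \<in> L"
          then obtain k where "u = k \<cdot>\<^sub>v y" by (auto simp: L_def)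
          then have "c \<cdot>\<^sub>v u = (c * k) \<cdot>\<^sub>v y" by (simp add: smult_smult_assoc)
          then show "c \<cdot>\<^sub>v u \<in> L" using LI by metis
        qed (rule zL)
        fix u assume "u \<in> L"
        then obtain k where u: "u = k \<cdot>\<^sub>v y" by (auto simp: L_def)
        have k0: "k \<cdot>\<^sub>v 0\<^sub>v ?n = (0\<^sub>v ?n :: 'k vec)" by (intro eq_vecI) auto
        show "opa M *\<^sub>v u \<in> L" "opd M *\<^sub>v u \<in> L" unfolding u using yc d zL k0 by (simp_all add: mat_vec_smult)
        have "opb M *\<^sub>v u = (k * \<sigma>) \<cdot>\<^sub>v y" unfolding u using yc d y(2) by (simp add: mat_vec_smult smult_smult_assoc)
        then show "opb M *\<^sub>v u \<in> L" using LI by metis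
      qed
      have yL: "y \<in> L" using LI[of 1] by simp
      have "simple_submodule M L" unfolding simple_submodule_def
      proof (intro conjI allI impI Ls)
        show "L \<noteq> zero_space M" using yL False by blast
        fix Y assume Y: "submodule_D4 M Y \<and> Y \<subseteq> L"
        note LY = lin_subspaceD[OF submodule_D4D(1)[OF Y[THEN conjunct1]]]
        show "Y = zero_space M \<or> Y = L"
        proof (cases "Y \<subseteq> zero_space M")
          case True then show ?thesis using LY(2) by blast
        next
          case F: False
          then obtain u where u: "u \<in> Y" "u \<noteq> 0\<^sub>v ?n" by blast
          then obtain k where k: "u = k \<cdot>\<^sub>v y" using Y by (auto simp: L_def)
          have "k \<noteq> 0"
          proof
            assume "k = 0"
            then have "u = 0\<^sub>v ?n" unfolding k using yc by (intro eq_vecI) auto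
            then show False using u by simp
          qed
          have "L \<subseteq> Y"
          proof
            fix v assume "v \<in> L"
            then obtain l where v: "v = l \<cdot>\<^sub>v y" by (auto simp: L_def)
            have "(l / k) \<cdot>\<^sub>v u \<in> Y" by (rule LY(4)[OF u(1)])
            then show "v \<in> Y" unfolding v k using \<open>k \<noteq> 0\<close> by (simp add: smult_smult_assoc)
          qed
          then show ?thesis using Y by blast
        qed
      qed
      then show ?thesis using all yL by blast
    qed (use LX(2) in simp)
    show "K \<subseteq> X"
    proof
      fix x assume x: "x \<in> K"
      have xc: "x \<in> space M" using x by (simp add: K_def)
      have "(1/2) \<cdot>\<^sub>v (x + 1 \<cdot>\<^sub>v (opb M *\<^sub>v x)) \<in> X"
        by (rule eig[OF submodule_eigen_parts[OF M K x] eigen_parts(1)[OF two M xc]]) simp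
      moreover have "(1/2) \<cdot>\<^sub>v (x + (- 1) \<cdot>\<^sub>v (opb M *\<^sub>v x)) \<in> X"
        by (rule eig[OF submodule_eigen_parts[OF M K x] eigen_parts(1)[OF two M xc]]) simp
      ultimately have "(1/2) \<cdot>\<^sub>v (x + 1 \<cdot>\<^sub>v (opb M *\<^sub>v x)) + (1/2) \<cdot>\<^sub>v (x + (- 1) \<cdot>\<^sub>v (opb M *\<^sub>v x)) \<in> X"
        by (rule LX(3))
      then show "x \<in> X" unfolding eigen_parts_sum[OF two M xc, symmetric] .
    qed
  qed
  then show "?K \<subseteq> soc M" unfolding K_def .
qed

section \<open>Lengths\<close>

lemma full_split_dim:
  fixes A B :: "'k::field mat"
  assumes A: "A \<in> carrier_mat n d" and B: "B \<in> carrier_mat d n" and BA: "B * A = 1\<^sub>m d"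
    and full: "(*\<^sub>v) A ` carrier_vec d = carrier_vec n"
  shows "d = n"
proof -
  have "bij_betw ((*\<^sub>v) A) (carrier_vec d) (carrier_vec n)"
    using left_inverse_inj[OF A B BA] full by (simp add: bij_betw_def)
  then show ?thesis by (rule bij_inverse[OF A])
qed

text \<open>On a module where every generator acts by a scalar each linear subspace is a submodule,
  so a composition series grows by exactly one dimension at each step. The dimension is tracked by
  the number of columns of a split injection.\<close>

lemma scalar_has_length:
  assumes zero: "opa (S :: 'k::field rep) = 0\<^sub>m (rdim S) (rdim S)" "opd S = 0\<^sub>m (rdim S) (rdim S)"
    and scal: "opb S = \<sigma> \<cdot>\<^sub>m 1\<^sub>m (rdim S)" "opc S = \<sigma> \<cdot>\<^sub>m 1\<^sub>m (rdim S)"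
    and len: "has_length S t"
  shows "rdim S = t"
proof -
  let ?n = "rdim S"
  obtain F where F0: "F 0 = zero_space S" and Ft: "F t = space S" and step: "\<And>i. i < t \<Longrightarrow> maximal_in S (F i) (F (Suc i))"
    using len unfolding has_length_def by blast
  have sub: "submodule_D4 S X" if X: "lin_subspace ?n X" for X
    unfolding submodule_D4_iff
  proof (intro conjI X ballI)
    note LX = lin_subspaceD[OF X]
    fix t :: "'k rep \<Rightarrow> 'k mat" and u assume t: "t \<in> gens" and u: "u \<in> X"
    have uc: "dim_vec u = ?n" using LX(1)[OF u] by simp
    have "0\<^sub>m ?n ?n *\<^sub>v u = 0\<^sub>v ?n" "(\<sigma> \<cdot>\<^sub>m 1\<^sub>m ?n) *\<^sub>v u = \<sigma> \<cdot>\<^sub>v u" using uc by (simp_all add: mat_vec)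
    then show "t S *\<^sub>v u \<in> X" using t LX(2) LX(4)[OF u] by (auto simp: gens_def zero scal)
  qed
  have "i \<le> t \<Longrightarrow> \<exists>A B. A \<in> carrier_mat ?n i \<and> B \<in> carrier_mat i ?n \<and> B * A = 1\<^sub>m i \<and> (*\<^sub>v) A ` carrier_vec i = F i" for i
  proof (induction i)
    case 0
    show ?case
    proof (intro exI conjI)
      show "0\<^sub>m ?n 0 \<in> carrier_mat ?n 0" "0\<^sub>m 0 ?n \<in> carrier_mat 0 ?n" by simp_all
      show "0\<^sub>m 0 ?n * 0\<^sub>m ?n 0 = (1\<^sub>m 0 :: 'k mat)" by (intro eq_matI) auto
      show "(*\<^sub>v) (0\<^sub>m ?n 0) ` carrier_vec 0 = F 0" unfolding F0
      proof
        show "(*\<^sub>v) (0\<^sub>m ?n 0) ` carrier_vec 0 \<subseteq> zero_space S" by (auto simp: mat_vec_zero)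
        show "zero_space S \<subseteq> (*\<^sub>v) (0\<^sub>m ?n 0) ` carrier_vec 0"
          by (auto intro!: image_eqI[of _ _ "0\<^sub>v 0"] simp: mat_vec_zero)
      qed
    qed
  next
    case (Suc i)
    then obtain A B where A: "A \<in> carrier_mat ?n i" and B: "B \<in> carrier_mat i ?n" and BA: "B * A = 1\<^sub>m i"
      and im: "(*\<^sub>v) A ` carrier_vec i = F i" by auto
    have mx: "submodule_D4 S (F (Suc i))" "F i \<subset> F (Suc i)"
      and max: "\<And>X. submodule_D4 S X \<Longrightarrow> F i \<subset> X \<Longrightarrow> \<not> X \<subset> F (Suc i)"
      using step[of i] Suc.prems by (auto simp: maximal_in_def)
    note LU = lin_subspaceD[OF submodule_D4D(1)[OF mx(1)]]
    obtain u where u: "u \<in> F (Suc i)" "u \<notin> F i" using mx(2) by blast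
    obtain A' B' where A': "A' \<in> carrier_mat ?n (i + 1)" "B' \<in> carrier_mat (i + 1) ?n" "B' * A' = 1\<^sub>m (i + 1)"
      "(*\<^sub>v) A' ` carrier_vec (i + 1) = {y + k \<cdot>\<^sub>v u | y k. y \<in> (*\<^sub>v) A ` carrier_vec i}"
      by (rule split_extend[OF A B BA LU(1)[OF u(1)] u(2)[folded im]])
    \<comment> \<open>\<open>F i\<close> enlarged by the line of \<open>u\<close> is a submodule
      strictly above \<open>F i\<close> and inside \<open>F (Suc i)\<close>; maximality makes it
      equal to \<open>F (Suc i)\<close>.\<close>
    define X where "X = {y + k \<cdot>\<^sub>v u | y k. y \<in> F i}"
    have imX: "(*\<^sub>v) A' ` carrier_vec (i + 1) = X" unfolding A'(4) im X_def ..
    have XI: "y + k \<cdot>\<^sub>v u \<in> X" if "y \<in> F i" for y k using that by (auto simp: X_def)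
    have "submodule_D4 S X" unfolding imX[symmetric] by (rule sub[OF lin_subspace_image[OF A'(1)]])
    moreover have "F i \<subset> X"
    proof
      show "F i \<subseteq> X"
      proof
        fix y assume y: "y \<in> F i"
        have "y \<in> F (Suc i)" using y mx(2) by blast
        note c = LU(1)[OF this] LU(1)[OF u(1)]
        have "y + 0 \<cdot>\<^sub>v u = y" using c by (intro eq_vecI) auto
        then show "y \<in> X" using XI[OF y, of 0] by simp
      qed
      have "0\<^sub>v ?n \<in> F i" unfolding im[symmetric] by (rule lin_subspaceD(2)[OF lin_subspace_image[OF A]])
      from XI[OF this, of 1] have "u \<in> X" using LU(1)[OF u(1)] by simp
      then show "F i \<noteq> X" using u(2) by blast
    qed
    ultimately have "\<not> X \<subset> F (Suc i)" by (rule max)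
    moreover have "X \<subseteq> F (Suc i)"
    proof
      fix z assume "z \<in> X"
      then obtain y k where "y \<in> F i" "z = y + k \<cdot>\<^sub>v u" by (auto simp: X_def)
      then show "z \<in> F (Suc i)" using LU(3)[OF _ LU(4)[OF u(1)]] mx(2) by auto
    qed
    ultimately have "X = F (Suc i)" by blast
    then have "(*\<^sub>v) A' ` carrier_vec (Suc i) = F (Suc i)" using imX by simp
    then show ?case using A'(1-3) unfolding Suc_eq_plus1[symmetric] by blast
  qed
  from this[OF order_refl] obtain A B where AB: "A \<in> carrier_mat ?n t" "B \<in> carrier_mat t ?n" "B * A = 1\<^sub>m t"
    "(*\<^sub>v) A ` carrier_vec t = F t" by blast
  show ?thesis using full_split_dim[OF AB(1-3) AB(4)[unfolded Ft]] by simp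
qed

section \<open>Modules of Loewy length two\<close>

text \<open>If \<open>\<pi>\<close> is a projection onto the socle commuting with \<open>b\<close>, then \<open>(1 + b)/2 - \<pi> b\<close>, which is \<open>\<pi>\<close> on the
  \<open>-1\<close>-eigenspace of \<open>b\<close> and \<open>1 - \<pi>\<close> on the \<open>1\<close>-eigenspace, is an idempotent endomorphism. Indecomposability thus forces
  \<open>b\<close> to act by a scalar on the socle and by the opposite scalar on the quotient.\<close>

lemma graded_of_type:
  assumes two: "(2::'k::field) \<noteq> 0" and type: "is_type (M :: 'k rep) s s" and M: "block1 M"
  obtains \<sigma> where "\<sigma> = 1 \<or> \<sigma> = - 1" "graded M \<sigma> s s"
proof -
  let ?n = "rdim M"
  obtain S i Q p where S: "D4_module S" and i: "i \<in> mono_D4 S M" and imi: "(*\<^sub>v) i ` space S = soc M"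
    and lenS: "has_length S s"
    and Q: "D4_module Q" and p: "p \<in> epi_D4 M Q" and kerp: "mat_kernel p = soc M" and lenQ: "has_length Q s"
    and ind: "indecomposable M" and loewy: "loewy_length M = 2"
    using type unfolding is_type_def by blast
  note d = block1_dims[OF M] and rM = rep_carrier_block1[OF M]
  note rS = D4_moduleD(1)[OF S] and rQ = D4_moduleD(1)[OF Q]
  have Mm: "D4_module M" and cb: "opc M = opb M" using M by (auto simp: block1_def)
  have ih: "i \<in> hom_D4 S M" and ph: "p \<in> hom_D4 M Q" using i p by (auto simp: mono_D4_def epi_D4_def)
  note ic = hom_D4D(1)[OF ih] and pc = hom_D4D(1)[OF ph]
  define a where "a = opa M"
  define b where "b = opb M"
  define e where "e = opd M"
  have abe: "a \<in> carrier_mat ?n ?n" "b \<in> carrier_mat ?n ?n" "e \<in> carrier_mat ?n ?n" using d(1-3)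
    by (simp_all add: a_def b_def e_def)
  have bb: "b * b = 1\<^sub>m ?n" using D4_moduleD(12)[OF Mm] by (simp add: b_def)
  have ba: "b * a = - (a * b)" using D4_moduleD(6)[OF Mm] by (simp add: a_def b_def)
  have be: "b * e = - (e * b)" using D4_moduleD(7)[OF Mm] by (simp add: e_def b_def)
  note soc = soc_block1[OF two M, folded a_def e_def]
  have in_soc: "a *\<^sub>v x \<in> soc M" "e *\<^sub>v x \<in> soc M" if x: "x \<in> space M" for x
  proof -
    note bv = block1_vec(1-3)[OF M x, folded a_def e_def] and l = loewy_two[OF two M loewy x, folded a_def e_def]
    have z: "- 0\<^sub>v ?n = (0\<^sub>v ?n :: 'k vec)" by (intro eq_vecI) auto
    show "a *\<^sub>v x \<in> soc M" "e *\<^sub>v x \<in> soc M" unfolding soc using abe x bv l z by auto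
  qed
  have pa: "p * a = 0\<^sub>m (rdim Q) ?n" "p * e = 0\<^sub>m (rdim Q) ?n"
  proof -
    have "p * t = 0\<^sub>m (rdim Q) ?n" if t: "t \<in> carrier_mat ?n ?n" and ts: "\<And>x. x \<in> space M \<Longrightarrow> t *\<^sub>v x \<in> soc M" for t
    proof (rule eq_mat_by_vec)
      fix x :: "'k vec" assume x: "x \<in> carrier_vec ?n"
      have "p *\<^sub>v (t *\<^sub>v x) = 0\<^sub>v (rdim Q)" using ts[OF x] pc unfolding kerp[symmetric] by (simp add: mat_kernel_def)
      then show "(p * t) *\<^sub>v x = 0\<^sub>m (rdim Q) ?n *\<^sub>v x" using pc t x by (simp add: mat_vec)
    qed (use pc t in auto)
    then show "p * a = 0\<^sub>m (rdim Q) ?n" "p * e = 0\<^sub>m (rdim Q) ?n" using abe in_soc by blast+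
  qed
  have i_soc: "i *\<^sub>v x \<in> soc M" if "x \<in> space S" for x using that imi by blast
  have ai: "a * i = 0\<^sub>m ?n (rdim S)" "e * i = 0\<^sub>m ?n (rdim S)" "p * i = 0\<^sub>m (rdim Q) (rdim S)"
  proof -
    show "a * i = 0\<^sub>m ?n (rdim S)"
    proof (rule eq_mat_by_vec)
      fix x :: "'k vec" assume x: "x \<in> carrier_vec (rdim S)"
      show "(a * i) *\<^sub>v x = 0\<^sub>m ?n (rdim S) *\<^sub>v x" using i_soc[OF x] abe ic x unfolding soc by (simp add: mat_vec)
    qed (use abe ic in auto)
    show "e * i = 0\<^sub>m ?n (rdim S)"
    proof (rule eq_mat_by_vec)
      fix x :: "'k vec" assume x: "x \<in> carrier_vec (rdim S)"
      show "(e * i) *\<^sub>v x = 0\<^sub>m ?n (rdim S) *\<^sub>v x" using i_soc[OF x] abe ic x unfolding soc by (simp add: mat_vec)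
    qed (use abe ic in auto)
    show "p * i = 0\<^sub>m (rdim Q) (rdim S)"
    proof (rule eq_mat_by_vec)
      fix x :: "'k vec" assume x: "x \<in> carrier_vec (rdim S)"
      show "(p * i) *\<^sub>v x = 0\<^sub>m (rdim Q) (rdim S) *\<^sub>v x" using i_soc[OF x] pc ic x unfolding kerp[symmetric]
        by (simp add: mat_vec mat_kernel_def)
    qed (use pc ic in auto)
  qed
  obtain L0 where L0: "L0 \<in> carrier_mat (rdim S) ?n" "L0 * i = 1\<^sub>m (rdim S)" by (rule mono_D4_left_inverse[OF i])
  have bS: "opb S \<in> carrier_mat (rdim S) (rdim S)" "opb S * opb S = 1\<^sub>m (rdim S)" using D4_moduleD(3,12)[OF S] by auto
  have ib: "b * i = i * opb S" using ih by (simp add: hom_D4_def b_def)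
  have half: "(1/2) * x + (1/2) * x = x" for x :: 'k using two by (simp add: field_simps)
  \<comment> \<open>A linear retraction onto the socle, averaged so that it intertwines
    \<open>b\<close> on \<open>M\<close> with \<open>b\<close> on \<open>S\<close>. This makes
    \<open>\<pi> = i L\<close> a projection commuting with \<open>b\<close>.\<close>
  define L where "L = (1/2) \<cdot>\<^sub>m (L0 + opb S * (L0 * b))"
  have Lc: "L \<in> carrier_mat (rdim S) ?n" unfolding L_def using L0(1) bS(1) abe(2) by auto
  have Li: "L * i = 1\<^sub>m (rdim S)"
  proof -
    have "opb S * (L0 * (b * i)) = opb S * ((L0 * i) * opb S)" unfolding ib using L0(1) bS(1) ic
      by (simp add: mat_mult_assoc)
    also have "\<dots> = 1\<^sub>m (rdim S)" unfolding L0(2) using bS by simp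
    finally have "L * i = (1/2) \<cdot>\<^sub>m (1\<^sub>m (rdim S) + 1\<^sub>m (rdim S))"
      unfolding L_def using L0 bS(1) abe(2) ic by (simp add: mat_smult_mult mat_add_mult mat_mult_assoc)
    also have "\<dots> = 1\<^sub>m (rdim S)" by (intro eq_matI) (simp_all add: two)
    finally show ?thesis .
  qed
  have Lb: "L * b = opb S * L"
  proof -
    have 1: "opb S * (opb S * (L0 * b)) = L0 * b"
    proof -
      have "opb S * (opb S * (L0 * b)) = (opb S * opb S) * (L0 * b)" using bS(1) L0(1) abe(2)
        by (simp add: mat_mult_assoc)
      then show ?thesis unfolding bS(2) using L0(1) abe(2) by simp
    qed
    have "L * b = (1/2) \<cdot>\<^sub>m (L0 * b + opb S * L0)"
      unfolding L_def using L0(1) bS(1) abe(2) bb by (simp add: mat_smult_mult mat_add_mult mat_mult_assoc)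
    also have "\<dots> = (1/2) \<cdot>\<^sub>m (opb S * L0 + L0 * b)"
      using L0(1) bS(1) abe(2) by (subst comm_add_mat[of _ "rdim S" ?n]) auto
    also have "\<dots> = opb S * L"
      unfolding L_def using L0(1) bS(1) abe(2) by (simp add: mat_mult_smult mat_mult_add 1)
    finally show ?thesis .
  qed
  define \<pi> where "\<pi> = i * L"
  have \<pi>c: "\<pi> \<in> carrier_mat ?n ?n" unfolding \<pi>_def using ic Lc by auto
  have \<pi>i: "\<pi> * i = i" unfolding \<pi>_def using ic Lc Li by (simp add: mat_mult_assoc)
  have \<pi>\<pi>: "\<pi> * \<pi> = \<pi>"
  proof -
    have "\<pi> * \<pi> = (\<pi> * i) * L" unfolding \<pi>_def using ic Lc by (simp add: mat_mult_assoc)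
    also have "\<dots> = \<pi>" unfolding \<pi>i by (simp add: \<pi>_def)
    finally show ?thesis .
  qed
  have b\<pi>: "b * \<pi> = \<pi> * b"
  proof -
    have "b * \<pi> = (b * i) * L" unfolding \<pi>_def using abe(2) ic Lc by (simp add: mat_mult_assoc)
    also have "\<dots> = i * (opb S * L)" unfolding ib using bS(1) ic Lc by (simp add: mat_mult_assoc)
    also have "\<dots> = \<pi> * b" unfolding Lb[symmetric] \<pi>_def using abe(2) ic Lc by (simp add: mat_mult_assoc)
    finally show ?thesis .
  qed
  have a\<pi>: "a * \<pi> = 0\<^sub>m ?n ?n" "e * \<pi> = 0\<^sub>m ?n ?n" "p * \<pi> = 0\<^sub>m (rdim Q) ?n"
  proof -
    have "a * \<pi> = (a * i) * L" "e * \<pi> = (e * i) * L" "p * \<pi> = (p * i) * L"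
      unfolding \<pi>_def using abe pc ic Lc by (simp_all add: mat_mult_assoc)
    then show "a * \<pi> = 0\<^sub>m ?n ?n" "e * \<pi> = 0\<^sub>m ?n ?n" "p * \<pi> = 0\<^sub>m (rdim Q) ?n" unfolding ai using Lc
      by (simp_all add: mat_mult_zero)
  qed
  have \<pi>_soc: "\<pi> *\<^sub>v y = y" if "y \<in> soc M" for y
  proof -
    obtain x where x: "x \<in> space S" "y = i *\<^sub>v x" using \<open>y \<in> soc M\<close> imi by blast
    have "\<pi> *\<^sub>v y = (\<pi> * i) *\<^sub>v x" unfolding x(2) using \<pi>c ic x(1) by (simp add: mat_mult_vec_assoc)
    then show ?thesis unfolding \<pi>i x(2) .
  qed
  have \<pi>a: "\<pi> * a = a" "\<pi> * e = e"
    by (rule eq_mat_by_vec[of _ ?n ?n]; use \<pi>c abe in_soc \<pi>_soc in \<open>simp add: mat_mult_vec_assoc\<close>)+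
  define E where "E = (1/2) \<cdot>\<^sub>m (1\<^sub>m ?n + b) - \<pi> * b"
  have Ec: "E \<in> carrier_mat ?n ?n" unfolding E_def using \<pi>c abe(2) by (intro minus_carrier_mat) auto
  \<comment> \<open>Stated for \<open>t = a\<close> and \<open>t = d\<close> together: an operator
    anticommuting with \<open>b\<close> that has its values in the socle and kills the socle. Both
    products equal \<open>(t + t b)/2\<close>.\<close>
  have anti: "E * t = t * E" if t: "t \<in> carrier_mat ?n ?n" and bt: "b * t = - (t * b)" and \<pi>t: "\<pi> * t = t"
    and t\<pi>: "t * \<pi> = 0\<^sub>m ?n ?n" for t
  proof -
    have tb: "t * b \<in> carrier_mat ?n ?n" using t abe(2) by auto
    have 1: "\<pi> * (t * b) = t * b"
    proof -
      have "\<pi> * (t * b) = (\<pi> * t) * b" using \<pi>c t abe(2) by (simp add: mat_mult_assoc)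
      then show ?thesis unfolding \<pi>t .
    qed
    have 2: "t * (\<pi> * b) = 0\<^sub>m ?n ?n"
    proof -
      have "t * (\<pi> * b) = (t * \<pi>) * b" using \<pi>c t abe(2) by (simp add: mat_mult_assoc)
      then show ?thesis unfolding t\<pi> using abe(2) by (simp add: mat_mult_zero)
    qed
    have "E * t = (1/2) \<cdot>\<^sub>m (t + - (t * b)) - - (t * b)"
      unfolding E_def using \<pi>c t abe(2) bt 1 by (simp add: mat_ring)
    also have "\<dots> = (1/2) \<cdot>\<^sub>m (t + t * b)"
    proof (rule eq_matI)
      fix j k assume "j < dim_row ((1/2) \<cdot>\<^sub>m (t + t * b))" "k < dim_col ((1/2) \<cdot>\<^sub>m (t + t * b))"
      then have jk: "j < ?n" "k < ?n" using t abe(2) by simp_all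
      have id: "h * (x + - y) - - y = h * (x + y)" if h: "\<And>z. h * z + h * z = z" for h x y :: 'k
      proof -
        have "h * (x + - y) - - y = h * (x + - y) + (h * y + h * y)" by (simp only: h diff_minus_eq_add)
        also have "\<dots> = h * (x + y)" by (simp add: algebra_simps)
        finally show ?thesis .
      qed
      show "((1/2) \<cdot>\<^sub>m (t + - (t * b)) - - (t * b)) $$ (j, k) = ((1/2) \<cdot>\<^sub>m (t + t * b)) $$ (j, k)"
        using jk carrier_matD[OF t] carrier_matD[OF abe(2)]
        by (simp only: index_minus_mat index_smult_mat index_add_mat index_uminus_mat index_mult_mat(2,3) id[OF half])
    qed (use t tb in simp_all)
    also have "\<dots> = t * E"
      unfolding E_def using \<pi>c t abe(2) 2 by (simp add: mat_ring) (intro eq_matI; simp del: index_mult_mat(1))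
    finally show ?thesis .
  qed
  have Eb: "E * b = b * E"
  proof -
    have "b * (\<pi> * b) = (b * \<pi>) * b" using \<pi>c abe(2) by (simp add: mat_mult_assoc)
    also have "\<dots> = \<pi>" unfolding b\<pi> using \<pi>c abe(2) bb by (simp add: mat_mult_assoc)
    finally show ?thesis unfolding E_def using \<pi>c abe(2) bb by (simp add: mat_ring)
  qed
  have "E \<in> hom_D4 M M"
    unfolding hom_D4_def cb a_def[symmetric] b_def[symmetric] e_def[symmetric]
    using Ec Eb anti[OF abe(1) ba \<pi>a(1) a\<pi>(1)] anti[OF abe(3) be \<pi>a(2) a\<pi>(2)] by simp
  moreover have "E * E = E"
  proof -
    \<comment> \<open>With \<open>x = (1 + b)/2\<close> and \<open>y = \<pi> b\<close> one has
      \<open>x^2 = x\<close>, \<open>y^2 = \<pi>\<close> and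
      \<open>x y = y x = (y + \<pi>)/2\<close>, so \<open>(x - y)^2 = x - y\<close>.\<close>
    define x where "x = (1/2) \<cdot>\<^sub>m (1\<^sub>m ?n + b)"
    define y where "y = \<pi> * b"
    have xc: "x \<in> carrier_mat ?n ?n" and yc: "y \<in> carrier_mat ?n ?n" unfolding x_def y_def using \<pi>c abe(2) by auto
    have xx: "x * x = x"
    proof -
      have "x * x = (1/2) \<cdot>\<^sub>m ((1/2) \<cdot>\<^sub>m (1\<^sub>m ?n + b) + (1/2) \<cdot>\<^sub>m (b + 1\<^sub>m ?n))"
        unfolding x_def using abe(2) bb by (simp add: mat_ring)
      also have "b + 1\<^sub>m ?n = 1\<^sub>m ?n + b" by (rule comm_add_mat[OF abe(2)]) simp
      also have "(1/2) \<cdot>\<^sub>m (1\<^sub>m ?n + b) + (1/2) \<cdot>\<^sub>m (1\<^sub>m ?n + b) = 1\<^sub>m ?n + b"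
        by (rule eq_matI) (use abe(2) half in \<open>simp_all only: index_smult_mat index_add_mat carrier_matD[OF abe(2)]
          index_one_mat(2,3)\<close>)
      finally show ?thesis unfolding x_def .
    qed
    have yy: "y * y = \<pi>"
    proof -
      have "y * y = \<pi> * ((b * \<pi>) * b)" unfolding y_def using \<pi>c abe(2) by (simp add: mat_mult_assoc)
      also have "\<dots> = (\<pi> * \<pi>) * (b * b)" unfolding b\<pi> using \<pi>c abe(2) by (simp add: mat_mult_assoc)
      finally show ?thesis unfolding \<pi>\<pi> bb using \<pi>c by simp
    qed
    have by': "b * y = \<pi>" "y * b = \<pi>"
    proof -
      have "b * y = (b * \<pi>) * b" unfolding y_def using \<pi>c abe(2) by (simp add: mat_mult_assoc)
      also have "\<dots> = \<pi> * (b * b)" unfolding b\<pi> using \<pi>c abe(2) by (simp add: mat_mult_assoc)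
      finally show "b * y = \<pi>" unfolding bb using \<pi>c by simp
      show "y * b = \<pi>" unfolding y_def using \<pi>c abe(2) bb by (simp add: mat_mult_assoc)
    qed
    have xy: "x * y = (1/2) \<cdot>\<^sub>m (y + \<pi>)" "y * x = (1/2) \<cdot>\<^sub>m (y + \<pi>)"
      unfolding x_def using yc abe(2) by' by (simp_all add: mat_ring)
    have "E * E = (x * x - x * y) - (y * x - y * y)"
      unfolding E_def x_def[symmetric] y_def[symmetric] using xc yc
      by (simp add: mat_ring) (intro eq_matI; simp del: index_mult_mat(1))
    also have "\<dots> = x - y" unfolding xx xy yy
    proof (rule eq_matI)
      fix j k assume "j < dim_row (x - y)" "k < dim_col (x - y)"
      then have jk: "j < ?n" "k < ?n" using yc by simp_all
      have id: "(u - h * (v + w)) - (h * (v + w) - w) = u - v" if h: "\<And>z. h * z + h * z = z" for h u v w :: 'k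
      proof -
        have "(u - h * (v + w)) - (h * (v + w) - w) = u - (h * (v + w) + h * (v + w)) + w"
          by (simp only: diff_diff_eq2 diff_add_eq diff_diff_eq)
        then show ?thesis by (simp add: h)
      qed
      show "(x - (1/2) \<cdot>\<^sub>m (y + \<pi>) - ((1/2) \<cdot>\<^sub>m (y + \<pi>) - \<pi>)) $$ (j, k) = (x - y) $$ (j, k)"
        using jk carrier_matD[OF xc] carrier_matD[OF yc] carrier_matD[OF \<pi>c]
        by (simp only: index_minus_mat index_smult_mat index_add_mat id[OF half])
    qed (use xc yc \<pi>c in simp_all)
    finally show ?thesis unfolding E_def x_def y_def .
  qed
  ultimately have E01: "E = 0\<^sub>m ?n ?n \<or> E = 1\<^sub>m ?n" by (rule indecomposable_idempotent[OF ind])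
  \<comment> \<open>On the socle \<open>E\<close> restricts to \<open>(1 - b)/2\<close>, on the
    quotient it induces \<open>(1 + b)/2\<close>. Thus \<open>E = 0\<close> and \<open>E = 1\<close>
    both force opposite signs of \<open>b\<close> on the two parts.\<close>
  have Ei: "E * i = (1/2) \<cdot>\<^sub>m (i + b * i) - b * i"
  proof -
    have "\<pi> * (b * i) = (b * \<pi>) * i" unfolding b\<pi> using \<pi>c abe(2) ic by (simp add: mat_mult_assoc)
    then have "\<pi> * (b * i) = b * i" using \<pi>c abe(2) ic \<pi>i by (simp add: mat_mult_assoc)
    then show ?thesis unfolding E_def using \<pi>c abe(2) ic by (simp add: mat_ring)
  qed
  have pE: "p * E = (1/2) \<cdot>\<^sub>m (p + p * b)"
  proof -
    have "p * (\<pi> * b) = (p * \<pi>) * b" using pc \<pi>c abe(2) by (simp add: mat_mult_assoc)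
    then have "p * (\<pi> * b) = 0\<^sub>m (rdim Q) ?n" unfolding a\<pi> using abe(2) by (simp add: mat_mult_zero)
    then show ?thesis unfolding E_def using pc \<pi>c abe(2)
      by (simp add: mat_ring) (intro eq_matI; simp del: index_mult_mat(1))
  qed
  \<comment> \<open>\<open>\<sigma>\<close> is the sign of \<open>b\<close> on the quotient:
    \<open>- 1\<close> when \<open>E = 0\<close> and \<open>1\<close> when
    \<open>E = 1\<close>.\<close>
  obtain \<sigma> :: 'k where \<sigma>: "\<sigma> = 1 \<or> \<sigma> = - 1" and bi: "b * i = (- \<sigma>) \<cdot>\<^sub>m i" and pb: "p * b = \<sigma> \<cdot>\<^sub>m p"
  proof -
    have bic: "b * i \<in> carrier_mat ?n (rdim S)" and pbc: "p * b \<in> carrier_mat (rdim Q) ?n" using abe(2) ic pc by auto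
    have one: "1 \<cdot>\<^sub>m A = A" for A :: "'k mat" by (intro eq_matI) auto
    have ent: "((1/2) \<cdot>\<^sub>m (A + B) - B) $$ (j, k) = (1/2) * (A $$ (j, k) + B $$ (j, k)) - B $$ (j, k)"
      "((1/2) \<cdot>\<^sub>m (A + B)) $$ (j, k) = (1/2) * (A $$ (j, k) + B $$ (j, k))"
      if "A \<in> carrier_mat m l" "B \<in> carrier_mat m l" "j < m" "k < l" for A B :: "'k mat" and m l j k
      using that by simp_all
    have dbl: "x + y = 2 * z" if "(1/2) * (x + y) = z" for x y z :: 'k using that two by auto
    have h0: "y = - x" if "(1/2) * (x + y) = 0" for x y :: 'k
      using dbl[OF that] by (simp add: eq_neg_iff_add_eq_0 add.commute)
    have h1: "y = x" if "(1/2) * (x + y) - y = 0" for x y :: 'k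
      using dbl[of x y y] that by (simp only: right_minus_eq mult_2 add_right_cancel)
    have h2: "y = - x" if "(1/2) * (x + y) - y = x" for x y :: 'k
    proof -
      have "x + y = (x + y) + (x + y)" using dbl[of x y "x + y"] that by (simp only: diff_eq_eq mult_2)
      then show ?thesis by (simp add: eq_neg_iff_add_eq_0 add.commute)
    qed
    have h3: "y = x" if "(1/2) * (x + y) = x" for x y :: 'k
      using dbl[OF that] by (simp only: mult_2 add_left_cancel)
    from E01 show thesis
    proof
      assume E0: "E = 0\<^sub>m ?n ?n"
      have "(1/2) \<cdot>\<^sub>m (i + b * i) - b * i = 0\<^sub>m ?n (rdim S)" unfolding Ei[symmetric] E0 using ic
        by (simp add: mat_mult_zero)
      then have "b * i = i"
      proof (intro eq_matI)
        fix j k assume eq: "(1/2) \<cdot>\<^sub>m (i + b * i) - b * i = 0\<^sub>m ?n (rdim S)" and "j < dim_row i" "k < dim_col i"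
        then have jk: "j < ?n" "k < rdim S" using ic by simp_all
        have "(1/2) * (i $$ (j, k) + (b * i) $$ (j, k)) - (b * i) $$ (j, k) = 0"
          unfolding ent(1)[OF ic bic jk, symmetric] eq using jk by simp
        then show "(b * i) $$ (j, k) = i $$ (j, k)" by (rule h1)
      qed (use ic bic in auto)
      moreover have "(1/2) \<cdot>\<^sub>m (p + p * b) = 0\<^sub>m (rdim Q) ?n" unfolding pE[symmetric] E0 using pc
        by (simp add: mat_mult_zero)
      then have "p * b = (- 1) \<cdot>\<^sub>m p"
      proof (intro eq_matI)
        fix j k assume eq: "(1/2) \<cdot>\<^sub>m (p + p * b) = 0\<^sub>m (rdim Q) ?n"
          and "j < dim_row ((- 1) \<cdot>\<^sub>m p)" "k < dim_col ((- 1) \<cdot>\<^sub>m p)"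
        then have jk: "j < rdim Q" "k < ?n" using pc by simp_all
        have "(1/2) * (p $$ (j, k) + (p * b) $$ (j, k)) = 0"
          unfolding ent(2)[OF pc pbc jk, symmetric] eq using jk by simp
        then have "(p * b) $$ (j, k) = - p $$ (j, k)" by (rule h0)
        then show "(p * b) $$ (j, k) = ((- 1) \<cdot>\<^sub>m p) $$ (j, k)" using jk pc by (simp del: index_mult_mat(1))
      qed (use pc pbc in auto)
      ultimately show thesis using that[of "- 1"] by (simp add: one)
    next
      assume E1: "E = 1\<^sub>m ?n"
      have "(1/2) \<cdot>\<^sub>m (i + b * i) - b * i = i" unfolding Ei[symmetric] E1 using ic by simp
      then have "b * i = (- 1) \<cdot>\<^sub>m i"
      proof (intro eq_matI)
        fix j k assume eq: "(1/2) \<cdot>\<^sub>m (i + b * i) - b * i = i"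
          and "j < dim_row ((- 1) \<cdot>\<^sub>m i)" "k < dim_col ((- 1) \<cdot>\<^sub>m i)"
        then have jk: "j < ?n" "k < rdim S" using ic by simp_all
        have "(1/2) * (i $$ (j, k) + (b * i) $$ (j, k)) - (b * i) $$ (j, k) = i $$ (j, k)"
          unfolding ent(1)[OF ic bic jk, symmetric] eq ..
        then have "(b * i) $$ (j, k) = - i $$ (j, k)" by (rule h2)
        then show "(b * i) $$ (j, k) = ((- 1) \<cdot>\<^sub>m i) $$ (j, k)" using jk ic by (simp del: index_mult_mat(1))
      qed (use ic bic in auto)
      moreover have "(1/2) \<cdot>\<^sub>m (p + p * b) = p" unfolding pE[symmetric] E1 using pc by simp
      then have "p * b = p"
      proof (intro eq_matI)
        fix j k assume eq: "(1/2) \<cdot>\<^sub>m (p + p * b) = p" and "j < dim_row p" "k < dim_col p"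
        then have jk: "j < rdim Q" "k < ?n" using pc by simp_all
        have "(1/2) * (p $$ (j, k) + (p * b) $$ (j, k)) = p $$ (j, k)"
          unfolding ent(2)[OF pc pbc jk, symmetric] eq ..
        then show "(p * b) $$ (j, k) = p $$ (j, k)" by (rule h3)
      qed (use pc pbc in auto)
      ultimately show thesis using that[of 1] by (simp add: one)
    qed
  qed
  have \<sigma>\<sigma>: "\<sigma> * \<sigma> = 1" using \<sigma> by auto
  have dS: "rdim S = s"
  proof (rule scalar_has_length[OF _ _ _ _ lenS])
    have z: "t S = 0\<^sub>m (rdim S) (rdim S)" if t: "t \<in> gens" and "t M * i = 0\<^sub>m ?n (rdim S)" for t
      by (rule mono_D4_cancel[OF i]) (use hom_D4D(2)[OF ih t] that ic rep_carrierD[OF rS t] in \<open>auto simp: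
        mat_mult_zero\<close>)
    show "opa S = 0\<^sub>m (rdim S) (rdim S)" "opd S = 0\<^sub>m (rdim S) (rdim S)"
      using z[OF gens_simps(1)] z[OF gens_simps(4)] ai(1,2) by (auto simp: a_def e_def)
    have z: "t S = (- \<sigma>) \<cdot>\<^sub>m 1\<^sub>m (rdim S)" if t: "t \<in> gens" and "t M = b" for t
      by (rule mono_D4_cancel[OF i]) (use hom_D4D(2)[OF ih t] that bi ic rep_carrierD[OF rS t] in \<open>auto simp:
        mat_mult_smult\<close>)
    show "opb S = (- \<sigma>) \<cdot>\<^sub>m 1\<^sub>m (rdim S)" "opc S = (- \<sigma>) \<cdot>\<^sub>m 1\<^sub>m (rdim S)"
      using z[OF gens_simps(2)] z[OF gens_simps(3)] cb by (auto simp: b_def)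
  qed
  obtain R where R: "R \<in> carrier_mat ?n (rdim Q)" "p * R = 1\<^sub>m (rdim Q)" by (rule epi_D4_right_inverse[OF p])
  have dQ: "rdim Q = s"
  proof (rule scalar_has_length[OF _ _ _ _ lenQ])
    have tQ: "t Q = (p * t M) * R" if t: "t \<in> gens" for t
    proof -
      have "t Q = t Q * (p * R)" unfolding R(2) using rep_carrierD[OF rQ t] by simp
      also have "\<dots> = (t Q * p) * R" using rep_carrierD[OF rQ t] pc R(1) by (simp add: mat_mult_assoc)
      finally show ?thesis unfolding hom_D4D(2)[OF ph t] .
    qed
    show "opa Q = 0\<^sub>m (rdim Q) (rdim Q)" "opd Q = 0\<^sub>m (rdim Q) (rdim Q)"
      unfolding tQ[OF gens_simps(1)] tQ[OF gens_simps(4)] a_def[symmetric] e_def[symmetric] pa using R(1)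
        by (simp_all add: mat_mult_zero)
    show "opb Q = \<sigma> \<cdot>\<^sub>m 1\<^sub>m (rdim Q)" "opc Q = \<sigma> \<cdot>\<^sub>m 1\<^sub>m (rdim Q)"
      unfolding tQ[OF gens_simps(2)] tQ[OF gens_simps(3)] cb b_def[symmetric] pb using pc R
        by (simp_all add: mat_smult_mult)
  qed
  note ic = ic[unfolded dS] and pc = pc[unfolded dQ] and R = R[unfolded dQ] and L0 = L0[unfolded dS]
    and pi = ai(3)[unfolded dS dQ]
  \<comment> \<open>A section of \<open>p\<close>, averaged so that its columns are eigenvectors of
    \<open>b\<close> for \<open>\<sigma>\<close>.\<close>
  define U where "U = (1/2) \<cdot>\<^sub>m (R + \<sigma> \<cdot>\<^sub>m (b * R))"
  have Uc: "U \<in> carrier_mat ?n s" unfolding U_def using R(1) abe(2) by auto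
  have pU: "p * U = 1\<^sub>m s"
  proof -
    have "p * (b * R) = (p * b) * R" using pc abe(2) R(1) by (simp add: mat_mult_assoc)
    then have "p * (b * R) = \<sigma> \<cdot>\<^sub>m 1\<^sub>m s" unfolding pb using pc R by (simp add: mat_smult_mult)
    then have "p * U = (1/2) \<cdot>\<^sub>m (1\<^sub>m s + \<sigma> \<cdot>\<^sub>m (\<sigma> \<cdot>\<^sub>m 1\<^sub>m s))" unfolding U_def using pc abe(2) R
      by (simp add: mat_ring)
    also have "\<dots> = 1\<^sub>m s" by (intro eq_matI) (simp_all add: \<sigma>\<sigma> two)
    finally show ?thesis .
  qed
  have bU: "b * U = \<sigma> \<cdot>\<^sub>m U"
  proof -
    have "b * (b * R) = (b * b) * R" using abe(2) R(1) by (simp add: mat_mult_assoc)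
    then have "b * (b * R) = R" unfolding bb using R(1) by simp
    then have "b * U = (1/2) \<cdot>\<^sub>m (b * R + \<sigma> \<cdot>\<^sub>m R)" unfolding U_def using abe(2) R(1) by (simp add: mat_ring)
    also have "\<dots> = \<sigma> \<cdot>\<^sub>m U" unfolding U_def
    proof (rule eq_matI)
      fix j k assume "j < dim_row (\<sigma> \<cdot>\<^sub>m ((1/2) \<cdot>\<^sub>m (R + \<sigma> \<cdot>\<^sub>m (b * R))))" "k < dim_col (\<sigma> \<cdot>\<^sub>m ((1/2) \<cdot>\<^sub>m (R + \<sigma> \<cdot>\<^sub>m
        (b * R))))"
      then have jk: "j < ?n" "k < s" using R(1) abe(2) by simp_all
      have id: "h * (v + \<sigma> * u) = \<sigma> * (h * (u + \<sigma> * v))" for h u v :: 'k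
      proof -
        have "\<sigma> * (h * (u + \<sigma> * v)) = h * ((\<sigma> * \<sigma>) * v + \<sigma> * u)" by (simp only: distrib_left ac_simps)
        then show ?thesis by (simp only: \<sigma>\<sigma> mult_1)
      qed
      show "((1/2) \<cdot>\<^sub>m (b * R + \<sigma> \<cdot>\<^sub>m R)) $$ (j, k) = (\<sigma> \<cdot>\<^sub>m ((1/2) \<cdot>\<^sub>m (R + \<sigma> \<cdot>\<^sub>m (b * R)))) $$ (j, k)"
        using jk carrier_matD[OF R(1)] carrier_matD[OF abe(2)]
        by (simp only: index_smult_mat index_add_mat index_mult_mat(2,3)) (rule id)
    qed (use R(1) abe(2) in simp_all)
    finally show ?thesis .
  qed
  \<comment> \<open>The retraction onto the socle, corrected to vanish on the complement spanned by
    the columns of \<open>U\<close>. Then \<open>p\<close> and \<open>L'\<close> stacked form a left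
    inverse of \<open>U\<close> and \<open>i\<close> placed side by side.\<close>
  define L' where "L' = L0 - (L0 * U) * p"
  have L'c: "L' \<in> carrier_mat s ?n" unfolding L'_def using L0(1) Uc pc by (intro minus_carrier_mat) auto
  have L'i: "L' * i = 1\<^sub>m s" unfolding L'_def using L0 Uc pc ic pi by (simp add: mat_ring) (intro eq_matI; simp)
  have L'U: "L' * U = 0\<^sub>m s s" unfolding L'_def using L0(1) Uc pc pU by (simp add: mat_ring)
  let ?D = "sparse (s + s) (s + s) (\<lambda>j. if j < s then \<sigma> else - \<sigma>) (\<lambda>j. j)"
  define C where "C = four_block_mat U i (0\<^sub>m 0 s) (0\<^sub>m 0 s)"
  define T where "T = four_block_mat p (0\<^sub>m s 0) L' (0\<^sub>m s 0)"
  have Cc: "C \<in> carrier_mat ?n (s + s)" unfolding C_def using four_block_carrier_mat[of U ?n s "0\<^sub>m 0 s" 0 s] Uc by simp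
  have Tc: "T \<in> carrier_mat (s + s) ?n" unfolding T_def using four_block_carrier_mat[of p s ?n "0\<^sub>m s 0" s 0] pc by simp
  have TC: "T * C = 1\<^sub>m (s + s)" unfolding T_def C_def
    using Uc ic pc L'c pU pi L'U L'i by (subst mult_four_block_mat[of _ s ?n _ 0 _ s _ _ s _ s]) (auto simp:
      mat_mult_zero mat_add_zero)
  \<comment> \<open>For each \<open>x\<close> the vector \<open>x - U p x\<close> is in the kernel
    of \<open>p\<close>, which is the image of \<open>i\<close>. Surjectivity gives dimension
    \<open>2 s\<close> and makes the columns of \<open>C\<close> an eigenbasis.\<close>
  have "(*\<^sub>v) C ` carrier_vec (s + s) = carrier_vec ?n"
  proof
    show "(*\<^sub>v) C ` carrier_vec (s + s) \<subseteq> carrier_vec ?n" using Cc by auto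
    show "carrier_vec ?n \<subseteq> (*\<^sub>v) C ` carrier_vec (s + s)"
    proof
      fix x :: "'k vec" assume x: "x \<in> carrier_vec ?n"
      define y where "y = p *\<^sub>v x"
      have yc: "y \<in> carrier_vec s" unfolding y_def using pc x by auto
      have Uy: "U *\<^sub>v y \<in> carrier_vec ?n" using Uc yc by auto
      have "p *\<^sub>v (x - U *\<^sub>v y) = p *\<^sub>v x - (p * U) *\<^sub>v y" using pc Uc x yc by (simp add: mat_vec)
      also have "\<dots> = 0\<^sub>v s" unfolding pU y_def[symmetric] using yc by (simp add: mat_one_vec)
      finally have "x - U *\<^sub>v y \<in> mat_kernel p" using x Uy by (intro mat_kernelI[OF pc]) auto
      then obtain z where z: "z \<in> carrier_vec s" "x - U *\<^sub>v y = i *\<^sub>v z" unfolding kerp imi[symmetric] dS by auto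
      have "x = U *\<^sub>v y + (x - U *\<^sub>v y)" using x Uc by (intro eq_vecI) (auto simp del: index_mult_mat_vec)
      then have x_eq: "x = U *\<^sub>v y + i *\<^sub>v z" unfolding z(2) .
      have "C *\<^sub>v (y @\<^sub>v z) = (U *\<^sub>v y + i *\<^sub>v z) @\<^sub>v (0\<^sub>m 0 s *\<^sub>v y + 0\<^sub>m 0 s *\<^sub>v z)"
        unfolding C_def by (rule four_block_mat_mult_vec[OF Uc ic _ _ yc z(1)]) auto
      also have "\<dots> = x" unfolding x_eq[symmetric] using x by (intro eq_vecI) auto
      finally show "x \<in> (*\<^sub>v) C ` carrier_vec (s + s)" using yc z(1) by (intro image_eqI[of _ _ "y @\<^sub>v z"]) auto
    qed
  qed
  then have n: "?n = s + s" using full_split_dim[OF Cc Tc TC] by simp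
  have CT: "C * T = 1\<^sub>m (s + s)" using mat_mult_left_right_inverse[OF _ _ TC] Cc Tc n by simp
  have bC: "b * C = C * ?D"
  proof (rule mat_col_eqI)
    fix j assume "j < dim_col (C * ?D)"
    then have j: "j < s + s" by simp
    have colD: "col ?D j = (if j < s then \<sigma> else - \<sigma>) \<cdot>\<^sub>v unit_vec (s + s) j"
      using j by (intro eq_vecI) (auto simp: sparse_index unit_vec_def)
    have "col (C * ?D) j = C *\<^sub>v col ?D j" by (rule col_mult2[OF Cc _ j]) simp
    also have "\<dots> = (if j < s then \<sigma> else - \<sigma>) \<cdot>\<^sub>v col C j" unfolding colD using Cc j
      by (simp add: mat_vec_smult mat_mult_unit_vec[OF Cc j])
    also have "\<dots> = b *\<^sub>v col C j"
    proof (cases "j < s")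
      case True
      have "col C j = col U j" unfolding C_def using True Uc ic by (intro eq_vecI) auto
      moreover have "b *\<^sub>v col U j = col (b * U) j" using col_mult2[OF abe(2) Uc True] by simp
      moreover have "\<dots> = \<sigma> \<cdot>\<^sub>v col U j" unfolding bU using Uc True by (intro eq_vecI) auto
      ultimately show ?thesis using True by simp
    next
      case False
      then have j': "j - s < s" using j by simp
      have "col C j = col i (j - s)" unfolding C_def using False j' j Uc ic by (intro eq_vecI) auto
      moreover have "b *\<^sub>v col i (j - s) = col (b * i) (j - s)" using col_mult2[OF abe(2) ic j'] by simp
      moreover have "\<dots> = (- \<sigma>) \<cdot>\<^sub>v col i (j - s)" unfolding bi using ic j' by (intro eq_vecI) auto
      ultimately show ?thesis using False by simp
    qed
    also have "\<dots> = col (b * C) j" using col_mult2[OF abe(2) Cc j] by simp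
    finally show "col (b * C) j = col (C * ?D) j" ..
  qed (use abe(2) Cc in auto)
  have "graded M \<sigma> s s"
  proof (rule gradedI[OF n _ _ CT TC])
    show "C \<in> carrier_mat (s + s) (s + s)" "T \<in> carrier_mat (s + s) (s + s)" using Cc Tc n by simp_all
    fix t :: "'k rep \<Rightarrow> 'k mat" assume "t \<in> {opb, opc}"
    then have "t M = b" using cb by (auto simp: b_def)
    then show "t M * C = C * ?D" using bC by simp
  qed
  with \<sigma> show thesis by (rule that)
qed

theorem corollary2p10:
  fixes P :: "bit \<Rightarrow> 'k::alg_closed_field rep"
    and r r' :: bit and s :: nat and \<eta> :: "'k proj_line"
  assumes char: "CHAR('k) \<noteq> 2"
    and P: "\<And>q. is_P q (P q)"
    and s: "s \<ge> 1"
  shows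
    "(odd s \<longrightarrow>
       (\<forall>N N'. (is_Omega ^^ s) (simple_V r) N \<and> (is_Omega_inv ^^ s) (simple_V r) N' \<longrightarrow>
          P r' \<otimes>\<^sub>D N \<cong>\<^sub>D P r' \<otimes>\<^sub>D N' \<and>
          P r' \<otimes>\<^sub>D N' \<cong>\<^sub>D dsum [copies s (P (r + r')), copies (s + 1) (P (r + r' + 1))])) \<and>
     (even s \<longrightarrow>
       (\<forall>N N'. (is_Omega ^^ s) (simple_V r) N \<and> (is_Omega_inv ^^ s) (simple_V r) N' \<longrightarrow>
          P r' \<otimes>\<^sub>D N \<cong>\<^sub>D P r' \<otimes>\<^sub>D N' \<and>
          P r' \<otimes>\<^sub>D N' \<cong>\<^sub>D dsum [copies s (P (r + r' + 1)), copies (s + 1) (P (r + r'))])) \<and>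
     (\<forall>M. is_M s r \<eta> M \<longrightarrow>
        P r' \<otimes>\<^sub>D M \<cong>\<^sub>D dsum [copies s (P 0), copies s (P 1)])"
proof -
  have two: "(2 :: 'k) \<noteq> 0"
  proof
    assume "(2 :: 'k) = 0"
    then have "CHAR('k) dvd 2" using of_nat_eq_0_iff_char_dvd[of 2, where ?'a = 'k] by simp
    \<comment> \<open>A divisor of 2 is 1 or 2; characteristic 1 would mean \<open>1 = 0\<close> in
      the field.\<close>
    then have "CHAR('k) = 1 \<or> CHAR('k) = 2" using dvd_imp_le[of "CHAR('k)" 2] by (cases "CHAR('k)") auto
    moreover have "CHAR('k) \<noteq> 1" using of_nat_CHAR[where ?'a = 'k] by auto
    ultimately show False using char by simp
  qed
  have pow: "pow_neg1 (r + r' + 1) = - (pow_neg1 r * pow_neg1 r' :: 'k)" "pow_neg1 (r + r') = (pow_neg1 r * pow_neg1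
    r' :: 'k)"
    by (cases r; cases r'; simp add: pow_neg1_def)+
  have e: "pow_neg1 r * pow_neg1 r = (1 :: 'k)" by simp
  note main = tensor_projective[OF two P P P]
  have rP: "rep_carrier (P q)" for q by (rule D4_moduleD(1)[OF is_P_module(1)[OF two P]])
  have both: "P r' \<otimes>\<^sub>D N \<cong>\<^sub>D P r' \<otimes>\<^sub>D N' \<and> P r' \<otimes>\<^sub>D N' \<cong>\<^sub>D D"
    if N: "D4_module N" "P r' \<otimes>\<^sub>D N \<cong>\<^sub>D D" and N': "D4_module N'" "P r' \<otimes>\<^sub>D N' \<cong>\<^sub>D D" and D: "rep_carrier D" for N N' D
  proof -
    have rc: "rep_carrier (P r' \<otimes>\<^sub>D K)" if "D4_module K" for K
      by (rule D4_moduleD(1)[OF D4_module_tensor[OF is_P_module(1)[OF two P] that]])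
    show ?thesis
      using iso_D4_trans[OF N(2) iso_D4_sym[OF N'(2) rc[OF N'(1)] D] rc[OF N(1)] D rc[OF N'(1)]] N'(2) by blast
  qed
  have rD: "rep_carrier (dsum [copies m (P q), copies n (P q')])" for m n q q'
    by (rule rep_carrier_dsum) (auto intro: rep_carrier_copies rP)
  \<comment> \<open>The eigenvalue with multiplicity \<open>s + 1\<close> is
    \<open>(-1)^(s + r)\<close>. After tensoring with \<open>P r'\<close> it contributes the sign
    \<open>(-1)^(s + r + r')\<close>, which is the origin of the dependence on the parity of
    \<open>s\<close>.\<close>
  have gr: "D4_module N \<and> graded N ((- 1) ^ s * pow_neg1 r) (s + 1) s"
    if "(is_Omega ^^ s) (simple_V r) N \<or> (is_Omega_inv ^^ s) (simple_V r) N" for N :: "'k rep"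
    using that graded_Omega_power[OF two e] graded_Omega_inv_power[OF two e] unfolding simple_V_eq_syz by blast
  show ?thesis
  proof (rule conjI[OF _ conjI]; intro impI allI)
    fix N N' :: "'k rep" assume odd: "odd s" and NN: "(is_Omega ^^ s) (simple_V r) N \<and> (is_Omega_inv ^^ s) (simple_V
      r) N'"
    have m1: "(- 1) ^ s = (- 1 :: 'k)" using odd by simp
    let ?D = "dsum [copies s (P (r + r')), copies (s + 1) (P (r + r' + 1))]"
    \<comment> \<open>\<open>main(2)\<close> is the version with the summands exchanged: the grading
      lists the multiplicity \<open>s + 1\<close> before \<open>s\<close>, the claimed decomposition
      the other way round.\<close>
    have D: "P r' \<otimes>\<^sub>D K \<cong>\<^sub>D ?D" if K: "D4_module K \<and> graded K ((- 1) ^ s * pow_neg1 r) (s + 1) s" for K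
      by (rule main(2)[OF K[THEN conjunct1] K[THEN conjunct2]]) (simp_all only: pow m1, simp_all add: mult.commute)
    show "P r' \<otimes>\<^sub>D N \<cong>\<^sub>D P r' \<otimes>\<^sub>D N' \<and> P r' \<otimes>\<^sub>D N' \<cong>\<^sub>D ?D"
      using both[OF _ D[OF gr] _ D[OF gr] rD] gr NN by blast
  next
    fix N N' :: "'k rep" assume even: "even s" and NN: "(is_Omega ^^ s) (simple_V r) N \<and> (is_Omega_inv ^^ s)
      (simple_V r) N'"
    have m1: "(- 1) ^ s = (1 :: 'k)" using even by simp
    let ?D = "dsum [copies s (P (r + r' + 1)), copies (s + 1) (P (r + r'))]"
    have D: "P r' \<otimes>\<^sub>D K \<cong>\<^sub>D ?D" if K: "D4_module K \<and> graded K ((- 1) ^ s * pow_neg1 r) (s + 1) s" for K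
      by (rule main(2)[OF K[THEN conjunct1] K[THEN conjunct2]]) (simp_all only: pow m1, simp_all add: mult.commute)
    show "P r' \<otimes>\<^sub>D N \<cong>\<^sub>D P r' \<otimes>\<^sub>D N' \<and> P r' \<otimes>\<^sub>D N' \<cong>\<^sub>D ?D"
      using both[OF _ D[OF gr] _ D[OF gr] rD] gr NN by blast
  next
    fix M assume "is_M s r \<eta> M"
    then obtain i where type: "is_type M s s" and i: "i \<in> mono_D4 (M_one r \<eta>) M" unfolding is_M_def by blast
    have ind: "indecomposable M" using type by (simp add: is_type_def)
    have M: "block1 M" by (rule block1_of_M_one[OF two ind i])
    then have Mm: "D4_module M" by (simp add: block1_def)
    obtain \<sigma> where \<sigma>: "\<sigma> = 1 \<or> \<sigma> = - 1" and g: "graded M \<sigma> s s" by (rule graded_of_type[OF two type M])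
    have pows: "pow_neg1 0 = (1 :: 'k)" "pow_neg1 1 = (- 1 :: 'k)" by (simp_all add: pow_neg1_def)
    have "pow_neg1 r' = (1 :: 'k) \<or> pow_neg1 r' = (- 1 :: 'k)" by (simp add: pow_neg1_def)
    then consider "pow_neg1 r' * \<sigma> = 1" | "pow_neg1 r' * \<sigma> = - 1" using \<sigma> by auto
    then show "P r' \<otimes>\<^sub>D M \<cong>\<^sub>D dsum [copies s (P 0), copies s (P 1)]"
    \<comment> \<open>The sign of \<open>b\<close> on the quotient together with \<open>r'\<close>
      decides which eigenspace yields copies of \<open>P 0\<close>. Both eigenspaces have dimension
      \<open>s\<close>, so the two cases differ only in the order of the summands.\<close>
    proof cases
      case 1
      show ?thesis by (rule main(1)[OF Mm g]) (simp_all only: 1 pows)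
    next
      case 2
      show ?thesis by (rule main(2)[OF Mm g]) (simp_all only: 2 pows minus_minus)
    qed
  qed
qed

end
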